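(* Suppose there exist $k\in\{1,2,3,\ldots\}$ and a set $A$ of Boolean formulas such that: (a) $A\in\mathrm{P}$ and $A\cap\mathrm{SAT}$ is $\mathrm{NP}$-complete; (b) each formula $G\in A$ has a strong backdoor $S$ with respect to the unit propagation subsolver with $\|S\|\leq k$; and (c) there is a polynomial-time algorithm that, given $G\in A$, finds a strong backdoor of $G$ with respect to the unit propagation subsolver having the property in (b). Then $\mathrm{P}=\mathrm{NP}$.
   Context: Formulas are encoded as strings over a finite alphabet $\Sigma$; $\mathrm{SAT}$ is the set of satisfiable Boolean formulas. For a formula $F$, $V(F)$ is its set of variables, and $\|X\|$ is the cardinality of a finite set $X$. A CNF formula is viewed as a set of clauses, each clause a set of literals; it is satisfiable iff some assignment makes at least one literal of every clause true. The empty CNF formula is trivially True, and a CNF formula containing the empty clause is trivially False. A partial assignment $a_S$ assigns truth values to the variables of a set $S\subseteq V(F)$; $F[a_S]$ denotes the simplified formula: for each variable $x$ set to True (resp. False), remove every clause containing the literal $x$ (resp. $\overline{x}$) and delete the literal $\overline{x}$ (resp. $x$) from the remaining clauses. A subsolver is a polynomial-time algorithm $A$ such that for each input formula $F$: (i) $A$ either rejects $F$ or determines $F$ (returns a satisfying assignment if $F$ is satisfiable, and proclaims unsatisfiability if $F$ is unsatisfiable); (ii) $A$ determines $F$ whenever $F$ is trivially True or trivially False; (iii) if $A$ determines $F$ then for each variable $x$ and value $v$, $A$ determines $F[v/x]$. The unit propagation subsolver works as follows: while the current formula is neither trivially True nor trivially False and contains a unit clause (a clause with exactly one literal), it takes the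 unit clause whose encoding is lexicographically least, sets its literal to True, and simplifies; if it reaches a trivially True formula it returns the satisfying assignment built, if it reaches a formula containing the empty clause it proclaims unsatisfiability, and otherwise it rejects. A strong backdoor of a formula $F$ for a subsolver $A$ is a nonempty set $S\subseteq V(F)$ such that for every partial assignment $a_S$, $A$ determines $F[a_S]$. *)

theory Defs
  imports Main
begin

text \<open>The finite alphabet Sigma.  S0/S1 are binary digits, SP/SN mark a positive /
negative literal, SC terminates a clause (and an element of a variable set).\<close>
datatype sym = S0 | S1 | SP | SN | SC

fun sym_code :: "sym \<Rightarrow> nat" where
  "sym_code S0 = 0" | "sym_code S1 = 1" | "sym_code SP = 2" | "sym_code SN = 3" | "sym_code SC = 4"

fun bin_pos :: "nat \<Rightarrow> sym list" where
  "bin_pos n = (if n = 0 then [] else bin_pos (n div 2) @ [if even n then S0 else S1])"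

definition bin :: "nat \<Rightarrow> sym list" where
  "bin n = (if n = 0 then [S0] else bin_pos n)"

text \<open>A literal is a pair (variable, polarity): (x,True) is x, (x,False) is the negation of x.\<close>
type_synonym lit = "nat \<times> bool"
type_synonym clause = "lit set"
type_synonym cnf = "clause set"

definition enc_lit :: "lit \<Rightarrow> sym list" where
  "enc_lit l = (if snd l then SP else SN) # bin (fst l)"

definition enc_clause :: "lit list \<Rightarrow> sym list" where
  "enc_clause ls = concat (map enc_lit ls) @ [SC]"

definition enc_cnf :: "lit list list \<Rightarrow> sym list" where
  "enc_cnf cs = concat (map enc_clause cs)"

definition is_formula :: "sym list \<Rightarrow> bool" where
  "is_formula w \<longleftrightarrow> (\<exists>cs. w = enc_cnf cs)"

definition cnf_of :: "sym list \<Rightarrow> cnf" where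
  "cnf_of w = set (map set (SOME cs. w = enc_cnf cs))"

definition enc_varset :: "nat list \<Rightarrow> sym list" where
  "enc_varset xs = concat (map (\<lambda>x. bin x @ [SC]) xs)"

definition vars :: "cnf \<Rightarrow> nat set" where
  "vars F = fst ` \<Union> F"

definition cnf_sat :: "cnf \<Rightarrow> bool" where
  "cnf_sat F \<longleftrightarrow> (\<exists>a :: nat \<Rightarrow> bool. \<forall>C\<in>F. \<exists>l\<in>C. a (fst l) = snd l)"

definition assign :: "cnf \<Rightarrow> nat set \<Rightarrow> (nat \<Rightarrow> bool) \<Rightarrow> cnf" where
  "assign F S a = {C - {(x, \<not> a x) | x. x \<in> S} | C. C \<in> F \<and> \<not> (\<exists>x\<in>S. (x, a x) \<in> C)}"

definition unit_key :: "lit \<Rightarrow> nat list" where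
  "unit_key l = map sym_code (enc_clause [l])"

definition least_unit :: "cnf \<Rightarrow> lit" where
  "least_unit F = (THE l. {l} \<in> F \<and>
     (\<forall>l'. {l'} \<in> F \<and> l' \<noteq> l \<longrightarrow> (unit_key l, unit_key l') \<in> lexord {(a, b). a < b}))"

datatype result = Sat "lit list" | Unsat | Reject

fun up_run :: "nat \<Rightarrow> cnf \<Rightarrow> result" where
  "up_run 0 F = Reject"
| "up_run (Suc n) F =
     (if F = {} then Sat []
      else if {} \<in> F then Unsat
      else if (\<exists>l. {l} \<in> F) then
        (let l = least_unit F in
           case up_run n (assign F {fst l} (\<lambda>_. snd l)) of
             Sat as \<Rightarrow> Sat (l # as)
           | r \<Rightarrow> r)
      else Reject)"

text \<open>Each propagation step removes one variable, so card (vars F) + 1 iterations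
  always suffice; the fuel bound is never the reason for rejection.\<close>
definition unit_prop :: "cnf \<Rightarrow> result" where
  "unit_prop F = up_run (card (vars F) + 1) F"

definition up_determines :: "cnf \<Rightarrow> bool" where
  "up_determines F \<longleftrightarrow> unit_prop F \<noteq> Reject"

definition strong_backdoor_up :: "cnf \<Rightarrow> nat set \<Rightarrow> bool" where
  "strong_backdoor_up F S \<longleftrightarrow> S \<noteq> {} \<and> S \<subseteq> vars F \<and>
     (\<forall>a :: nat \<Rightarrow> bool. up_determines (assign F S a))"

definition SAT :: "sym list set" where
  "SAT = {w. is_formula w \<and> cnf_sat (cnf_of w)}"

text \<open>Single-tape machines.  States: 0 = accept/halt, 1 = reject/halt, 2 = start.
  Tape symbol 0 is the blank; input symbol s is written as sym_code s + 1.\<close>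
definition code :: "sym \<Rightarrow> nat" where
  "code s = sym_code s + 1"

type_synonym config = "nat \<times> (int \<Rightarrow> nat) \<times> int"

record tm =
  tm_states :: nat
  tm_syms :: nat
  tm_delta :: "nat \<Rightarrow> nat \<Rightarrow> nat \<times> nat \<times> int"

record ntm =
  ntm_states :: nat
  ntm_syms :: nat
  ntm_delta :: "nat \<Rightarrow> nat \<Rightarrow> (nat \<times> nat \<times> int) set"

definition wf_tm :: "tm \<Rightarrow> bool" where
  "wf_tm M \<longleftrightarrow> 3 \<le> tm_states M \<and> 6 \<le> tm_syms M \<and>
    (\<forall>q < tm_states M. \<forall>s < tm_syms M. case tm_delta M q s of (q', s', d) \<Rightarrow>
        q' < tm_states M \<and> s' < tm_syms M \<and> d \<in> {-1, 0, 1})"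

definition wf_ntm :: "ntm \<Rightarrow> bool" where
  "wf_ntm M \<longleftrightarrow> 3 \<le> ntm_states M \<and> 6 \<le> ntm_syms M \<and>
    (\<forall>q < ntm_states M. \<forall>s < ntm_syms M. \<forall>(q', s', d) \<in> ntm_delta M q s.
        q' < ntm_states M \<and> s' < ntm_syms M \<and> d \<in> {-1, 0, 1})"

definition init_config :: "sym list \<Rightarrow> config" where
  "init_config w = (2, (\<lambda>i. if 0 \<le> i \<and> i < int (length w) then code (w ! nat i) else 0), 0)"

fun tm_step :: "tm \<Rightarrow> config \<Rightarrow> config" where
  "tm_step M (q, t, h) =
     (if q < 2 then (q, t, h)
      else (case tm_delta M q (t h) of (q', s', d) \<Rightarrow> (q', t(h := s'), h + d)))"

definition tm_run :: "tm \<Rightarrow> sym list \<Rightarrow> nat \<Rightarrow> config" where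
  "tm_run M w n = (tm_step M ^^ n) (init_config w)"

definition ntm_step :: "ntm \<Rightarrow> (config \<times> config) set" where
  "ntm_step M = {((q, t, h), (q', t(h := s'), h + d)) | q t h q' s' d.
                   2 \<le> q \<and> (q', s', d) \<in> ntm_delta M q (t h)}"

definition poly_bound :: "nat \<Rightarrow> nat \<Rightarrow> nat" where
  "poly_bound c n = c * n ^ c + c"

definition in_P :: "sym list set \<Rightarrow> bool" where
  "in_P L \<longleftrightarrow> (\<exists>M c. wf_tm M \<and> (\<forall>w.
      fst (tm_run M w (poly_bound c (length w))) < 2 \<and>
      (fst (tm_run M w (poly_bound c (length w))) = 0 \<longleftrightarrow> w \<in> L)))"

definition in_NP :: "sym list set \<Rightarrow> bool" where
  "in_NP L \<longleftrightarrow> (\<exists>M c. wf_ntm M \<and> (\<forall>w. w \<in> L \<longleftrightarrow>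
      (\<exists>n \<le> poly_bound c (length w). \<exists>t h. (init_config w, (0, t, h)) \<in> ntm_step M ^^ n)))"

definition poly_computable :: "(sym list \<Rightarrow> sym list) \<Rightarrow> bool" where
  "poly_computable f \<longleftrightarrow> (\<exists>M c. wf_tm M \<and> (\<forall>w.
      case tm_run M w (poly_bound c (length w)) of (q, t, h) \<Rightarrow>
        q = 0 \<and> (\<forall>i < length (f w). t (h + int i) = code (f w ! i)) \<and>
        t (h + int (length (f w))) = 0))"

definition NP_complete :: "sym list set \<Rightarrow> bool" where
  "NP_complete L \<longleftrightarrow> in_NP L \<and>
     (\<forall>L'. in_NP L' \<longrightarrow> (\<exists>f. poly_computable f \<and> (\<forall>w. w \<in> L' \<longleftrightarrow> f w \<in> L)))"

definition PP :: "sym list set set" where "PP = {L. in_P L}"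
definition NP :: "sym list set set" where "NP = {L. in_NP L}"

end

theory Submission
  imports Defs "HOL-Library.Sublist"
begin

text \<open>
  A formula with a strong backdoor of size at most \<open>k\<close> is satisfiable iff there are \<open>k\<close> literals over
  its variables from which unit propagation makes every clause true: for a model \<open>a\<close>, take the
  literals of \<open>a\<close> on the backdoor, and conversely every partial assignment that makes all clauses
  true extends to a model, wherever it comes from.  As \<open>k\<close> is fixed, all choices of \<open>k\<close> literals can
  be tried in polynomial time.  Hence \<open>A \<inter> SAT\<close> is in P, and so is every language that reduces to it.

  Polynomial time on single-tape machines is reached through a structured language whose variables
  are stacks: each stack is kept on a track of the tape with its top at cell 0, and a push or a pop
  shifts the track.
\<close>

section \<open>Polynomial bounds\<close>

text \<open>The procedure never simplifies a formula: it overwrites signs in a marked copy and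
  propagates in textual order, whereas \<open>up_run\<close> deletes literals and always takes the
  lexicographically least unit clause. The two runs are not matched step by step. For the values of
  a model it suffices that marking up to a fixed point assigns every variable that the subsolver
  would assign; this is the order independence of unit propagation in the only direction required. A
  word outside \<open>A\<close> may encode no formula at all, so a machine for \<open>A\<close> is
  simulated on the reduced word before the search starts. The set of stacks is fixed once for all
  \<open>k\<close>, while the search nests \<open>k\<close> loops over literals. All loops therefore
  share one stack, on which a sentinel separates the levels.\<close>

definition poly_bounded :: "(nat \<Rightarrow> nat) \<Rightarrow> bool" where
  "poly_bounded f \<longleftrightarrow> (\<exists>d. \<forall>n. f n \<le> (n + 2) ^ d)"

lemma poly_bounded_mono:
  assumes "poly_bounded g" "\<And>n. f n \<le> g n"
  shows "poly_bounded f"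
  using assms unfolding poly_bounded_def by (meson order_trans)

lemma poly_bounded_const: "poly_bounded (\<lambda>_. c)"
proof -
  have "c \<le> (n + 2) ^ c" for n
  proof -
    have "c \<le> 2 ^ c" using less_exp[of c] by simp
    also have "\<dots> \<le> (n + 2) ^ c" by (intro power_mono) auto
    finally show ?thesis .
  qed
  then show ?thesis unfolding poly_bounded_def by blast
qed

lemma poly_bounded_id: "poly_bounded (\<lambda>n. n)"
  unfolding poly_bounded_def by (rule exI[of _ 1]) simp

text \<open>The base \<open>n + 2\<close> is at least 2, also for \<open>n = 0\<close>, so a factor
  2 costs one unit of the exponent. This is why the bounds carry no coefficient.\<close>

lemma poly_bounded_add:
  assumes "poly_bounded f" "poly_bounded g"
  shows "poly_bounded (\<lambda>n. f n + g n)"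
proof -
  obtain a b where f: "\<And>n. f n \<le> (n + 2) ^ a" and g: "\<And>n. g n \<le> (n + 2) ^ b"
    using assms unfolding poly_bounded_def by blast
  have "f n + g n \<le> (n + 2) ^ Suc (a + b)" for n
  proof -
    have "(n + 2) ^ a \<le> (n + 2) ^ (a + b)" "(n + 2) ^ b \<le> (n + 2) ^ (a + b)"
      by (intro power_increasing; simp)+
    moreover have "2 * (n + 2) ^ (a + b) \<le> (n + 2) ^ Suc (a + b)" by simp
    ultimately show ?thesis using f[of n] g[of n] by linarith
  qed
  then show ?thesis unfolding poly_bounded_def by blast
qed

lemma poly_bounded_mult:
  assumes "poly_bounded f" "poly_bounded g"
  shows "poly_bounded (\<lambda>n. f n * g n)"
proof -
  obtain a b where f: "\<And>n. f n \<le> (n + 2) ^ a" and g: "\<And>n. g n \<le> (n + 2) ^ b"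
    using assms unfolding poly_bounded_def by blast
  have "f n * g n \<le> (n + 2) ^ (a + b)" for n
    using mult_mono[OF f[of n] g[of n]] by (simp add: power_add)
  then show ?thesis unfolding poly_bounded_def by blast
qed

lemma poly_bounded_compose:
  assumes "poly_bounded f" "poly_bounded g"
  shows "poly_bounded (\<lambda>n. f (g n))"
proof -
  obtain a b where f: "\<And>n. f n \<le> (n + 2) ^ a" and g: "\<And>n. g n \<le> (n + 2) ^ b"
    using assms unfolding poly_bounded_def by blast
  have "f (g n) \<le> (n + 2) ^ (Suc (Suc b) * a)" for n
  proof -
    \<comment> \<open>The factor 3 obtained here is at most \<open>(n + 2) * (n + 2)\<close>, hence
      the exponent \<open>b + 2\<close>.\<close>
    have "g n + 2 \<le> (n + 2) ^ b + 2 * (n + 2) ^ b" using g[of n] one_le_power[of "n + 2" b] by linarith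
    also have "\<dots> \<le> (n + 2) ^ b * ((n + 2) * (n + 2))" by simp
    finally have "g n + 2 \<le> (n + 2) ^ Suc (Suc b)" by (simp add: algebra_simps)
    then have "(g n + 2) ^ a \<le> ((n + 2) ^ Suc (Suc b)) ^ a" by (intro power_mono) auto
    then show ?thesis using f[of "g n"] by (simp only: power_mult)
  qed
  then show ?thesis unfolding poly_bounded_def by blast
qed

lemma poly_bounded_power:
  assumes "poly_bounded f"
  shows "poly_bounded (\<lambda>n. f n ^ c)"
  by (induction c) (use assms in \<open>auto intro: poly_bounded_const poly_bounded_mult\<close>)

lemmas poly_bounded_intros =
  poly_bounded_const poly_bounded_id poly_bounded_add poly_bounded_mult poly_bounded_power

lemma poly_bounded_poly_bound: "poly_bounded (poly_bound c)"
proof -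
  have "poly_bounded (\<lambda>n. c * n ^ c + c)" by (intro poly_bounded_intros)
  then show ?thesis by (simp add: poly_bound_def[abs_def])
qed

text \<open>In \<open>poly_bound\<close> one constant is coefficient, exponent and summand at once.
  The value \<open>3 ^ d\<close> serves all three roles: \<open>n + 2 \<le> 3 * n\<close> for
  positive \<open>n\<close>, \<open>d \<le> 3 ^ d\<close>, and at \<open>n = 0\<close> the summand
  alone dominates \<open>2 ^ d\<close>.\<close>

lemma poly_bounded_iff: "poly_bounded f \<longleftrightarrow> (\<exists>c. \<forall>n. f n \<le> poly_bound c n)"
proof
  assume "poly_bounded f"
  then obtain d where d: "\<And>n. f n \<le> (n + 2) ^ d" unfolding poly_bounded_def by blast
  have "(n + 2) ^ d \<le> poly_bound (3 ^ d) n" for n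
  proof (cases "n = 0")
    case True
    have "(2::nat) ^ d \<le> 3 ^ d" by (intro power_mono) auto
    from trans_le_add2[OF this] show ?thesis using True by (simp add: poly_bound_def numeral_2_eq_2)
  next
    case False
    have "(n + 2) ^ d \<le> (3 * n) ^ d" using False by (intro power_mono) auto
    also have "\<dots> = 3 ^ d * n ^ d" by (rule power_mult_distrib)
    also have "\<dots> \<le> 3 ^ d * n ^ (3 ^ d)"
    proof (intro mult_left_mono power_increasing)
      have "d < 2 ^ d" by (rule less_exp)
      also have "(2::nat) ^ d \<le> 3 ^ d" by (intro power_mono) auto
      finally show "d \<le> 3 ^ d" by simp
    qed (use False in auto)
    finally show ?thesis by (simp add: poly_bound_def)
  qed
  then show "\<exists>c. \<forall>n. f n \<le> poly_bound c n" using d by (meson order_trans)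
next
  assume "\<exists>c. \<forall>n. f n \<le> poly_bound c n"
  then show "poly_bounded f" using poly_bounded_mono poly_bounded_poly_bound by blast
qed

section \<open>A structured language over stacks\<close>

datatype 'r op = Push 'r nat | Pop 'r

datatype 'r com =
    Skip
  | Ops "('r \<Rightarrow> nat) \<Rightarrow> 'r op list"
  | Seq "'r com" "'r com"
  | Cond "('r \<Rightarrow> nat) \<Rightarrow> bool" "'r com" "'r com"
  | Loop "('r \<Rightarrow> nat) \<Rightarrow> bool" "'r com"

type_synonym 'r store = "'r \<Rightarrow> nat list"

text \<open>Stack entries are nonzero; the value 0 stands for the top of an empty stack.\<close>
definition top0 :: "nat list \<Rightarrow> nat" where
  "top0 xs = (case xs of [] \<Rightarrow> 0 | x # _ \<Rightarrow> x)"

lemma top0_simps [simp]: "top0 [] = 0" "top0 (x # xs) = x"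
  by (simp_all add: top0_def)

abbreviation tops :: "'r store \<Rightarrow> 'r \<Rightarrow> nat" where
  "tops \<sigma> \<equiv> (\<lambda>r. top0 (\<sigma> r))"

fun app_op :: "'r op \<Rightarrow> 'r store \<Rightarrow> 'r store" where
  "app_op (Push r x) \<sigma> = \<sigma>(r := x # \<sigma> r)"
| "app_op (Pop r) \<sigma> = \<sigma>(r := tl (\<sigma> r))"

fun app_opt :: "'r op option \<Rightarrow> 'r store \<Rightarrow> 'r store" where
  "app_opt None \<sigma> = \<sigma>"
| "app_opt (Some p) \<sigma> = app_op p \<sigma>"

text \<open>The next command and the single stack operation depend on the vector of tops alone, so a
  finite control that reads one cell can perform the step. An \<open>Ops\<close> block consults its
  function once, on entry; afterwards it is a constant list.\<close>

fun ctl_step :: "'r com \<Rightarrow> ('r \<Rightarrow> nat) \<Rightarrow> 'r com \<times> 'r op option" where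
  "ctl_step Skip v = (Skip, None)"
| "ctl_step (Ops f) v = (case f v of [] \<Rightarrow> (Skip, None) | p # ps \<Rightarrow> (Ops (\<lambda>_. ps), Some p))"
| "ctl_step (Seq c d) v =
     (if c = Skip then (d, None) else (Seq (fst (ctl_step c v)) d, snd (ctl_step c v)))"
| "ctl_step (Cond b c d) v = (if b v then c else d, None)"
| "ctl_step (Loop b c) v = (if b v then Seq c (Loop b c) else Skip, None)"

fun com_step :: "'r com \<times> 'r store \<Rightarrow> 'r com \<times> 'r store" where
  "com_step (c, \<sigma>) = (fst (ctl_step c (tops \<sigma>)), app_opt (snd (ctl_step c (tops \<sigma>))) \<sigma>)"

text \<open>As \<open>Skip\<close> is a fixed point of \<open>com_step\<close>, \<open>n\<close> is
  an upper bound on the running time and not an exact count.\<close>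

definition runs :: "'r com \<Rightarrow> 'r store \<Rightarrow> nat \<Rightarrow> 'r store \<Rightarrow> bool" where
  "runs c \<sigma> n \<sigma>' \<longleftrightarrow> (com_step ^^ n) (c, \<sigma>) = (Skip, \<sigma>')"

lemma funpow_fixpoint: "f x = x \<Longrightarrow> (f ^^ n) x = x"
  by (induction n) auto

lemma funpow_split: "(f ^^ Suc (a + b)) x = (f ^^ a) ((f ^^ b) (f x))"
  by (simp add: funpow_add funpow_swap1)

lemma runs_mono:
  assumes "runs c \<sigma> m \<sigma>'" "m \<le> n"
  shows "runs c \<sigma> n \<sigma>'"
proof -
  have "n = (n - m) + m" using assms by simp
  then have "(com_step ^^ n) (c, \<sigma>) = (com_step ^^ (n - m)) ((com_step ^^ m) (c, \<sigma>))"
    by (metis comp_apply funpow_add)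
  then show ?thesis using assms by (simp add: runs_def funpow_fixpoint)
qed

lemma runs_Suc: "runs c \<sigma> (Suc n) \<sigma>' \<longleftrightarrow>
    runs (fst (com_step (c, \<sigma>))) (snd (com_step (c, \<sigma>))) n \<sigma>'"
  by (simp add: runs_def funpow_Suc_right del: funpow.simps)

lemma runs_Skip: "runs Skip \<sigma> n \<sigma>"
  by (simp add: runs_def funpow_fixpoint)

lemma runs_const_Ops: "runs (Ops (\<lambda>_. ps)) \<sigma> (length ps + 1) (fold app_op ps \<sigma>)"
  by (induction ps arbitrary: \<sigma>) (simp_all add: runs_Suc runs_Skip)

lemma runs_Ops:
  assumes "f (tops \<sigma>) = ps" "length ps + 1 \<le> n" "fold app_op ps \<sigma> = \<sigma>'"
  shows "runs (Ops f) \<sigma> n \<sigma>'"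
proof -
  have "runs (Ops f) \<sigma> (length ps + 1) (fold app_op ps \<sigma>)"
  proof (cases ps)
    case (Cons p qs)
    then show ?thesis using runs_const_Ops[of qs "app_op p \<sigma>"] assms(1) by (simp add: runs_Suc)
  qed (use assms(1) in \<open>simp add: runs_Suc runs_Skip\<close>)
  then show ?thesis using runs_mono assms by metis
qed

lemma runs_Seq:
  assumes "runs c \<sigma> m \<sigma>'" "runs d \<sigma>' n \<sigma>''" "m + n + 1 \<le> k"
  shows "runs (Seq c d) \<sigma> k \<sigma>''"
proof -
  have "runs (Seq c d) \<sigma> (m + n + 1) \<sigma>''"
    using assms(1)
  proof (induction m arbitrary: c \<sigma>)
    case 0
    then have "c = Skip" "\<sigma> = \<sigma>'" by (simp_all add: runs_def)
    then show ?case using assms(2) by (simp add: runs_Suc)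
  next
    case (Suc m)
    show ?case
    proof (cases "c = Skip")
      case True
      then have "\<sigma> = \<sigma>'" using Suc.prems runs_Skip[of \<sigma> "Suc m"] by (simp add: runs_def)
      then have "runs (Seq c d) \<sigma> (Suc n) \<sigma>''" using True assms(2) by (simp add: runs_Suc)
      then show ?thesis by (rule runs_mono) simp
    next
      case False
      then show ?thesis using Suc by (simp add: runs_Suc)
    qed
  qed
  then show ?thesis using assms(3) runs_mono by blast
qed

lemma runs_Cond:
  assumes "b (tops \<sigma>) \<Longrightarrow> runs c \<sigma> n \<sigma>'" "\<not> b (tops \<sigma>) \<Longrightarrow> runs d \<sigma> n \<sigma>'" "n + 1 \<le> k"
  shows "runs (Cond b c d) \<sigma> k \<sigma>'"
proof -
  have "runs (Cond b c d) \<sigma> (Suc n) \<sigma>'" using assms(1,2) by (simp add: runs_Suc)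
  then show ?thesis using assms(3) runs_mono[of _ _ "Suc n"] by simp
qed

lemma runs_Loop_done:
  assumes "\<not> b (tops \<sigma>)" "1 \<le> k"
  shows "runs (Loop b c) \<sigma> k \<sigma>"
proof -
  have "runs (Loop b c) \<sigma> (Suc 0) \<sigma>" using assms(1) by (simp add: runs_Suc runs_Skip)
  then show ?thesis using assms(2) runs_mono[of _ _ "Suc 0"] by simp
qed

lemma runs_Loop_step:
  assumes "b (tops \<sigma>)" "runs c \<sigma> m \<sigma>'" "runs (Loop b c) \<sigma>' n \<sigma>''" "m + n + 2 \<le> k"
  shows "runs (Loop b c) \<sigma> k \<sigma>''"
proof -
  have "runs (Loop b c) \<sigma> (Suc (m + n + 1)) \<sigma>''"
    using assms(1) runs_Seq[OF assms(2,3) order_refl] by (simp add: runs_Suc)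
  then show ?thesis using assms(4) by (auto intro: runs_mono)
qed

section \<open>Compilation to single-tape machines\<close>

definition vecs :: "nat \<Rightarrow> ('r \<Rightarrow> nat) set" where
  "vecs B = {v. \<forall>r. v r < B}"

lemma finite_vecs: "finite (vecs B :: ('r::finite \<Rightarrow> nat) set)"
proof -
  have "vecs B = {v. \<forall>r::'r. (r \<in> UNIV \<longrightarrow> v r \<in> {..<B}) \<and> (r \<notin> UNIV \<longrightarrow> v r = 0)}"
    by (auto simp: vecs_def)
  then show ?thesis using finite_set_of_finite_funs[of "UNIV :: 'r set" "{..<B}" 0] by simp
qed

fun ok_op :: "nat \<Rightarrow> 'r op \<Rightarrow> bool" where
  "ok_op B (Push r x) \<longleftrightarrow> 0 < x \<and> x < B"
| "ok_op B (Pop r) \<longleftrightarrow> True"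

primrec ok_com :: "nat \<Rightarrow> 'r com \<Rightarrow> bool" where
  "ok_com B Skip \<longleftrightarrow> True"
| "ok_com B (Ops f) \<longleftrightarrow> (\<forall>v\<in>vecs B. \<forall>p\<in>set (f v). ok_op B p)"
| "ok_com B (Seq c d) \<longleftrightarrow> ok_com B c \<and> ok_com B d"
| "ok_com B (Cond b c d) \<longleftrightarrow> ok_com B c \<and> ok_com B d"
| "ok_com B (Loop b c) \<longleftrightarrow> ok_com B c"

text \<open>A finite set containing every command reachable from the given one while all tops stay
  below \<open>B\<close>; it becomes part of the machine's state. Finiteness hinges on
  \<open>Ops f\<close>, which leaves only suffixes of the lists \<open>f v\<close> for the finitely
  many vectors \<open>v\<close>.\<close>

primrec residuals :: "nat \<Rightarrow> 'r com \<Rightarrow> 'r com set" where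
  "residuals B Skip = {Skip}"
| "residuals B (Ops f) = insert Skip (insert (Ops f)
     ((\<lambda>ps. Ops (\<lambda>_. ps)) ` (\<Union>v\<in>vecs B. set (suffixes (f v)))))"
| "residuals B (Seq c d) = (\<lambda>c'. Seq c' d) ` residuals B c \<union> residuals B d"
| "residuals B (Cond b c d) = insert (Cond b c d) (residuals B c \<union> residuals B d)"
| "residuals B (Loop b c) =
     insert Skip (insert (Loop b c) ((\<lambda>c'. Seq c' (Loop b c)) ` residuals B c))"

lemma finite_residuals: "finite (residuals B (c :: 'r::finite com))"
  by (induction c) (auto simp: finite_vecs)

lemma self_in_residuals: "c \<in> residuals B c"
  by (induction c) auto

lemma residuals_closed:
  assumes "ok_com B c" "v \<in> vecs B" "c' \<in> residuals B c"
  shows "fst (ctl_step c' v) \<in> residuals B c \<and>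
    (case snd (ctl_step c' v) of None \<Rightarrow> True | Some p \<Rightarrow> ok_op B p)"
  using assms
proof (induction c arbitrary: c')
  case Skip
  then show ?case by simp
next
  case (Ops f)
  \<comment> \<open>Stated for a second function \<open>g\<close> so that it covers both
    \<open>f\<close> itself, with \<open>u = v\<close>, and a constant residual.\<close>
  have *: "fst (ctl_step (Ops g) v) \<in> residuals B (Ops f) \<and>
    (case snd (ctl_step (Ops g) v) of None \<Rightarrow> True | Some p \<Rightarrow> ok_op B p)"
    if "g v \<in> set (suffixes (f u))" "u \<in> vecs B" for g u
  proof (cases "g v")
    case (Cons p ps)
    from that Cons have sx: "suffix (p # ps) (f u)" by simp
    then have "suffix ps (f u)" by (meson suffix_ConsD)
    moreover have "p \<in> set (f u)" using sx by (auto simp: suffix_def)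
    moreover have "ps \<in> (\<Union>v\<in>vecs B. set (suffixes (f v)))" if "suffix ps (f u)"
      using that \<open>u \<in> vecs B\<close> by auto
    ultimately show ?thesis using Cons that(2) Ops.prems(1) by (auto intro!: imageI)
  qed simp
  from Ops.prems(3) consider "c' = Skip" | "c' = Ops f"
    | ps u where "c' = Ops (\<lambda>_. ps)" "u \<in> vecs B" "ps \<in> set (suffixes (f u))" by auto
  then show ?case
  proof cases
    case 2
    then show ?thesis using *[of f v] Ops.prems(2) by simp
  next
    case 3
    then show ?thesis using *[of "\<lambda>_. ps" u] by simp
  qed simp
next
  case (Seq c d)
  from Seq.prems(3) consider c1 where "c' = Seq c1 d" "c1 \<in> residuals B c" | "c' \<in> residuals B d"
    by auto
  then show ?case
  proof cases
    case 1
    then show ?thesis using Seq.IH(1)[of c1] Seq.prems self_in_residuals[of d B] by auto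
  next
    case 2
    then show ?thesis using Seq.IH(2)[of c'] Seq.prems by auto
  qed
next
  case (Cond b c d)
  then show ?case using self_in_residuals[of d B] self_in_residuals[of c B] by auto
next
  case (Loop b c)
  from Loop.prems(3) consider "c' = Skip" | "c' = Loop b c"
    | c1 where "c' = Seq c1 (Loop b c)" "c1 \<in> residuals B c" by auto
  then show ?case
  proof cases
    case 2
    then show ?thesis using self_in_residuals[of c B] by auto
  next
    case 3
    then show ?thesis using Loop.IH[of c1] Loop.prems by auto
  qed simp
qed

text \<open>Every stack occupies one track with its top at cell 0, and the Boolean component of a cell
  marks cell 0.  Pushing and popping shift a track: \<open>Ins\<close> carries the displaced entry to the right,
  \<open>Seek\<close> runs to the end of a track and \<open>Del\<close> carries entries to the left.\<close>
datatype 'r ctl =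
    Acc | Rej | Start
  | Home "'r com" | Back "'r com"
  | Ins "'r com" 'r nat | Seek "'r com" 'r | Del "'r com" 'r nat

type_synonym 'r cell = "('r \<Rightarrow> nat) \<times> bool"

text \<open>A push leaves the head at the far end, hence the separate return \<open>Back\<close>. A
  pop starts \<open>Del\<close> with 0 on the first blank cell of the track; every entry is then
  written one cell to the left, and the sweep ends on the marked cell without a further
  return.\<close>

fun ctl_delta :: "(('r \<Rightarrow> nat) \<Rightarrow> bool) \<Rightarrow> 'r com \<Rightarrow> 'r ctl \<Rightarrow> 'r cell \<Rightarrow> 'r ctl \<times> 'r cell \<times> int" where
  "ctl_delta acc c0 Acc s = (Acc, s, 0)"
| "ctl_delta acc c0 Rej s = (Rej, s, 0)"
| "ctl_delta acc c0 Start s = (Home c0, (fst s, True), 0)"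
| "ctl_delta acc c0 (Home c) s =
     (if c = Skip then (if acc (fst s) then Acc else Rej, s, 0)
      else (case ctl_step c (fst s) of
          (c', None) \<Rightarrow> (Home c', s, 0)
        | (c', Some (Push r x)) \<Rightarrow> (Ins c' r (fst s r), ((fst s)(r := x), snd s), 1)
        | (c', Some (Pop r)) \<Rightarrow> (Seek c' r, s, 0)))"
| "ctl_delta acc c0 (Back c) s = (if snd s then (Home c, s, 0) else (Back c, s, -1))"
| "ctl_delta acc c0 (Ins c r x) s =
     (if x = 0 then (Back c, s, 0) else (Ins c r (fst s r), ((fst s)(r := x), snd s), 1))"
| "ctl_delta acc c0 (Seek c r) s = (if fst s r = 0 then (Del c r 0, s, 0) else (Seek c r, s, 1))"
| "ctl_delta acc c0 (Del c r x) s =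
     (if snd s then (Home c, ((fst s)(r := x), snd s), 0)
      else (Del c r (fst s r), ((fst s)(r := x), snd s), -1))"

fun ctl_exec :: "(('r \<Rightarrow> nat) \<Rightarrow> bool) \<Rightarrow> 'r com \<Rightarrow>
    'r ctl \<times> (int \<Rightarrow> 'r cell) \<times> int \<Rightarrow> 'r ctl \<times> (int \<Rightarrow> 'r cell) \<times> int" where
  "ctl_exec acc c0 (q, t, h) =
     (case ctl_delta acc c0 q (t h) of (q', s, d) \<Rightarrow> (q', t(h := s), h + d))"

section \<open>Tracks of the tape and the sweeps that shift them\<close>

definition track :: "nat list \<Rightarrow> int \<Rightarrow> nat" where
  "track xs p = (if 0 \<le> p \<and> nat p < length xs then xs ! nat p else 0)"

lemma track_Nil [simp]: "track [] p = 0"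
  by (simp add: track_def)

lemma track_0: "track xs 0 = top0 xs"
  by (cases xs) (auto simp: track_def)

lemma track_neg: "p < 0 \<Longrightarrow> track xs p = 0"
  by (simp add: track_def)

lemma track_Cons: "track (x # xs) p = (if p = 0 then x else track xs (p - 1))"
proof (cases "p > 0")
  case True
  then obtain n where "p = int (Suc n)" by (metis not0_implies_Suc of_nat_0 order_less_irrefl zero_less_imp_eq_int)
  then show ?thesis by (simp add: track_def nat_add_distrib)
qed (auto simp: track_def)

lemma track_tl: "track (tl xs) p = (if p < 0 then 0 else track xs (p + 1))"
  by (cases xs) (auto simp: track_Cons track_neg)

definition tape_of :: "'r store \<Rightarrow> int \<Rightarrow> 'r cell" where
  "tape_of \<sigma> p = ((\<lambda>r. track (\<sigma> r) p), p = 0)"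

lemma ctl_exec_Back:
  assumes "\<And>i. snd (t i) \<longleftrightarrow> i = 0"
  shows "(ctl_exec acc c0 ^^ Suc n) (Back c, t, int n) = (Home c, t, 0)"
proof (induction n)
  case 0
  then show ?case using assms[of 0] by simp
next
  case (Suc n)
  have "ctl_exec acc c0 (Back c, t, int (Suc n)) = (Back c, t, int n)"
    using assms[of "1 + int n"] by simp
  then show ?case using Suc by (metis comp_apply funpow_Suc_right)
qed

text \<open>Here \<open>x\<close> is the displaced entry and \<open>ys\<close> the track from cell
  \<open>p\<close> on. A carried 0 means that the track had already ended, and the sweep stops
  without moving; for this reason the number \<open>n\<close> of moves is only bounded. The same
  \<open>n\<close> gives the final head position and so the cost of the return.\<close>

lemma ctl_exec_Ins:
  assumes "\<And>i. i \<ge> p \<Longrightarrow> fst (t i) r = track ys (i - p)" "0 \<notin> set ys" "x = 0 \<Longrightarrow> ys = []"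
  shows "\<exists>n \<le> length ys + 1. (ctl_exec acc c0 ^^ Suc n) (Ins c r x, t, p) =
    (Back c, \<lambda>i. if i \<ge> p then ((fst (t i))(r := track (x # ys) (i - p)), snd (t i)) else t i, p + int n)"
  using assms
proof (induction ys arbitrary: x t p)
  case Nil
  let ?t' = "\<lambda>i. if i \<ge> p then ((fst (t i))(r := track [x] (i - p)), snd (t i)) else t i"
  show ?case
  proof (cases "x = 0")
    case True
    have "?t' i = t i" for i using Nil(1)[of i] True by (cases "t i") (auto simp: track_Cons)
    then have "?t' = t" by (rule ext)
    then show ?thesis using True by (intro exI[of _ 0]) simp
  next
    case False
    have t: "?t' i = (t(p := ((fst (t p))(r := x), snd (t p)))) i" for i
      using Nil(1)[of i] by (cases "t i") (auto simp: track_Cons)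
    then have "?t' = t(p := ((fst (t p))(r := x), snd (t p)))" by (rule ext)
    then show ?thesis using False Nil(1)[of p] by (intro exI[of _ 1]) (simp add: fun_upd_idem_iff)
  qed
next
  case (Cons y ys)
  have x: "x \<noteq> 0" and y: "y \<noteq> 0" using Cons.prems by auto
  let ?t1 = "t(p := ((fst (t p))(r := x), snd (t p)))"
  have "\<exists>n \<le> length ys + 1. (ctl_exec acc c0 ^^ Suc n) (Ins c r y, ?t1, p + 1) =
    (Back c, \<lambda>i. if i \<ge> p + 1 then ((fst (?t1 i))(r := track (y # ys) (i - (p + 1))), snd (?t1 i))
       else ?t1 i, p + 1 + int n)"
    using Cons.prems y by (intro Cons.IH) (auto simp: track_Cons algebra_simps)
  then obtain n where n: "n \<le> length ys + 1" and e: "(ctl_exec acc c0 ^^ Suc n) (Ins c r y, ?t1, p + 1) =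
    (Back c, \<lambda>i. if i \<ge> p + 1 then ((fst (?t1 i))(r := track (y # ys) (i - (p + 1))), snd (?t1 i))
       else ?t1 i, p + 1 + int n)"
    by blast
  have p_eq: "p \<le> i \<Longrightarrow> \<not> 1 + p \<le> i \<Longrightarrow> i = p" for i by simp
  have "ctl_exec acc c0 (Ins c r x, t, p) = (Ins c r y, ?t1, p + 1)"
    using x Cons.prems(1)[of p] by (simp add: track_Cons)
  then have "(ctl_exec acc c0 ^^ Suc (Suc n)) (Ins c r x, t, p) =
    (ctl_exec acc c0 ^^ Suc n) (Ins c r y, ?t1, p + 1)"
    by (metis comp_apply funpow_Suc_right)
  also have "\<dots> = (Back c, \<lambda>i. if i \<ge> p then ((fst (t i))(r := track (x # y # ys) (i - p)), snd (t i)) else t i,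
     p + int (Suc n))"
    unfolding e by (auto simp: fun_eq_iff track_Cons[of x] algebra_simps dest!: p_eq)
  finally show ?case using n by (intro exI[of _ "Suc n"]) simp
qed

lemma ctl_exec_Seek:
  assumes "\<And>i. i \<ge> p \<Longrightarrow> fst (t i) r = track ys (i - p)" "0 \<notin> set ys"
  shows "(ctl_exec acc c0 ^^ Suc (length ys)) (Seek c r, t, p) = (Del c r 0, t, p + int (length ys))"
  using assms
proof (induction ys arbitrary: p)
  case Nil
  then show ?case using Nil(1)[of p] by simp
next
  case (Cons y ys)
  have "(ctl_exec acc c0 ^^ Suc (length ys)) (Seek c r, t, p + 1) =
      (Del c r 0, t, p + 1 + int (length ys))"
    using Cons.prems by (intro Cons.IH) (auto simp: track_Cons algebra_simps)
  moreover have "ctl_exec acc c0 (Seek c r, t, p) = (Seek c r, t, p + 1)"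
    using Cons.prems(1)[of p] Cons.prems(2) by (simp add: track_Cons)
  ultimately show ?case
    by (simp add: funpow_Suc_right del: funpow.simps)
qed

lemma ctl_exec_Del:
  assumes "\<And>i. snd (t i) \<longleftrightarrow> i = 0"
  shows "(ctl_exec acc c0 ^^ Suc n) (Del c r x, t, int n) =
    (Home c, \<lambda>i. if 0 \<le> i \<and> i \<le> int n
       then ((fst (t i))(r := if i = int n then x else fst (t (i + 1)) r), snd (t i)) else t i, 0)"
  using assms
proof (induction n arbitrary: x t)
  case 0
  then show ?case using 0[of 0] by (auto simp: fun_eq_iff)
next
  case (Suc n)
  let ?t1 = "t(int (Suc n) := ((fst (t (int (Suc n))))(r := x), snd (t (int (Suc n)))))"
  have e: "ctl_exec acc c0 (Del c r x, t, int (Suc n)) = (Del c r (fst (t (int (Suc n))) r), ?t1, int n)"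
    using Suc.prems[of "1 + int n"] by simp
  have "(ctl_exec acc c0 ^^ Suc (Suc n)) (Del c r x, t, int (Suc n)) =
     (ctl_exec acc c0 ^^ Suc n) (Del c r (fst (t (int (Suc n))) r), ?t1, int n)"
    by (metis comp_apply funpow_Suc_right e)
  also have "\<dots> = (Home c, \<lambda>i. if 0 \<le> i \<and> i \<le> int n
       then ((fst (?t1 i))(r := if i = int n then (fst (t (int (Suc n))) r) else fst (?t1 (i + 1)) r), snd (?t1 i))
       else ?t1 i, 0)"
    using Suc.prems by (intro Suc.IH) auto
  also have "\<dots> = (Home c, \<lambda>i. if 0 \<le> i \<and> i \<le> int (Suc n)
       then ((fst (t i))(r := if i = int (Suc n) then x else fst (t (i + 1)) r), snd (t i)) else t i, 0)"
    by (auto simp: fun_eq_iff algebra_simps)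
  finally show ?case .
qed

definition ok_store :: "nat \<Rightarrow> 'r store \<Rightarrow> bool" where
  "ok_store B \<sigma> \<longleftrightarrow> (\<forall>r. \<forall>x\<in>set (\<sigma> r). 0 < x \<and> x < B)"

text \<open>A push or a pop costs one sweep over the track in each direction, and
  \<open>2 * l + 7\<close> bounds both. At the end the head is again on the marked cell, where all
  tops are visible at once.\<close>

lemma ctl_exec_com_step:
  assumes "c \<noteq> Skip" "com_step (c, \<sigma>) = (c', \<sigma>')" "\<And>r. 0 \<notin> set (\<sigma> r)" "\<And>r. length (\<sigma> r) \<le> l"
  shows "\<exists>n \<le> 2 * l + 7. (ctl_exec acc c0 ^^ n) (Home c, tape_of \<sigma>, 0) = (Home c', tape_of \<sigma>', 0)"
proof -
  have v: "fst (tape_of \<sigma> 0) = tops \<sigma>" by (simp add: tape_of_def track_0)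
  obtain p where p: "ctl_step c (tops \<sigma>) = (c', p)" "\<sigma>' = app_opt p \<sigma>"
    using assms(2) by (cases "ctl_step c (tops \<sigma>)") auto
  consider "p = None" | r x where "p = Some (Push r x)" | r where "p = Some (Pop r)"
    by (metis not_None_eq op.exhaust)
  then show ?thesis
  proof cases
    case 1
    then show ?thesis using p assms(1) by (intro exI[of _ 1]) (simp add: v)
  next
    case (2 r x)
    let ?t = "(tape_of \<sigma>)(0 := ((tops \<sigma>)(r := x), True))"
    have e: "ctl_exec acc c0 (Home c, tape_of \<sigma>, 0) = (Ins c' r (top0 (\<sigma> r)), ?t, 1)"
      using p 2 assms(1) by (simp add: v) (simp add: tape_of_def)
    have "\<exists>n \<le> length (tl (\<sigma> r)) + 1. (ctl_exec acc c0 ^^ Suc n) (Ins c' r (top0 (\<sigma> r)), ?t, 1) =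
      (Back c', \<lambda>i. if i \<ge> 1 then ((fst (?t i))(r := track (top0 (\<sigma> r) # tl (\<sigma> r)) (i - 1)), snd (?t i))
         else ?t i, 1 + int n)"
    proof (rule ctl_exec_Ins)
      show "fst (?t i) r = track (tl (\<sigma> r)) (i - 1)" if "i \<ge> 1" for i
        using that by (simp add: tape_of_def track_tl)
      show "0 \<notin> set (tl (\<sigma> r))" using assms(3)[of r] by (cases "\<sigma> r") auto
      show "tl (\<sigma> r) = []" if "top0 (\<sigma> r) = 0" using that assms(3)[of r] by (cases "\<sigma> r") auto
    qed
    then obtain n where n: "n \<le> length (tl (\<sigma> r)) + 1" and
      f: "(ctl_exec acc c0 ^^ Suc n) (Ins c' r (top0 (\<sigma> r)), ?t, 1) =
      (Back c', \<lambda>i. if i \<ge> 1 then ((fst (?t i))(r := track (top0 (\<sigma> r) # tl (\<sigma> r)) (i - 1)), snd (?t i))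
         else ?t i, 1 + int n)" by blast
    have tr: "track (top0 (\<sigma> r) # tl (\<sigma> r)) j = track (\<sigma> r) j" for j
      by (cases "\<sigma> r") (auto simp: track_Cons)
    have s: "(\<lambda>i. if i \<ge> 1 then ((fst (?t i))(r := track (top0 (\<sigma> r) # tl (\<sigma> r)) (i - 1)), snd (?t i))
         else ?t i) = tape_of \<sigma>'"
      unfolding tr p(2) 2 by (auto simp: fun_eq_iff tape_of_def track_Cons track_0 track_neg)
    have "(ctl_exec acc c0 ^^ Suc (Suc (Suc n) + Suc n)) (Home c, tape_of \<sigma>, 0)
      = (ctl_exec acc c0 ^^ Suc (Suc n)) ((ctl_exec acc c0 ^^ Suc n) (ctl_exec acc c0 (Home c, tape_of \<sigma>, 0)))"
      by (rule funpow_split)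
    also have "\<dots> = (ctl_exec acc c0 ^^ Suc (Suc n)) (Back c', tape_of \<sigma>', int (Suc n))"
      unfolding e f s by simp
    also have "\<dots> = (Home c', tape_of \<sigma>', 0)"
      by (rule ctl_exec_Back) (simp add: tape_of_def)
    finally show ?thesis using n assms(4)[of r]
      by (intro exI[of _ "Suc (Suc (Suc n) + Suc n)"]) (simp add: le_diff_conv2)
  next
    case (3 r)
    let ?L = "length (\<sigma> r)"
    have e: "ctl_exec acc c0 (Home c, tape_of \<sigma>, 0) = (Seek c' r, tape_of \<sigma>, 0)"
      using p 3 assms(1) by (simp add: v)
    have f: "(ctl_exec acc c0 ^^ Suc ?L) (Seek c' r, tape_of \<sigma>, 0) = (Del c' r 0, tape_of \<sigma>, int ?L)"
      using ctl_exec_Seek[of 0 "tape_of \<sigma>" r "\<sigma> r"] assms(3) by (simp add: tape_of_def)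
    have "(ctl_exec acc c0 ^^ Suc (Suc ?L + Suc ?L)) (Home c, tape_of \<sigma>, 0)
      = (ctl_exec acc c0 ^^ Suc ?L) ((ctl_exec acc c0 ^^ Suc ?L) (ctl_exec acc c0 (Home c, tape_of \<sigma>, 0)))"
      by (rule funpow_split)
    also have "\<dots> = (ctl_exec acc c0 ^^ Suc ?L) (Del c' r 0, tape_of \<sigma>, int ?L)"
      unfolding e f ..
    also have "\<dots> = (Home c', \<lambda>i. if 0 \<le> i \<and> i \<le> int ?L
       then ((fst (tape_of \<sigma> i))(r := if i = int ?L then 0 else fst (tape_of \<sigma> (i + 1)) r), snd (tape_of \<sigma> i))
       else tape_of \<sigma> i, 0)"
      by (rule ctl_exec_Del) (simp add: tape_of_def)
    also have "\<dots> = (Home c', tape_of \<sigma>', 0)"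
      unfolding p(2) 3 by (auto simp: fun_eq_iff tape_of_def track_tl) (auto simp: track_def)
    finally show ?thesis using assms(4)[of r] by (intro exI[of _ "Suc (Suc ?L + Suc ?L)"]) simp
  qed
qed

lemma ok_store_com_step:
  assumes "ok_com B c0" "c \<in> residuals B c0" "ok_store B \<sigma>" "0 < B" "com_step (c, \<sigma>) = (c', \<sigma>')"
  shows "c' \<in> residuals B c0 \<and> ok_store B \<sigma>' \<and> (\<forall>r. length (\<sigma>' r) \<le> Suc (length (\<sigma> r)))"
proof -
  have "top0 (\<sigma> r) < B" for r
    using assms(3)[unfolded ok_store_def, rule_format, of _ r] assms(4) by (cases "\<sigma> r") auto
  then have v: "tops \<sigma> \<in> vecs B" by (simp add: vecs_def)
  obtain p where p: "ctl_step c (tops \<sigma>) = (c', p)" "\<sigma>' = app_opt p \<sigma>"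
    using assms(5) by (cases "ctl_step c (tops \<sigma>)") auto
  have tl: "x \<in> set (tl xs) \<Longrightarrow> x \<in> set xs" for x :: nat and xs by (cases xs) auto
  have "c' \<in> residuals B c0 \<and> (case p of None \<Rightarrow> True | Some p \<Rightarrow> ok_op B p)"
    using residuals_closed[OF assms(1) v assms(2)] p(1) by simp
  then show ?thesis using assms(3) p(2)
    by (cases p; cases "the p") (auto simp: ok_store_def dest: tl)
qed

text \<open>A step lengthens a stack by at most one entry, so during \<open>n\<close> steps all
  stacks stay within \<open>l + n\<close> and each step costs at most
  \<open>2 * (l + n) + 7\<close>.\<close>

lemma ctl_exec_runs:
  assumes "ok_com B c0" "0 < B" "c \<in> residuals B c0" "ok_store B \<sigma>" "\<And>r. length (\<sigma> r) \<le> l"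
    "runs c \<sigma> n \<sigma>'"
  shows "\<exists>m \<le> n * (2 * (l + n) + 7). (ctl_exec acc c0 ^^ m) (Home c, tape_of \<sigma>, 0) = (Home Skip, tape_of \<sigma>', 0)"
  using assms(3-)
proof (induction n arbitrary: c \<sigma> l)
  case 0
  then show ?case by (simp add: runs_def)
next
  case (Suc n)
  show ?case
  proof (cases "c = Skip")
    case True
    then have "\<sigma>' = \<sigma>" using Suc.prems(4) runs_Skip[of \<sigma> "Suc n"] by (simp add: runs_def)
    then show ?thesis using True by (intro exI[of _ 0]) simp
  next
    case False
    obtain c1 \<sigma>1 where s: "com_step (c, \<sigma>) = (c1, \<sigma>1)" by fastforce
    note ok = ok_store_com_step[OF assms(1) Suc.prems(1,2) assms(2) s]
    obtain m1 where m1: "m1 \<le> 2 * l + 7"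
      "(ctl_exec acc c0 ^^ m1) (Home c, tape_of \<sigma>, 0) = (Home c1, tape_of \<sigma>1, 0)"
      using ctl_exec_com_step[OF False s, of l acc c0] Suc.prems(2,3) unfolding ok_store_def by blast
    have "length (\<sigma>1 r) \<le> Suc l" for r using ok Suc.prems(3)[of r] by (meson Suc_le_mono order_trans)
    moreover have "runs c1 \<sigma>1 n \<sigma>'" using Suc.prems(4) s by (simp only: runs_Suc fst_conv snd_conv)
    ultimately obtain m2 where m2: "m2 \<le> n * (2 * (Suc l + n) + 7)"
      "(ctl_exec acc c0 ^^ m2) (Home c1, tape_of \<sigma>1, 0) = (Home Skip, tape_of \<sigma>', 0)"
      using Suc.IH[of c1 \<sigma>1 "Suc l"] ok by blast
    have "(ctl_exec acc c0 ^^ (m2 + m1)) (Home c, tape_of \<sigma>, 0) = (Home Skip, tape_of \<sigma>', 0)"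
      using m1(2) m2(2) by (simp add: funpow_add)
    moreover have "m2 + m1 \<le> Suc n * (2 * (l + Suc n) + 7)"
      using m1(1) m2(1) by (simp add: algebra_simps)
    ultimately show ?thesis by blast
  qed
qed

text \<open>Machine states and symbols are numbers, some with a prescribed meaning: 0, 1, 2 for
  accept, reject and start, 0 for the blank, 1 to 5 for the input symbols. The list
  \<open>qs\<close> holds the elements that must receive prescribed numbers.\<close>

lemma finite_numbering:
  assumes "finite Q" "distinct qs" "set qs \<subseteq> Q"
  shows "\<exists>e N. inj_on e Q \<and> (\<forall>x\<in>Q. e x < N) \<and> (\<forall>i < length qs. e (qs ! i) = i) \<and> length qs \<le> (N::nat)"
proof -
  obtain rs where rs: "set rs = Q - set qs" "distinct rs"
    using finite_distinct_list[of "Q - set qs"] assms(1) by auto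
  define xs where "xs = qs @ rs"
  have xs: "distinct xs" "set xs = Q" using rs assms by (auto simp: xs_def)
  define e where "e = inv_into {..<length xs} (nth xs)"
  have inj: "inj_on (nth xs) {..<length xs}" using xs(1) by (simp add: inj_on_nth)
  have im: "nth xs ` {..<length xs} = Q"
    unfolding xs(2)[symmetric] by (auto simp: set_conv_nth)
  have "inj_on e Q" unfolding e_def using im by (metis inj_on_inv_into order_refl)
  moreover have "e x < length xs" if "x \<in> Q" for x
    using that im inv_into_into[of x "nth xs" "{..<length xs}"] unfolding e_def by simp
  moreover have "e (qs ! i) = i" if "i < length qs" for i
    using inv_into_f_f[OF inj, of i] that unfolding e_def by (simp add: xs_def nth_append)
  ultimately show ?thesis by (intro exI[of _ e] exI[of _ "length xs"]) (simp add: xs_def)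
qed

definition ctl_states :: "nat \<Rightarrow> 'r::finite com \<Rightarrow> 'r ctl set" where
  "ctl_states B c = {Acc, Rej, Start} \<union> Home ` residuals B c \<union> Back ` residuals B c
     \<union> (\<lambda>(c, r, x). Ins c r x) ` (residuals B c \<times> UNIV \<times> {..<B})
     \<union> (\<lambda>(c, r). Seek c r) ` (residuals B c \<times> UNIV)
     \<union> (\<lambda>(c, r, x). Del c r x) ` (residuals B c \<times> UNIV \<times> {..<B})"

lemma finite_ctl_states: "finite (ctl_states B c)"
  unfolding ctl_states_def by (auto simp: finite_residuals)

lemma ctl_states_intros:
  "Acc \<in> ctl_states B c" "Rej \<in> ctl_states B c" "Start \<in> ctl_states B c"
  "c' \<in> residuals B c \<Longrightarrow> Home c' \<in> ctl_states B c"
  "c' \<in> residuals B c \<Longrightarrow> Back c' \<in> ctl_states B c"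
  "c' \<in> residuals B c \<Longrightarrow> x < B \<Longrightarrow> Ins c' r x \<in> ctl_states B c"
  "c' \<in> residuals B c \<Longrightarrow> Seek c' r \<in> ctl_states B c"
  "c' \<in> residuals B c \<Longrightarrow> x < B \<Longrightarrow> Del c' r x \<in> ctl_states B c"
  unfolding ctl_states_def by force+

lemma ctl_states_cases:
  assumes "q \<in> ctl_states B c"
  obtains "q = Acc" | "q = Rej" | "q = Start"
  | c' where "q = Home c'" "c' \<in> residuals B c"
  | c' where "q = Back c'" "c' \<in> residuals B c"
  | c' r x where "q = Ins c' r x" "c' \<in> residuals B c" "x < B"
  | c' r where "q = Seek c' r" "c' \<in> residuals B c"
  | c' r x where "q = Del c' r x" "c' \<in> residuals B c" "x < B"
  using assms unfolding ctl_states_def by auto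

lemma ctl_delta_closed:
  assumes "ok_com B c" "0 < B" "q \<in> ctl_states B c" "fst s \<in> vecs B"
    "ctl_delta acc c q s = (q', s', d)"
  shows "q' \<in> ctl_states B c \<and> fst s' \<in> vecs B \<and> d \<in> {-1, 0, 1}"
  using assms(3)
proof (cases rule: ctl_states_cases)
  case (4 c')
  show ?thesis
  proof (cases "c' = Skip")
    case False
    obtain c1 p where p: "ctl_step c' (fst s) = (c1, p)" by fastforce
    have "c1 \<in> residuals B c" "case p of None \<Rightarrow> True | Some p \<Rightarrow> ok_op B p"
      using residuals_closed[OF assms(1,4) 4(2)] p by auto
    then show ?thesis using assms(4,5) 4 False p
      by (cases p; cases "the p") (auto simp: vecs_def intro: ctl_states_intros)
  qed (use assms 4 in \<open>auto intro: ctl_states_intros\<close>)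
qed (use assms self_in_residuals[of c B] in
      \<open>auto simp: vecs_def intro: ctl_states_intros split: if_splits\<close>)

lemma tm_run_halted:
  assumes "fst (tm_run M w m) < 2" "m \<le> n"
  shows "tm_run M w n = tm_run M w m"
proof -
  have "tm_step M cfg = cfg" if "fst cfg < 2" for cfg
    using that by (cases cfg) auto
  then have "(tm_step M ^^ (n - m)) (tm_run M w m) = tm_run M w m"
    using assms(1) funpow_fixpoint by metis
  moreover have "n = (n - m) + m" using assms(2) by simp
  ultimately show ?thesis unfolding tm_run_def by (metis comp_apply funpow_add)
qed

text \<open>Numbering control states and cells turns the abstract control into a machine that it
  mirrors step by step. The test \<open>acc\<close> on the final tops decides acceptance, so
  programs need no halting states of their own.\<close>

theorem in_P_if_program:
  fixes c :: "'r::finite com"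
  assumes ok: "ok_com B c" "6 \<le> B"
    and run: "\<And>w. \<exists>\<sigma>'. runs c ((\<lambda>_. [])(inp := map code w)) (T (length w)) \<sigma>' \<and> (acc (tops \<sigma>') \<longleftrightarrow> w \<in> L)"
    and poly: "poly_bounded T"
  shows "in_P L"
proof -
  define Q where "Q = ctl_states B c"
  define \<Gamma> :: "'r cell set" where "\<Gamma> = vecs B \<times> UNIV"
  \<comment> \<open>An input symbol is identified with a cell that carries it on the track
    \<open>inp\<close>, blank elsewhere and unmarked; \<open>ltr 0\<close> is the blank cell. The
    mark on cell 0 is written by the first step, from \<open>Start\<close>.\<close>
  define ltr :: "nat \<Rightarrow> 'r cell" where "ltr i = ((\<lambda>_. 0)(inp := i), False)" for i
  have "finite Q" "distinct [Acc, Rej, Start]" "set [Acc, Rej, Start] \<subseteq> Q"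
    by (auto simp: Q_def finite_ctl_states ctl_states_intros)
  from finite_numbering[OF this] obtain e NQ where
    inj_e: "inj_on e Q" and e_less: "\<And>x. x \<in> Q \<Longrightarrow> e x < NQ" and NQ: "3 \<le> NQ" and
    e_nth: "\<forall>i<3. e ([Acc, Rej, Start] ! i) = i" by (auto simp: numeral_3_eq_3)
  have e3: "e Acc = 0" "e Rej = 1" "e Start = 2"
    using e_nth[rule_format, of 0] e_nth[rule_format, of 1] e_nth[rule_format, of 2] by simp_all
  have "inj ltr"
  proof (rule injI)
    show "x = y" if "ltr x = ltr y" for x y
      using that unfolding ltr_def by (metis fun_upd_same prod.inject)
  qed
  then have "distinct (map ltr [0..<6])" by (simp only: distinct_map) (auto intro: inj_on_subset)
  moreover have "finite \<Gamma>" by (simp add: \<Gamma>_def finite_vecs)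
  moreover have "set (map ltr [0..<6]) \<subseteq> \<Gamma>"
    using ok(2) by (auto simp: ltr_def \<Gamma>_def vecs_def)
  ultimately have "\<exists>g NS. inj_on g \<Gamma> \<and> (\<forall>x\<in>\<Gamma>. g x < NS) \<and>
      (\<forall>i < length (map ltr [0..<6]). g (map ltr [0..<6] ! i) = i) \<and> length (map ltr [0..<6]) \<le> NS"
    by (intro finite_numbering)
  then obtain g NS where
    inj_g: "inj_on g \<Gamma>" and g_less: "\<And>x. x \<in> \<Gamma> \<Longrightarrow> g x < NS" and NS: "6 \<le> NS" and
    g_ltr': "\<forall>i<6. g (map ltr [0..<6] ! i) = i" by (metis length_map length_upt minus_nat.diff_0)
  have g_ltr: "g (ltr i) = i" if "i < 6" for i
    using g_ltr'[rule_format, OF that] that by (simp only: nth_map_upt diff_zero add_0)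
  \<comment> \<open>On numbers that code nothing the machine accepts at once; the value only has to
    satisfy \<open>wf_tm\<close>.\<close>
  define \<delta> where "\<delta> q s = (if q \<in> e ` Q \<and> s \<in> g ` \<Gamma> then
     (case ctl_delta acc c (inv_into Q e q) (inv_into \<Gamma> g s) of (q', s', d) \<Rightarrow> (e q', g s', d))
     else (0, 0, 0))" for q s
  define M where "M = \<lparr>tm_states = NQ, tm_syms = NS, tm_delta = \<delta>\<rparr>"
  have closed: "q' \<in> Q \<and> s' \<in> \<Gamma> \<and> d \<in> {-1, 0, 1}"
    if "q \<in> Q" "s \<in> \<Gamma>" "ctl_delta acc c q s = (q', s', d)" for q s q' s' d
    using ctl_delta_closed[of B c q s acc q' s' d] that ok
    unfolding Q_def \<Gamma>_def by (auto simp: mem_Times_iff)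
  have \<delta>: "\<delta> (e q) (g s) = (case ctl_delta acc c q s of (q', s', d) \<Rightarrow> (e q', g s', d))"
    if "q \<in> Q" "s \<in> \<Gamma>" for q s
    using that inj_e inj_g by (simp add: \<delta>_def)
  have wf: "wf_tm M"
    unfolding wf_tm_def
  proof (intro conjI allI impI)
    fix q s assume "q < tm_states M" "s < tm_syms M"
    show "case tm_delta M q s of (q', s', d) \<Rightarrow>
        q' < tm_states M \<and> s' < tm_syms M \<and> d \<in> {-1, 0, 1}"
    proof (cases "q \<in> e ` Q \<and> s \<in> g ` \<Gamma>")
      case True
      then obtain q0 s0 where qs: "q = e q0" "q0 \<in> Q" "s = g s0" "s0 \<in> \<Gamma>" by blast
      obtain q' s' d where *: "ctl_delta acc c q0 s0 = (q', s', d)" by (metis prod_cases3)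
      show ?thesis using closed[OF qs(2,4) *] \<delta>[OF qs(2,4)] * e_less g_less
        by (simp add: M_def qs)
    next
      case False
      then show ?thesis using NQ NS by (auto simp: M_def \<delta>_def)
    qed
  qed (use NQ NS in \<open>simp_all add: M_def\<close>)
  define tr where "tr = (\<lambda>(q, t :: int \<Rightarrow> 'r cell, h :: int). (e q, g \<circ> t, h))"
  define good where "good = (\<lambda>(q, t :: int \<Rightarrow> 'r cell, h :: int). q \<in> Q \<and> (\<forall>i. t i \<in> \<Gamma>))"
  have step: "tm_step M (tr x) = tr (ctl_exec acc c x) \<and> good (ctl_exec acc c x)" if "good x" for x
  proof -
    obtain q t h where x: "x = (q, t, h)" by (metis prod_cases3)
    have q: "q \<in> Q" and t: "\<And>i. t i \<in> \<Gamma>" using that by (auto simp: x good_def)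
    obtain q' s' d where *: "ctl_delta acc c q (t h) = (q', s', d)" by (metis prod_cases3)
    note cl = closed[OF q t *]
    show ?thesis
    proof (cases "e q < 2")
      case True
      then have "e q = e Acc \<or> e q = e Rej" using e3 by linarith
      then have "q = Acc \<or> q = Rej"
        using q inj_e ctl_states_intros unfolding Q_def by (metis inj_on_def)
      then have "ctl_exec acc c x = x" by (auto simp: x)
      then show ?thesis using True that by (simp add: x tr_def)
    next
      case False
      then show ?thesis using * cl t \<delta>[OF q t[of h]]
        by (auto simp: x tr_def good_def M_def comp_def fun_eq_iff)
    qed
  qed
  have steps: "(tm_step M ^^ n) (tr x) = tr ((ctl_exec acc c ^^ n) x) \<and> good ((ctl_exec acc c ^^ n) x)"
    if "good x" for n x
    by (induction n) (use that step in auto)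
  \<comment> \<open>The two extra steps are the one leaving \<open>Start\<close> and the one from
    \<open>Home Skip\<close> into a halting state.\<close>
  define U where "U n = Suc (Suc (T n * (2 * (n + T n) + 7)))" for n
  have "poly_bounded (\<lambda>n. T n * (2 * (n + T n) + 7) + 2)" by (intro poly_bounded_intros poly)
  then obtain d where d: "\<And>n. U n \<le> poly_bound d n" unfolding poly_bounded_iff U_def by auto
  have "fst (tm_run M w (poly_bound d (length w))) < 2 \<and>
      (fst (tm_run M w (poly_bound d (length w))) = 0 \<longleftrightarrow> w \<in> L)" for w
  proof -
    define \<sigma> where "\<sigma> = (\<lambda>_::'r. [])(inp := map code w)"
    obtain \<sigma>' where \<sigma>': "runs c \<sigma> (T (length w)) \<sigma>'" and acc: "acc (tops \<sigma>') \<longleftrightarrow> w \<in> L"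
      using run[of w] by (auto simp: \<sigma>_def)
    have code: "0 < code s" "code s < 6" for s by (cases s; simp add: code_def)+
    have ok\<sigma>: "ok_store B \<sigma>" using ok(2) code unfolding ok_store_def \<sigma>_def
      by (auto intro: order_less_le_trans)
    have B: "0 < B" using ok(2) by simp
    have len: "length (\<sigma> r) \<le> length w" for r by (simp add: \<sigma>_def)
    obtain m where m: "m \<le> T (length w) * (2 * (length w + T (length w)) + 7)"
      and e: "(ctl_exec acc c ^^ m) (Home c, tape_of \<sigma>, 0) = (Home Skip, tape_of \<sigma>', 0)"
      using ctl_exec_runs[OF ok(1) B self_in_residuals ok\<sigma> len \<sigma>'] by blast
    define t where "t i = ltr (track (map code w) i)" for i
    have t_init: "init_config w = tr (Start, t, 0)"
      using code by (auto simp: init_config_def tr_def t_def e3 g_ltr track_def fun_eq_iff)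
    have good: "good (Start, t, 0)"
      using code ok(2) unfolding good_def t_def ltr_def Q_def \<Gamma>_def vecs_def track_def
      by (auto intro: ctl_states_intros order_less_le_trans)
    have start: "ctl_exec acc c (Start, t, 0) = (Home c, tape_of \<sigma>, 0)"
      by (auto simp: t_def ltr_def tape_of_def \<sigma>_def fun_eq_iff track_0)
    have fin: "ctl_exec acc c (Home Skip, tape_of \<sigma>', 0) =
       (if acc (tops \<sigma>') then Acc else Rej, tape_of \<sigma>', 0)"
      by (simp add: tape_of_def track_0 fun_eq_iff)
    have "(ctl_exec acc c ^^ Suc (m + 1)) (Start, t, 0) = (if acc (tops \<sigma>') then Acc else Rej, tape_of \<sigma>', 0)"
      using e fin start by (metis Suc_eq_plus1 comp_apply funpow.simps(2) funpow_Suc_right)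
    then have r: "tm_run M w (Suc (m + 1)) = (if acc (tops \<sigma>') then 0 else 1, g \<circ> tape_of \<sigma>', 0)"
      using steps[OF good, of "Suc (m + 1)"] unfolding tm_run_def t_init
      by (simp add: tr_def e3 del: funpow.simps)
    have "Suc (m + 1) \<le> poly_bound d (length w)"
      using m d[of "length w"] unfolding U_def by linarith
    from tm_run_halted[OF _ this] r have "tm_run M w (poly_bound d (length w)) = tm_run M w (Suc (m + 1))"
      by simp
    then show ?thesis using r acc by simp
  qed
  then show ?thesis unfolding in_P_def using wf by blast
qed

section \<open>P is contained in NP\<close>

lemma in_P_imp_in_NP:
  assumes "in_P L"
  shows "in_NP L"
proof -
  obtain M c where wf: "wf_tm M" and M: "\<And>w. fst (tm_run M w (poly_bound c (length w))) < 2"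
    "\<And>w. fst (tm_run M w (poly_bound c (length w))) = 0 \<longleftrightarrow> w \<in> L"
    using assms unfolding in_P_def by blast
  define N where "N = \<lparr>ntm_states = tm_states M, ntm_syms = tm_syms M,
    ntm_delta = (\<lambda>q s. {tm_delta M q s})\<rparr>"
  have step: "(x, y) \<in> ntm_step N \<longleftrightarrow> 2 \<le> fst x \<and> y = tm_step M x" for x y
  proof -
    obtain q t h where x: "x = (q, t, h)" by (metis prod_cases3)
    obtain q' s' d where *: "tm_delta M q (t h) = (q', s', d)" by (metis prod_cases3)
    show ?thesis by (auto simp: ntm_step_def N_def x *)
  qed
  have fwd: "(x, y) \<in> ntm_step N ^^ n \<Longrightarrow> y = (tm_step M ^^ n) x" for n x y
    by (induction n arbitrary: y) (auto simp: step)
  have bwd: "(x, (tm_step M ^^ n) x) \<in> ntm_step N ^^ n"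
    if "\<And>m. m < n \<Longrightarrow> 2 \<le> fst ((tm_step M ^^ m) x)" for n x
    using that by (induction n) (auto simp: step intro!: relcompI)
  have "w \<in> L \<longleftrightarrow> (\<exists>n \<le> poly_bound c (length w). \<exists>t h. (init_config w, (0, t, h)) \<in> ntm_step N ^^ n)" for w
  proof
    assume "w \<in> L"
    \<comment> \<open>A halted configuration has no successor under \<open>ntm_step\<close>, so the
      accepting run has to be cut at the first halting time.\<close>
    define n where "n = (LEAST n. fst (tm_run M w n) < 2)"
    have n: "fst (tm_run M w n) < 2" "n \<le> poly_bound c (length w)"
      unfolding n_def using M(1)[of w] by (auto intro: LeastI Least_le)
    have "(init_config w, tm_run M w n) \<in> ntm_step N ^^ n"
      unfolding tm_run_def
    proof (rule bwd)
      show "2 \<le> fst ((tm_step M ^^ m) (init_config w))" if "m < n" for m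
        using not_less_Least[of m "\<lambda>n. fst (tm_run M w n) < 2"] that
        unfolding n_def tm_run_def by simp
    qed
    moreover have "fst (tm_run M w n) = 0"
      using tm_run_halted[OF n] M(2)[of w] \<open>w \<in> L\<close> by simp
    ultimately show "\<exists>n \<le> poly_bound c (length w). \<exists>t h. (init_config w, (0, t, h)) \<in> ntm_step N ^^ n"
      using n(2) by (metis prod.collapse)
  next
    assume "\<exists>n \<le> poly_bound c (length w). \<exists>t h. (init_config w, (0, t, h)) \<in> ntm_step N ^^ n"
    then obtain n t h where n: "n \<le> poly_bound c (length w)" "(init_config w, (0, t, h)) \<in> ntm_step N ^^ n"
      by blast
    then have "tm_run M w n = (0, t, h)" using fwd[of _ _ n] by (simp add: tm_run_def)
    then show "w \<in> L" using tm_run_halted[OF _ n(1), of M w] M(2)[of w] by simp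
  qed
  moreover have "wf_ntm N" using wf by (auto simp: wf_ntm_def wf_tm_def N_def)
  ultimately show ?thesis unfolding in_NP_def by blast
qed

section \<open>Moving and copying stacks\<close>

text \<open>The loop test is repeated inside \<open>Ops\<close> because \<open>ok_com\<close>
  quantifies over all vectors below \<open>B\<close>, including those on which the loop would have
  stopped and \<open>g\<close> might yield 0.\<close>

definition mv :: "(nat \<Rightarrow> bool) \<Rightarrow> 'r \<Rightarrow> ('r \<times> (nat \<Rightarrow> nat)) list \<Rightarrow> 'r com" where
  "mv P a bs = Loop (\<lambda>v. v a \<noteq> 0 \<and> P (v a))
     (Ops (\<lambda>v. if v a \<noteq> 0 \<and> P (v a) then Pop a # map (\<lambda>(b, g). Push b (g (v a))) bs else []))"

lemma ok_mv [simp]: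
  assumes "\<forall>x<B. 0 < x \<longrightarrow> P x \<longrightarrow> (\<forall>p\<in>set bs. 0 < snd p x \<and> snd p x < B)"
  shows "ok_com B (mv P a bs)"
proof -
  have "ok_op B p" if v: "v \<in> vecs B" and "v a \<noteq> 0" "P (v a)"
    and p: "p \<in> set (Pop a # map (\<lambda>(b, g). Push b (g (v a))) bs)" for v p
  proof -
    have "v a < B" using v by (simp add: vecs_def)
    then have "\<forall>p\<in>set bs. 0 < snd p (v a) \<and> snd p (v a) < B" using that assms by simp
    then show ?thesis using p by fastforce
  qed
  then show ?thesis by (simp add: mv_def)
qed

lemma fold_Push:
  assumes "distinct (map fst bs)"
  shows "fold app_op (map (\<lambda>(b, g). Push b (g x)) bs) \<sigma> =
    (\<lambda>r. case map_of bs r of None \<Rightarrow> \<sigma> r | Some g \<Rightarrow> g x # \<sigma> r)"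
  using assms
proof (induction bs arbitrary: \<sigma>)
  case (Cons p bs)
  obtain b g where p: "p = (b, g)" by fastforce
  have "map_of bs b = None" using Cons.prems by (auto simp: map_of_eq_None_iff p)
  moreover have "fold app_op (map (\<lambda>(b, g). Push b (g x)) bs) \<sigma>' =
    (\<lambda>r. case map_of bs r of None \<Rightarrow> \<sigma>' r | Some g \<Rightarrow> g x # \<sigma>' r)" for \<sigma>'
    using Cons by simp
  ultimately show ?case by (simp add: p fun_eq_iff split: option.split)
qed simp

lemma runs_mv:
  assumes "\<sigma> a = xs @ ys" "\<And>x. x \<in> set xs \<Longrightarrow> 0 < x \<and> P x" "ys = [] \<or> \<not> P (hd ys)"
    "distinct (map fst bs)" "a \<notin> set (map fst bs)" "(length bs + 4) * length xs + 1 \<le> n"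
    "\<sigma>' = (\<lambda>r. if r = a then ys else case map_of bs r of None \<Rightarrow> \<sigma> r
             | Some g \<Rightarrow> rev (map g xs) @ \<sigma> r)"
  shows "runs (mv P a bs) \<sigma> n \<sigma>'"
proof -
  have "runs (mv P a bs) \<sigma> ((length bs + 4) * length xs + 1) (\<lambda>r. if r = a then ys else
      case map_of bs r of None \<Rightarrow> \<sigma> r | Some g \<Rightarrow> rev (map g xs) @ \<sigma> r)"
    using assms(1,2)
  proof (induction xs arbitrary: \<sigma>)
    case Nil
    have b: "\<not> (tops \<sigma> a \<noteq> 0 \<and> P (tops \<sigma> a))" using Nil assms(3) by (cases ys) auto
    have eq: "(\<lambda>r. if r = a then ys else
      case map_of bs r of None \<Rightarrow> \<sigma> r | Some g \<Rightarrow> rev (map g []) @ \<sigma> r) = \<sigma>"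
      using Nil by (auto simp: fun_eq_iff split: option.splits)
    show ?case unfolding mv_def eq by (rule runs_Loop_done) (use b in simp_all)
  next
    case (Cons x xs)
    let ?\<sigma> = "\<lambda>r. if r = a then xs @ ys else case map_of bs r of None \<Rightarrow> \<sigma> r | Some g \<Rightarrow> g x # \<sigma> r"
    have x: "tops \<sigma> a = x" "0 < x" "P x" using Cons.prems by auto
    have no_a: "map_of bs a = None" using assms(5) by (auto simp: map_of_eq_None_iff)
    have 1: "runs (Ops (\<lambda>v. if v a \<noteq> 0 \<and> P (v a) then Pop a # map (\<lambda>(b, g). Push b (g (v a))) bs else []))
       \<sigma> (length bs + 2) ?\<sigma>"
    proof (rule runs_Ops)
      show "fold app_op (Pop a # map (\<lambda>(b, g). Push b (g x)) bs) \<sigma> = ?\<sigma>"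
        using no_a Cons.prems(1) by (simp add: fold_Push[OF assms(4)] fun_eq_iff split: option.split)
    qed (use x in auto)
    have 2: "runs (mv P a bs) ?\<sigma> ((length bs + 4) * length xs + 1) (\<lambda>r. if r = a then ys else
      case map_of bs r of None \<Rightarrow> ?\<sigma> r | Some g \<Rightarrow> rev (map g xs) @ ?\<sigma> r)"
      using Cons.prems by (intro Cons.IH) auto
    have 3: "(\<lambda>r. if r = a then ys else case map_of bs r of None \<Rightarrow> ?\<sigma> r | Some g \<Rightarrow> rev (map g xs) @ ?\<sigma> r)
      = (\<lambda>r. if r = a then ys else case map_of bs r of None \<Rightarrow> \<sigma> r | Some g \<Rightarrow> rev (map g (x # xs)) @ \<sigma> r)"
      by (simp add: fun_eq_iff split: option.split)
    show ?case
      using runs_Loop_step[OF _ 1 2[unfolded 3, unfolded mv_def]] x unfolding mv_def by simp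
  qed
  then show ?thesis using assms(6,7) runs_mono by blast
qed

abbreviation always :: "nat \<Rightarrow> bool" where "always \<equiv> (\<lambda>_. True)"

text \<open>Passing through the scratch stack \<open>t\<close> reverses twice, so \<open>a\<close>
  is restored and \<open>b\<close> receives the entries in their original order.\<close>

definition copy :: "'r \<Rightarrow> 'r \<Rightarrow> 'r \<Rightarrow> (nat \<Rightarrow> nat) \<Rightarrow> 'r com" where
  "copy t a b g = Seq (mv always a [(t, id)]) (mv always t [(a, id), (b, g)])"

lemma ok_copy [simp]: "\<forall>x<B. 0 < x \<longrightarrow> 0 < g x \<and> g x < B \<Longrightarrow> ok_com B (copy t a b g)"
  by (simp add: copy_def)

lemma runs_copy:
  assumes "\<sigma> t = []" "0 \<notin> set (\<sigma> a)" "t \<noteq> a" "t \<noteq> b" "a \<noteq> b" "11 * length (\<sigma> a) + 3 \<le> n"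
    "\<sigma>' = \<sigma>(b := map g (\<sigma> a) @ \<sigma> b)"
  shows "runs (copy t a b g) \<sigma> n \<sigma>'"
  unfolding copy_def
proof (rule runs_Seq)
  show "runs (mv always a [(t, id)]) \<sigma> (5 * length (\<sigma> a) + 1) (\<sigma>(a := [], t := rev (\<sigma> a)))"
    by (rule runs_mv[where xs = "\<sigma> a" and ys = "[]"])
      (use assms in \<open>auto simp: fun_eq_iff intro!: gr0I\<close>)
  show "runs (mv always t [(a, id), (b, g)]) (\<sigma>(a := [], t := rev (\<sigma> a))) (6 * length (\<sigma> a) + 1) \<sigma>'"
    by (rule runs_mv[where xs = "rev (\<sigma> a)" and ys = "[]"])
      (use assms in \<open>auto simp: fun_eq_iff rev_map intro!: gr0I\<close>)
qed (use assms in auto)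

definition clear :: "'r \<Rightarrow> 'r com" where
  "clear a = mv always a []"

lemma ok_clear [simp]: "ok_com B (clear a)"
  by (simp add: clear_def)

lemma runs_clear:
  assumes "0 \<notin> set (\<sigma> a)" "4 * length (\<sigma> a) + 1 \<le> n" "\<sigma>' = \<sigma>(a := [])"
  shows "runs (clear a) \<sigma> n \<sigma>'"
  unfolding clear_def
  by (rule runs_mv[where xs = "\<sigma> a" and ys = "[]"]) (use assms in \<open>auto simp: fun_eq_iff intro!: gr0I\<close>)

section \<open>Simulating a Turing machine on two stacks\<close>

text \<open>A tape symbol \<open>s\<close> is stored as \<open>s + 1\<close>, and a state \<open>q\<close> as \<open>q + 1\<close>.  The top of the
  right stack is the scanned cell; cells beyond the end of a stack are blank.\<close>
definition tm_ops :: "tm \<Rightarrow> 'r \<Rightarrow> 'r \<Rightarrow> 'r \<Rightarrow> ('r \<Rightarrow> nat) \<Rightarrow> 'r op list" where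
  "tm_ops M l r q v =
     (if v q - 1 < tm_states M \<and> v r - 1 < tm_syms M then
        case tm_delta M (v q - 1) (v r - 1) of (q', s', d) \<Rightarrow>
          [Pop q, Push q (q' + 1), Pop r] @
          (if d = 0 then [Push r (s' + 1)]
           else if d = 1 then [Push l (s' + 1)]
           else [Push r (s' + 1), Pop l, Push r (if v l = 0 then 1 else v l)])
      else [])"

text \<open>The halting states 0 and 1 are stored as 1 and 2, so \<open>3 \<le> v q\<close> says
  that the machine is still running.\<close>

definition sim_tm :: "tm \<Rightarrow> 'r \<Rightarrow> 'r \<Rightarrow> 'r \<Rightarrow> 'r com" where
  "sim_tm M l r q = Loop (\<lambda>v. 3 \<le> v q) (Ops (tm_ops M l r q))"

lemma wf_tmD:
  assumes "wf_tm M" "q < tm_states M" "s < tm_syms M" "tm_delta M q s = (q', s', d)"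
  shows "q' < tm_states M \<and> s' < tm_syms M \<and> d \<in> {-1, 0, 1}"
proof -
  have "\<forall>q < tm_states M. \<forall>s < tm_syms M. case tm_delta M q s of (q', s', d) \<Rightarrow>
      q' < tm_states M \<and> s' < tm_syms M \<and> d \<in> {-1, 0, 1}"
    using assms(1) unfolding wf_tm_def by (elim conjE)
  from this[rule_format, OF assms(2,3)] show ?thesis unfolding assms(4) by (simp only: prod.case)
qed

lemma ok_sim_tm:
  assumes "wf_tm M" "tm_states M < B" "tm_syms M < B"
  shows "ok_com B (sim_tm M l r q)"
proof -
  have "ok_op B p" if v: "v \<in> vecs B" and p: "p \<in> set (tm_ops M l r q v)" for v p
  proof -
    obtain q' s' d where *: "tm_delta M (v q - 1) (v r - 1) = (q', s', d)" by (metis prod_cases3)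
    have lt: "v q - 1 < tm_states M \<and> v r - 1 < tm_syms M"
    proof (rule ccontr)
      assume "\<not> ?thesis"
      then have "tm_ops M l r q v = []" unfolding tm_ops_def by (rule if_not_P)
      then show False using p by simp
    qed
    then have "q' < tm_states M \<and> s' < tm_syms M" using wf_tmD[OF assms(1) _ _ *] by blast
    moreover have "v l < B" using v by (simp add: vecs_def)
    moreover have "3 \<le> tm_states M" using assms(1) by (simp add: wf_tm_def)
    moreover have "tm_ops M l r q v = [Pop q, Push q (q' + 1), Pop r] @
          (if d = 0 then [Push r (s' + 1)]
           else if d = 1 then [Push l (s' + 1)]
           else [Push r (s' + 1), Pop l, Push r (if v l = 0 then 1 else v l)])"
      unfolding tm_ops_def * if_P[OF lt] by (simp only: prod.case)
    ultimately show ?thesis using p assms(2,3) by (cases "v l = 0"; cases "d = 0"; cases "d = 1") auto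
  qed
  then show ?thesis by (simp add: sim_tm_def)
qed

text \<open>Truncated subtraction makes the top 0 of an empty stack and the stored blank 1 both read
  as the blank 0.\<close>

definition cell_at :: "nat list \<Rightarrow> nat \<Rightarrow> nat" where
  "cell_at xs i = (if i < length xs then xs ! i - 1 else 0)"

lemma cell_at_simps [simp]:
  "cell_at [] i = 0" "cell_at (x # xs) 0 = x - 1" "cell_at (x # xs) (Suc i) = cell_at xs i"
  "cell_at (tl xs) i = cell_at xs (Suc i)"
  by (cases xs; simp add: cell_at_def)+

lemma cell_at_0: "cell_at xs 0 = top0 xs - 1"
  by (cases xs) auto

text \<open>Both stacks are read outward from the head. Explicit blanks at their ends are permitted,
  so a configuration has many representations and nothing has to be trimmed.\<close>

definition tm_rep :: "'r \<Rightarrow> 'r \<Rightarrow> 'r \<Rightarrow> 'r store \<Rightarrow> config \<Rightarrow> bool" where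
  "tm_rep l r q \<sigma> = (\<lambda>(s, t, h). \<sigma> q = [s + 1] \<and> 0 \<notin> set (\<sigma> l) \<and> 0 \<notin> set (\<sigma> r) \<and>
     (\<forall>i. t (h + int i) = cell_at (\<sigma> r) i) \<and> (\<forall>i. t (h - 1 - int i) = cell_at (\<sigma> l) i))"

lemma tm_repI:
  assumes "\<sigma> q = [s + 1]" "0 \<notin> set (\<sigma> l)" "0 \<notin> set (\<sigma> r)" "\<sigma> r = rs" "\<sigma> l = ls"
    "\<And>i. t (h + int i) = cell_at rs i" "\<And>i. t (h - 1 - int i) = cell_at ls i"
  shows "tm_rep l r q \<sigma> (s, t, h)"
  using assms by (simp add: tm_rep_def)

definition tm_valid :: "tm \<Rightarrow> config \<Rightarrow> bool" where
  "tm_valid M = (\<lambda>(s, t, h). s < tm_states M \<and> (\<forall>i. t i < tm_syms M))"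

lemma tm_valid_step: "wf_tm M \<Longrightarrow> tm_valid M cfg \<Longrightarrow> tm_valid M (tm_step M cfg)"
  by (cases cfg) (auto simp: tm_valid_def split: prod.splits dest: wf_tmD)

lemma tm_valid_init: "wf_tm M \<Longrightarrow> tm_valid M (init_config w)"
proof -
  have "code s < 6" for s by (cases s) (auto simp: code_def)
  then show "wf_tm M \<Longrightarrow> tm_valid M (init_config w)"
    by (auto simp: tm_valid_def wf_tm_def init_config_def intro: order_less_le_trans)
qed

lemma tm_ops_step:
  assumes rep: "tm_rep l r q \<sigma> (s, t, h)" and "tm_valid M (s, t, h)" "wf_tm M" "2 \<le> s" "distinct [l, r, q]"
  defines "ps \<equiv> tm_ops M l r q (tops \<sigma>)"
  shows "length ps \<le> 6 \<and> tm_rep l r q (fold app_op ps \<sigma>) (tm_step M (s, t, h)) \<and>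
    length (fold app_op ps \<sigma> r) \<le> length (\<sigma> r) + 2 \<and>
    length (fold app_op ps \<sigma> l) \<le> length (\<sigma> l) + 2 \<and>
    (\<forall>x. x \<notin> {l, r, q} \<longrightarrow> fold app_op ps \<sigma> x = \<sigma> x)"
proof -
  obtain s' y d where \<delta>: "tm_delta M s (t h) = (s', y, d)" by (metis prod_cases3)
  have q: "\<sigma> q = [s + 1]" and nz: "0 \<notin> set (\<sigma> l)" "0 \<notin> set (\<sigma> r)"
    and R: "\<And>i. t (h + int i) = cell_at (\<sigma> r) i" and L: "\<And>i. t (h - 1 - int i) = cell_at (\<sigma> l) i"
    using rep by (auto simp: tm_rep_def)
  have th: "t h = top0 (\<sigma> r) - 1" using R[of 0] by (simp add: cell_at_0)
  have lt: "s < tm_states M" "t h < tm_syms M" using assms(2) by (auto simp: tm_valid_def)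
  then have d: "d \<in> {-1, 0, 1}" using wf_tmD[OF assms(3) _ _ \<delta>] by blast
  have nz': "0 \<notin> set (tl (\<sigma> l))" "0 \<notin> set (tl (\<sigma> r))" using nz by (cases "\<sigma> l"; cases "\<sigma> r"; simp)+
  have tops: "tops \<sigma> q - 1 = s" "tops \<sigma> r - 1 = t h" using q th by auto
  have ps: "ps = [Pop q, Push q (s' + 1), Pop r] @
          (if d = 0 then [Push r (y + 1)]
           else if d = 1 then [Push l (y + 1)]
           else [Push r (y + 1), Pop l, Push r (if top0 (\<sigma> l) = 0 then 1 else top0 (\<sigma> l))])"
    unfolding ps_def tm_ops_def tops using lt \<delta> by simp
  have step: "tm_step M (s, t, h) = (s', t(h := y), h + d)" using assms(4) \<delta> by simp
  consider "d = 0" | "d = 1" | "d = -1" using d by auto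
  then show ?thesis
  proof cases
    case 1
    have R': "(t(h := y)) (h + 0 + int i) = cell_at ((y + 1) # tl (\<sigma> r)) i" for i
      using R[of i] by (cases i) auto
    have L': "(t(h := y)) (h + 0 - 1 - int i) = cell_at (\<sigma> l) i" for i using L[of i] by simp
    have "tm_rep l r q (fold app_op ps \<sigma>) (s', t(h := y), h + 0)"
      by (rule tm_repI[OF _ _ _ _ _ R' L']) (use 1 assms(5) nz nz' q in \<open>auto simp: ps\<close>)
    then show ?thesis using 1 assms(5) unfolding step ps by auto
  next
    case 2
    have R': "(t(h := y)) (h + 1 + int i) = cell_at (tl (\<sigma> r)) i" for i
      using R[of "Suc i"] by (simp add: algebra_simps)
    have L': "(t(h := y)) (h + 1 - 1 - int i) = cell_at ((y + 1) # \<sigma> l) i" for i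
    proof (cases i)
      case (Suc j)
      then show ?thesis using L[of j] by (simp add: algebra_simps)
    qed simp
    have "tm_rep l r q (fold app_op ps \<sigma>) (s', t(h := y), h + 1)"
      by (rule tm_repI[OF _ _ _ _ _ R' L']) (use 2 assms(5) nz nz' q in \<open>auto simp: ps\<close>)
    then show ?thesis using 2 assms(5) unfolding step ps by auto
  next
    case 3
    \<comment> \<open>On a move to the left from an empty left stack, the newly scanned cell is
      materialised as the stored blank 1.\<close>
    have R': "(t(h := y)) (h + - 1 + int i) =
      cell_at ((if top0 (\<sigma> l) = 0 then 1 else top0 (\<sigma> l)) # (y + 1) # tl (\<sigma> r)) i" for i
    proof (cases i)
      case 0
      then show ?thesis using L[of 0] by (simp add: cell_at_0)
    next
      case (Suc j)
      then show ?thesis using R[of j] by (cases j) (auto simp: algebra_simps)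
    qed
    have L': "(t(h := y)) (h + - 1 - 1 - int i) = cell_at (tl (\<sigma> l)) i" for i
      using L[of "Suc i"] by (simp add: algebra_simps)
    have "tm_rep l r q (fold app_op ps \<sigma>) (s', t(h := y), h + - 1)"
      by (rule tm_repI[OF _ _ _ _ _ R' L']) (use 3 assms(5) nz nz' q in \<open>auto simp: ps\<close>)
    then show ?thesis using 3 assms(5) unfolding step ps by auto
  qed
qed

text \<open>Each machine step costs 7 for the operations and 2 for the loop. The time
  \<open>n\<close> need not be the exact halting time: the loop simply ends earlier.\<close>

lemma runs_sim_tm:
  assumes "wf_tm M" "distinct [l, r, q]" "tm_valid M cfg" "tm_rep l r q \<sigma> cfg"
    "fst ((tm_step M ^^ n) cfg) < 2"
  shows "\<exists>\<sigma>'. runs (sim_tm M l r q) \<sigma> (9 * n + 1) \<sigma>' \<and> tm_rep l r q \<sigma>' ((tm_step M ^^ n) cfg) \<and>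
    length (\<sigma>' r) \<le> length (\<sigma> r) + 2 * n \<and> length (\<sigma>' l) \<le> length (\<sigma> l) + 2 * n \<and>
    (\<forall>x. x \<notin> {l, r, q} \<longrightarrow> \<sigma>' x = \<sigma> x)"
  using assms(3-)
proof (induction n arbitrary: cfg \<sigma>)
  case 0
  then have "runs (sim_tm M l r q) \<sigma> 1 \<sigma>"
    unfolding sim_tm_def by (intro runs_Loop_done) (auto simp: tm_rep_def)
  then show ?case using 0 by auto
next
  case (Suc n)
  obtain s t h where cfg: "cfg = (s, t, h)" by (metis prod_cases3)
  show ?case
  proof (cases "s < 2")
    case True
    then have "runs (sim_tm M l r q) \<sigma> (9 * Suc n + 1) \<sigma>"
      unfolding sim_tm_def using Suc.prems(2) by (intro runs_Loop_done) (auto simp: tm_rep_def cfg)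
    moreover have "(tm_step M ^^ Suc n) cfg = cfg" using True by (intro funpow_fixpoint) (simp add: cfg)
    ultimately show ?thesis using Suc.prems(2) by auto
  next
    case False
    define ps where "ps = tm_ops M l r q (tops \<sigma>)"
    let ?\<sigma> = "fold app_op ps \<sigma>"
    have st: "length ps \<le> 6 \<and> tm_rep l r q ?\<sigma> (tm_step M cfg) \<and>
      length (?\<sigma> r) \<le> length (\<sigma> r) + 2 \<and> length (?\<sigma> l) \<le> length (\<sigma> l) + 2 \<and>
      (\<forall>x. x \<notin> {l, r, q} \<longrightarrow> ?\<sigma> x = \<sigma> x)"
      using tm_ops_step[of l r q \<sigma> s t h M] Suc.prems assms(1,2) False unfolding cfg ps_def by simp
    have f: "(tm_step M ^^ Suc n) cfg = (tm_step M ^^ n) (tm_step M cfg)"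
      by (metis comp_apply funpow_Suc_right)
    obtain \<sigma>' where \<sigma>': "runs (sim_tm M l r q) ?\<sigma> (9 * n + 1) \<sigma>'"
      "tm_rep l r q \<sigma>' ((tm_step M ^^ n) (tm_step M cfg))"
      "length (\<sigma>' r) \<le> length (?\<sigma> r) + 2 * n" "length (\<sigma>' l) \<le> length (?\<sigma> l) + 2 * n"
      "\<forall>x. x \<notin> {l, r, q} \<longrightarrow> \<sigma>' x = ?\<sigma> x"
      using Suc.IH[OF tm_valid_step[OF assms(1) Suc.prems(1)], of ?\<sigma>] st Suc.prems(3)
      unfolding f by metis
    have 7: "runs (Ops (tm_ops M l r q)) \<sigma> 7 ?\<sigma>"
      by (rule runs_Ops[of _ _ ps]) (use st in \<open>simp_all add: ps_def\<close>)
    have "3 \<le> tops \<sigma> q" using False Suc.prems(2) by (simp add: cfg tm_rep_def)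
    then have "runs (sim_tm M l r q) \<sigma> (9 * Suc n + 1) \<sigma>'"
      using runs_Loop_step[of "\<lambda>v. 3 \<le> v q", OF _ 7 \<sigma>'(1)[unfolded sim_tm_def]] unfolding sim_tm_def by simp
    then show ?thesis using \<sigma>' st unfolding f by (intro exI[of _ \<sigma>']) auto
  qed
qed

section \<open>Formulas on stacks\<close>

lemma runs_CondT: "b (tops \<sigma>) \<Longrightarrow> runs c \<sigma> n \<sigma>' \<Longrightarrow> n + 1 \<le> k \<Longrightarrow> runs (Cond b c d) \<sigma> k \<sigma>'"
  by (rule runs_Cond) auto

lemma runs_CondF: "\<not> b (tops \<sigma>) \<Longrightarrow> runs d \<sigma> n \<sigma>' \<Longrightarrow> n + 1 \<le> k \<Longrightarrow> runs (Cond b c d) \<sigma> k \<sigma>'"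
  by (rule runs_Cond) auto

lemma ok_Ops: "ok_com B (Ops f) \<longleftrightarrow> (\<forall>v\<in>vecs B. list_all (ok_op B) (f v))"
  by (simp add: list_all_iff)

lemma vecsD: "v \<in> vecs B \<Longrightarrow> v r < B"
  by (simp add: vecs_def)

text \<open>\<open>TL\<close>, \<open>TR\<close>, \<open>TQ\<close> serve the simulated machines.
  \<open>Gr\<close> keeps the formula, \<open>Cr\<close> the literals still to be visited,
  \<open>Sr\<close> the chosen literals, \<open>XR\<close> the reversed marked formula and
  \<open>XF\<close> its part already passed. \<open>Yr\<close> and \<open>Sg\<close> hold the
  variable (reversed) and sign of the current literal, \<open>Y2\<close> the matched digits,
  \<open>Er\<close> a mismatch. \<open>Rr\<close> counts rounds and \<open>Res\<close> collects the
  verdict.\<close>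

datatype reg = Inp | TL | TR | TQ | Gr | Cr | Sr | XR | XF | Yr | Y2 | Tmp | Er | Sg | Zg | Zf | Rr | Res

instance reg :: finite
proof
  have "x \<in> {Inp, TL, TR, TQ, Gr, Cr, Sr, XR, XF, Yr, Y2, Tmp, Er, Sg, Zg, Zf, Rr, Res}" for x
    by (cases x) simp_all
  then have "(UNIV :: reg set) \<subseteq> {Inp, TL, TR, TQ, Gr, Cr, Sr, XR, XF, Yr, Y2, Tmp, Er, Sg, Zg, Zf, Rr, Res}"
    by (rule subsetI)
  then show "finite (UNIV :: reg set)" by (rule finite_subset) simp
qed

text \<open>The stores between phases, with all scratch stacks empty: a specification in this form
  needs no separate frame condition.\<close>

definition st :: "nat list \<Rightarrow> nat list \<Rightarrow> nat list \<Rightarrow> nat list \<Rightarrow> nat list \<Rightarrow> nat list \<Rightarrow> nat list \<Rightarrow>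
    nat list \<Rightarrow> reg store" where
  "st g c s x y sg r res = (\<lambda>_. [])(Gr := g, Cr := c, Sr := s, XR := x, Yr := y, Sg := sg, Rr := r, Res := res)"

lemma st_simps [simp]:
  "st g c s x y sg r res Inp = []" "st g c s x y sg r res TL = []" "st g c s x y sg r res TR = []"
  "st g c s x y sg r res TQ = []" "st g c s x y sg r res Gr = g" "st g c s x y sg r res Cr = c"
  "st g c s x y sg r res Sr = s" "st g c s x y sg r res XR = x" "st g c s x y sg r res XF = []"
  "st g c s x y sg r res Yr = y" "st g c s x y sg r res Y2 = []" "st g c s x y sg r res Tmp = []"
  "st g c s x y sg r res Er = []" "st g c s x y sg r res Sg = sg" "st g c s x y sg r res Zg = []"
  "st g c s x y sg r res Zf = []" "st g c s x y sg r res Rr = r" "st g c s x y sg r res Res = res"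
  by (simp_all add: st_def)

lemma st_upd [simp]:
  "(st g c s x y sg r res)(Gr := z) = st z c s x y sg r res"
  "(st g c s x y sg r res)(Cr := z) = st g z s x y sg r res"
  "(st g c s x y sg r res)(Sr := z) = st g c z x y sg r res"
  "(st g c s x y sg r res)(XR := z) = st g c s z y sg r res"
  "(st g c s x y sg r res)(Yr := z) = st g c s x z sg r res"
  "(st g c s x y sg r res)(Sg := z) = st g c s x y z r res"
  "(st g c s x y sg r res)(Rr := z) = st g c s x y sg z res"
  "(st g c s x y sg r res)(Res := z) = st g c s x y sg r z"
  by (rule ext, simp add: st_def)+

section \<open>Stack encodings of flags, variables and marked formulas\<close>

definition flag :: "bool \<Rightarrow> nat list" where
  "flag b = (if b then [1] else [])"

lemma flag_simps [simp]: "flag True = [1]" "flag False = []" "tl (flag b) = []"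
    "flag b = [] \<longleftrightarrow> \<not> b" "top0 (flag b) = (if b then 1 else 0)" "length (flag b) \<le> 1"
    "0 \<notin> set (flag b)"
  by (simp_all add: flag_def)

definition bits :: "nat \<Rightarrow> nat list" where
  "bits x = map code (bin x)"

declare bin_pos.simps [simp del]

lemma set_bin_pos: "set (bin_pos n) \<subseteq> {S0, S1}"
proof (induction n rule: bin_pos.induct)
  case (1 n)
  then show ?case by (cases "n = 0") (auto simp: bin_pos.simps[of n] bin_pos.simps[of 0])
qed

lemma set_bits: "set (bits x) \<subseteq> {1, 2}"
  using set_bin_pos[of x] by (auto simp: bits_def bin_def code_def)

text \<open>Evaluating a digit string by Horner's rule is a left inverse.\<close>

lemma inj_bin: "inj bin"
proof -
  define val where "val = foldl (\<lambda>a s. 2 * a + (if s = S1 then 1 else 0)) (0::nat)"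
  have "val (bin_pos n) = n" for n
  proof (induction n rule: bin_pos.induct)
    case (1 n)
    show ?case
    proof (cases "n = 0")
      case False
      then have "val (bin_pos n) = 2 * val (bin_pos (n div 2)) + (if even n then 0 else 1)"
        by (simp add: val_def bin_pos.simps[of n])
      also have "\<dots> = n" using 1 False by (simp)
      finally show ?thesis .
    qed (simp add: val_def bin_pos.simps)
  qed
  then have "val (bin n) = n" for n by (simp add: bin_def val_def)
  then show ?thesis by (rule inj_on_inverseI)
qed

lemma inj_code: "inj code"
  by (rule injI, rename_tac a b, case_tac a; case_tac b; simp add: code_def)

lemma bits_eq_iff: "bits x = bits y \<longleftrightarrow> x = y"
  by (simp add: bits_def inj_map_eq_map[OF inj_code] inj_eq[OF inj_bin])

definition sign_code :: "bool \<Rightarrow> nat" where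
  "sign_code b = (if b then 3 else 4)"

text \<open>The sign symbol of a literal also records its status under a partial assignment:
  3/4 unassigned, 6/7 true, 8/9 false (positive/negative literal).\<close>
definition stat :: "(nat \<Rightarrow> bool option) \<Rightarrow> lit \<Rightarrow> nat" where
  "stat m l = (case m (fst l) of None \<Rightarrow> sign_code (snd l)
     | Some b \<Rightarrow> (if b = snd l then (if snd l then 6 else 7) else (if snd l then 8 else 9)))"

lemma stat_range: "stat m l \<in> {3, 4, 6, 7, 8, 9}"
  by (auto simp: stat_def sign_code_def split: option.split)

definition enc_marked :: "(nat \<Rightarrow> bool option) \<Rightarrow> lit \<Rightarrow> nat list" where
  "enc_marked m l = stat m l # bits (fst l)"

definition enc_clauses :: "(nat \<Rightarrow> bool option) \<Rightarrow> lit list list \<Rightarrow> nat list" where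
  "enc_clauses m cs = concat (map (\<lambda>C. concat (map (enc_marked m) C) @ [5]) cs)"

text \<open>A mark replaces the sign symbol in place, so one length bound serves all partial
  assignments.\<close>

lemma length_enc_clauses: "length (enc_clauses m cs) = length (enc_clauses m' cs)"
  by (simp add: enc_clauses_def length_concat comp_def enc_marked_def)

lemma set_bits_bounds: "x \<in> set (bits n) \<Longrightarrow> 0 < x \<and> x \<le> 2"
  using set_bits[of n] by auto

lemma set_enc_clauses: "x \<in> set (enc_clauses m cs) \<Longrightarrow> 0 < x \<and> x < 10"
proof -
  assume "x \<in> set (enc_clauses m cs)"
  then consider "x = 5" | l :: lit where "x = stat m l" | l :: lit where "x \<in> set (bits (fst l))"
    by (auto simp: enc_clauses_def enc_marked_def split: if_splits)
  then show ?thesis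
  proof cases
    case (2 l)
    then show ?thesis using stat_range[of m l] by auto
  next
    case (3 l)
    then show ?thesis using set_bits_bounds[of x "fst l"] by auto
  qed simp
qed

section \<open>Passes over a marked formula\<close>

text \<open>The formula is read in reverse order, so that the sign symbol of a literal is met after its
  variable has been compared with the one stored in \<open>Yr\<close>.  \<open>Zg\<close> records whether all literals of
  the current clause seen so far satisfy the tested property, \<open>Zf\<close> whether some earlier clause did.\<close>
definition pass_body :: "(nat \<Rightarrow> bool \<Rightarrow> nat \<Rightarrow> bool \<times> nat) \<Rightarrow> reg com" where
  "pass_body fl =
     Cond (\<lambda>v. v XR = 5)
       (Ops (\<lambda>v. [Pop XR, Push XF 5] @ (if v Zg \<noteq> 0 then [Pop Zf, Push Zf 1] else []) @ [Pop Zg, Push Zg 1]))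
       (Cond (\<lambda>v. v XR \<le> 2)
         (Ops (\<lambda>v. if v XR = 0 then [] else [Pop XR, Push XF (v XR)] @
            (if v Er = 0 \<and> v Yr = v XR then [Pop Yr, Push Y2 (v XR)] else [Pop Er, Push Er 1])))
         (Seq
           (Ops (\<lambda>v. if v XR = 0 then [] else
              [Pop XR, Push XF (snd (fl (v Sg) (v Er = 0 \<and> v Yr = 0) (v XR))), Pop Er] @
              (if fst (fl (v Sg) (v Er = 0 \<and> v Yr = 0) (v XR)) then [] else [Pop Zg])))
           (mv always Y2 [(Yr, id)])))"

definition pass_loop :: "(nat \<Rightarrow> bool \<Rightarrow> nat \<Rightarrow> bool \<times> nat) \<Rightarrow> reg com" where
  "pass_loop fl = Loop (\<lambda>v. v XR \<noteq> 0) (pass_body fl)"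

definition pass :: "(nat \<Rightarrow> bool \<Rightarrow> nat \<Rightarrow> bool \<times> nat) \<Rightarrow> reg com" where
  "pass fl = Seq (pass_loop fl)
     (Seq (Ops (\<lambda>v. Pop Zg # (if v Zg \<noteq> 0 then [Pop Zf, Push Zf 1] else []))) (mv always XF [(XR, id)]))"

lemma ok_pass:
  assumes "10 < B" "\<And>a b s. 0 < s \<Longrightarrow> s < B \<Longrightarrow> 0 < snd (fl a b s) \<and> snd (fl a b s) < B"
  shows "ok_com B (pass fl)"
  using assms by (simp add: pass_def pass_loop_def pass_body_def ok_Ops vecsD del: ok_com.simps(2))

text \<open>The digit steps of a pass as a pure function on the contents of \<open>Yr\<close>,
  \<open>Y2\<close> and \<open>Er\<close>: matched digits wander from \<open>Yr\<close> to
  \<open>Y2\<close>, and the first mismatch stops the comparison.\<close>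

fun scan :: "nat list \<Rightarrow> nat list \<Rightarrow> nat list \<Rightarrow> nat list \<Rightarrow> nat list \<times> nat list \<times> nat list" where
  "scan [] y y2 e = (y, y2, e)"
| "scan (b # bs) y y2 e =
     (if e = [] \<and> top0 y = b then scan bs (tl y) (b # y2) e else scan bs y y2 [1])"

lemma scan_bad: "scan bs y y2 [Suc 0] = (y, y2, [Suc 0])"
  by (induction bs) auto

text \<open>The invariant \<open>rev y2 @ y\<close> lets one move from \<open>Y2\<close> back
  restore \<open>Yr\<close>, whatever the outcome. Digits are nonzero, so an exhausted
  \<open>y\<close> with top 0 counts as a mismatch.\<close>

lemma scan_correct:
  assumes "scan bs y y2 [] = (y', y2', e')" "0 \<notin> set bs"
  shows "rev y2' @ y' = rev y2 @ y \<and> (y' = [] \<and> e' = [] \<longleftrightarrow> bs = y) \<and>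
    length y2' \<le> length y2 + length bs \<and> e' \<in> {[], [1]}"
  using assms
proof (induction bs arbitrary: y y2)
  case (Cons b bs)
  show ?case
  proof (cases "top0 y = b")
    case True
    then obtain ys where "y = b # ys" using Cons.prems(2) by (cases y) auto
    then show ?thesis using Cons.IH[of ys "b # y2"] Cons.prems by auto
  next
    case False
    then have "(y', y2', e') = (y, y2, [1])" using Cons.prems by (simp add: scan_bad)
    then show ?thesis using False by auto
  qed
qed auto

text \<open>Continuation form: a given run of the loop from the store behind the digits is extended
  to the front. Digits, literals and clauses can thus be prefixed to the same loop without cutting
  it into pieces.\<close>

lemma pass_bits:
  assumes "\<sigma> XR = bs @ rest" "set bs \<subseteq> {1, 2}" "\<sigma> Er \<in> {[], [1]}"
    "scan bs (\<sigma> Yr) (\<sigma> Y2) (\<sigma> Er) = (y', y2', e')"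
    "runs (pass_loop fl) (\<sigma>(XR := rest, XF := rev bs @ \<sigma> XF, Yr := y', Y2 := y2', Er := e')) n \<sigma>'"
    "n + 12 * length bs \<le> k"
  shows "runs (pass_loop fl) \<sigma> k \<sigma>'"
  using assms
proof (induction bs arbitrary: \<sigma> k)
  case Nil
  then have "\<sigma>(XR := rest, XF := rev [] @ \<sigma> XF, Yr := y', Y2 := y2', Er := e') = \<sigma>"
    by (auto simp: fun_eq_iff)
  from Nil.prems(5)[unfolded this] show ?case by (rule runs_mono) (use Nil.prems(6) in simp)
next
  case (Cons b bs)
  define ok where "ok \<longleftrightarrow> \<sigma> Er = [] \<and> top0 (\<sigma> Yr) = b"
  define \<sigma>1 where "\<sigma>1 = (if ok then \<sigma>(XR := bs @ rest, XF := b # \<sigma> XF, Yr := tl (\<sigma> Yr), Y2 := b # \<sigma> Y2)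
    else \<sigma>(XR := bs @ rest, XF := b # \<sigma> XF, Er := [1]))"
  have b: "0 < b" "b \<le> 2" using Cons.prems(2) by auto
  have XR: "\<sigma> XR = b # bs @ rest" using Cons.prems(1) by simp
  have e0: "top0 (\<sigma> Er) = 0 \<longleftrightarrow> \<sigma> Er = []" "tl (\<sigma> Er) = []" using Cons.prems(3) by auto
  have 1: "runs (pass_body fl) \<sigma> 7 \<sigma>1"
    unfolding pass_body_def
  proof (rule runs_CondF, simp add: XR, use b in linarith)
    show "runs (Cond (\<lambda>v. v XR \<le> 2)
         (Ops (\<lambda>v. if v XR = 0 then [] else [Pop XR, Push XF (v XR)] @
            (if v Er = 0 \<and> v Yr = v XR then [Pop Yr, Push Y2 (v XR)] else [Pop Er, Push Er 1])))
         (Seq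
           (Ops (\<lambda>v. if v XR = 0 then [] else
              [Pop XR, Push XF (snd (fl (v Sg) (v Er = 0 \<and> v Yr = 0) (v XR))), Pop Er] @
              (if fst (fl (v Sg) (v Er = 0 \<and> v Yr = 0) (v XR)) then [] else [Pop Zg])))
           (mv always Y2 [(Yr, id)]))) \<sigma> 6 \<sigma>1"
      by (rule runs_CondT, simp add: XR b,
          rule runs_Ops[where ps = "[Pop XR, Push XF b] @ (if ok then [Pop Yr, Push Y2 b] else [Pop Er, Push Er 1])"
            and n = 5])
        (use b e0 in \<open>auto simp: XR ok_def \<sigma>1_def fun_eq_iff\<close>)
  qed simp
  have sc: "scan bs (\<sigma>1 Yr) (\<sigma>1 Y2) (\<sigma>1 Er) = (y', y2', e')"
    using Cons.prems(4) by (auto simp: \<sigma>1_def ok_def)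
  have eq: "\<sigma>1(XR := rest, XF := rev bs @ \<sigma>1 XF, Yr := y', Y2 := y2', Er := e') =
      \<sigma>(XR := rest, XF := rev (b # bs) @ \<sigma> XF, Yr := y', Y2 := y2', Er := e')"
    by (simp add: \<sigma>1_def fun_eq_iff)
  have 2: "runs (pass_loop fl) \<sigma>1 (n + 12 * length bs) \<sigma>'"
  proof (rule Cons.IH[OF _ _ _ sc])
    show "runs (pass_loop fl) (\<sigma>1(XR := rest, XF := rev bs @ \<sigma>1 XF, Yr := y', Y2 := y2', Er := e')) n \<sigma>'"
      unfolding eq by (rule Cons.prems(5))
    show "\<sigma>1 Er \<in> {[], [1]}" using Cons.prems(3) by (simp add: \<sigma>1_def)
    show "\<sigma>1 XR = bs @ rest" by (simp add: \<sigma>1_def)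
  qed (use Cons.prems(2) in simp_all)
  show ?case
    unfolding pass_loop_def
    by (rule runs_Loop_step[OF _ 1 2[unfolded pass_loop_def]]) (use b Cons.prems(6) in \<open>simp_all add: XR\<close>)
qed

lemma pass_lit:
  assumes "\<sigma> XR = rev (enc_marked m l) @ rest" "\<sigma> Y2 = []" "\<sigma> Er = []" "0 \<notin> set (\<sigma> Yr)" "\<sigma> Zg = flag g"
    "fl (top0 (\<sigma> Sg)) (rev (bits (fst l)) = \<sigma> Yr) (stat m l) = (p, s)"
    "runs (pass_loop fl) (\<sigma>(XR := rest, XF := s # bits (fst l) @ \<sigma> XF, Zg := flag (g \<and> p))) n \<sigma>'"
    "n + 20 * length (enc_marked m l) \<le> k"
  shows "runs (pass_loop fl) \<sigma> k \<sigma>'"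
proof -
  let ?b = "bits (fst l)"
  obtain y' y2' e' where sc: "scan (rev ?b) (\<sigma> Yr) (\<sigma> Y2) (\<sigma> Er) = (y', y2', e')" by (metis prod_cases3)
  have "0 \<notin> set (rev ?b)" using set_bits_bounds[of 0 "fst l"] by auto
  note scan = scan_correct[OF sc[unfolded assms(2,3)] this]
  have y': "0 \<notin> set y'" "0 \<notin> set y2'" using assms(4) scan by (metis Un_iff append_Nil rev.simps(1) set_append set_rev)+
  have eq: "top0 e' = 0 \<and> top0 y' = 0 \<longleftrightarrow> rev ?b = \<sigma> Yr"
    using scan y' by (cases y') auto
  have s0: "0 < stat m l" "\<not> stat m l \<le> 2" "stat m l \<noteq> 5" using stat_range[of m l] by auto
  let ?\<sigma>1 = "\<sigma>(XR := stat m l # rest, XF := ?b @ \<sigma> XF, Yr := y', Y2 := y2', Er := e')"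
  let ?\<sigma>2 = "\<sigma>(XR := rest, XF := s # ?b @ \<sigma> XF, Yr := y', Y2 := y2', Zg := flag (g \<and> p))"
  let ?\<sigma>3 = "\<sigma>(XR := rest, XF := s # ?b @ \<sigma> XF, Zg := flag (g \<and> p))"
  have te: "tl e' = []" using scan by auto
  have ops: "runs (Ops (\<lambda>v. if v XR = 0 then [] else
              [Pop XR, Push XF (snd (fl (v Sg) (v Er = 0 \<and> v Yr = 0) (v XR))), Pop Er] @
              (if fst (fl (v Sg) (v Er = 0 \<and> v Yr = 0) (v XR)) then [] else [Pop Zg]))) ?\<sigma>1 5 ?\<sigma>2"
    by (rule runs_Ops[where ps = "[Pop XR, Push XF s, Pop Er] @ (if p then [] else [Pop Zg])"])
      (use assms(3,5,6) s0 te in \<open>auto simp: eq fun_eq_iff\<close>)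
  have mv: "runs (mv always Y2 [(Yr, id)]) ?\<sigma>2 (5 * length ?b + 1) ?\<sigma>3"
    by (rule runs_mv[where xs = y2' and ys = "[]"])
      (use scan y' assms(2) in \<open>auto simp: fun_eq_iff intro!: gr0I\<close>)
  have 1: "runs (pass_body fl) ?\<sigma>1 (5 * length ?b + 9) ?\<sigma>3"
    unfolding pass_body_def
    by (rule runs_CondF, use s0 in simp,
        rule runs_CondF, use s0 in simp, rule runs_Seq[OF ops mv order_refl]) auto
  have 2: "runs (pass_loop fl) ?\<sigma>1 (n + 5 * length ?b + 11) \<sigma>'"
    unfolding pass_loop_def
    by (rule runs_Loop_step[OF _ 1 assms(7)[unfolded pass_loop_def]]) (use s0 in simp_all)
  show ?thesis
    by (rule pass_bits[of \<sigma> "rev ?b" "stat m l # rest", OF _ _ _ sc])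
      (use assms 2 set_bits[of "fst l"] in \<open>auto simp: enc_marked_def\<close>)
qed

lemma pass_lits:
  assumes "\<sigma> XR = rev (concat (map (enc_marked m) C)) @ rest" "\<sigma> Y2 = []" "\<sigma> Er = []" "0 \<notin> set (\<sigma> Yr)"
    "\<sigma> Zg = flag g"
    "\<And>l. l \<in> set C \<Longrightarrow> fl (top0 (\<sigma> Sg)) (rev (bits (fst l)) = \<sigma> Yr) (stat m l) = (p l, stat m' l)"
    "runs (pass_loop fl) (\<sigma>(XR := rest, XF := concat (map (enc_marked m') C) @ \<sigma> XF,
        Zg := flag (g \<and> (\<forall>l\<in>set C. p l)))) n \<sigma>'"
    "n + 20 * length (concat (map (enc_marked m) C)) \<le> k"
  shows "runs (pass_loop fl) \<sigma> k \<sigma>'"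
  using assms
proof (induction C arbitrary: rest n k)
  case Nil
  then have "\<sigma>(XR := rest, XF := concat (map (enc_marked m') []) @ \<sigma> XF, Zg := flag (g \<and> (\<forall>l\<in>set []. p l))) = \<sigma>"
    by (auto simp: fun_eq_iff)
  from Nil.prems(7)[unfolded this] show ?case by (rule runs_mono) (use Nil.prems(8) in simp)
next
  case (Cons l C)
  show ?case
  \<comment> \<open>In the reversed word the tail \<open>C\<close> is met before \<open>l\<close>,
    so the induction hypothesis is applied first and the head literal belongs to its
    continuation.\<close>
  proof (rule Cons.IH[of "rev (enc_marked m l) @ rest"])
    show "runs (pass_loop fl) (\<sigma>(XR := rev (enc_marked m l) @ rest, XF := concat (map (enc_marked m') C) @ \<sigma> XF,
        Zg := flag (g \<and> (\<forall>l\<in>set C. p l)))) (n + 20 * length (enc_marked m l)) \<sigma>'" (is "runs _ ?\<sigma> _ _")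
    proof (rule pass_lit)
      show "fl (top0 (?\<sigma> Sg)) (rev (bits (fst l)) = ?\<sigma> Yr) (stat m l) = (p l, stat m' l)"
        using Cons.prems(6) by simp
      have eq: "?\<sigma>(XR := rest, XF := stat m' l # bits (fst l) @ ?\<sigma> XF, Zg := flag ((g \<and> (\<forall>l\<in>set C. p l)) \<and> p l))
        = \<sigma>(XR := rest, XF := concat (map (enc_marked m') (l # C)) @ \<sigma> XF,
            Zg := flag (g \<and> (\<forall>l\<in>set (l # C). p l)))"
        by (auto simp: fun_eq_iff enc_marked_def conj_ac)
      show "runs (pass_loop fl) (?\<sigma>(XR := rest, XF := stat m' l # bits (fst l) @ ?\<sigma> XF,
          Zg := flag ((g \<and> (\<forall>l\<in>set C. p l)) \<and> p l))) n \<sigma>'"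
        unfolding eq by (rule Cons.prems(7))
    qed (use Cons.prems in auto)
  qed (use Cons.prems in auto)
qed

text \<open>In reverse order the terminator 5 of a clause is met before its literals, and there the
  result of the clause to its right moves from \<open>Zg\<close> to \<open>Zf\<close>. So after the
  loop the result of the first clause is still in \<open>Zg\<close>, which \<open>pass\<close> adds
  at the end. Initially \<open>Zg\<close> is empty, hence the rightmost terminator reports
  nothing.\<close>

lemma pass_clauses:
  assumes "\<sigma> XR = rev (enc_clauses m cs) @ rest" "\<sigma> Y2 = []" "\<sigma> Er = []" "0 \<notin> set (\<sigma> Yr)"
    "\<sigma> Zg = []" "\<sigma> Zf = []"
    "\<And>l. l \<in> set (concat cs) \<Longrightarrow> fl (top0 (\<sigma> Sg)) (rev (bits (fst l)) = \<sigma> Yr) (stat m l) = (p l, stat m' l)"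
    "runs (pass_loop fl) (\<sigma>(XR := rest, XF := enc_clauses m' cs @ \<sigma> XF,
        Zg := flag (cs \<noteq> [] \<and> (\<forall>l\<in>set (hd cs). p l)),
        Zf := flag (\<exists>C\<in>set (tl cs). \<forall>l\<in>set C. p l))) n \<sigma>'"
    "n + 20 * length (enc_clauses m cs) \<le> k"
  shows "runs (pass_loop fl) \<sigma> k \<sigma>'"
  using assms
proof (induction cs arbitrary: rest n k)
  case Nil
  have "\<sigma>(XR := rest, XF := enc_clauses m' [] @ \<sigma> XF, Zg := [], Zf := []) = \<sigma>"
    using Nil by (auto simp: fun_eq_iff enc_clauses_def)
  then have "runs (pass_loop fl) \<sigma> n \<sigma>'" using Nil.prems(8) by (simp del: fun_upd_apply)
  then show ?case by (rule runs_mono) (use Nil.prems(9) in simp)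
next
  case (Cons C cs)
  let ?c = "concat (map (enc_marked m) C)"
  have split: "enc_clauses m'' (C # cs) = concat (map (enc_marked m'') C) @ 5 # enc_clauses m'' cs" for m''
    by (simp add: enc_clauses_def)
  show ?case
  proof (rule Cons.IH[of "5 # rev ?c @ rest"])
    define g where "g \<longleftrightarrow> cs \<noteq> [] \<and> (\<forall>l\<in>set (hd cs). p l)"
    define f where "f \<longleftrightarrow> (\<exists>C\<in>set (tl cs). \<forall>l\<in>set C. p l)"
    have gf: "f \<or> g \<longleftrightarrow> (\<exists>C\<in>set cs. \<forall>l\<in>set C. p l)" by (cases cs) (auto simp: f_def g_def)
    let ?\<sigma>1 = "\<sigma>(XR := 5 # rev ?c @ rest, XF := enc_clauses m' cs @ \<sigma> XF, Zg := flag g, Zf := flag f)"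
    let ?\<sigma>2 = "\<sigma>(XR := rev ?c @ rest, XF := 5 # enc_clauses m' cs @ \<sigma> XF, Zg := flag True, Zf := flag (f \<or> g))"
    let ?q = "\<forall>l\<in>set C. p l"
    have 1: "runs (pass_body fl) ?\<sigma>1 8 ?\<sigma>2"
      unfolding pass_body_def
      by (rule runs_CondT, simp,
          rule runs_Ops[where ps = "[Pop XR, Push XF 5] @ (if g then [Pop Zf, Push Zf 1] else []) @ [Pop Zg, Push Zg 1]"
            and n = 7]) (auto simp: fun_eq_iff)
    have 2: "runs (pass_loop fl) ?\<sigma>2 (n + 20 * length ?c) \<sigma>'"
    proof (rule pass_lits[where g = True])
      have eq: "\<sigma>(XR := rest, XF := enc_clauses m' (C # cs) @ \<sigma> XF,
          Zg := flag (C # cs \<noteq> [] \<and> (\<forall>l\<in>set (hd (C # cs)). p l)),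
          Zf := flag (\<exists>C\<in>set (tl (C # cs)). \<forall>l\<in>set C. p l)) =
        ?\<sigma>2(XR := rest, XF := concat (map (enc_marked m') C) @ ?\<sigma>2 XF, Zg := flag (True \<and> ?q))"
        by (simp add: split fun_eq_iff gf)
      show "runs (pass_loop fl) (?\<sigma>2(XR := rest, XF := concat (map (enc_marked m') C) @ ?\<sigma>2 XF,
          Zg := flag (True \<and> ?q))) n \<sigma>'"
        unfolding eq[symmetric] by (rule Cons.prems(8))
    qed (use Cons.prems in auto)
    show "runs (pass_loop fl) (\<sigma>(XR := 5 # rev ?c @ rest, XF := enc_clauses m' cs @ \<sigma> XF,
        Zg := flag (cs \<noteq> [] \<and> (\<forall>l\<in>set (hd cs). p l)),
        Zf := flag (\<exists>C\<in>set (tl cs). \<forall>l\<in>set C. p l))) (n + 20 * length ?c + 10) \<sigma>'"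
      unfolding f_def[symmetric] g_def[symmetric]
      unfolding pass_loop_def by (rule runs_Loop_step[OF _ 1 2[unfolded pass_loop_def]]) simp_all
  qed (use Cons.prems in \<open>auto simp: split\<close>)
qed

text \<open>One sweep changes the marks from \<open>m\<close> to \<open>m'\<close> and reports
  whether all literals of some clause satisfy \<open>p\<close>. Marking, the unit test and the final
  check are instances that differ only in \<open>fl\<close>.\<close>

lemma runs_pass:
  assumes "\<And>l. l \<in> set (concat cs) \<Longrightarrow> fl (top0 sg) (rev (bits (fst l)) = y) (stat m l) = (p l, stat m' l)"
    "0 \<notin> set y" "25 * length (enc_clauses m cs) + 9 \<le> n"
  shows "runs (pass fl) (st g c s (rev (enc_clauses m cs)) y sg r res) n
    ((st g c s (rev (enc_clauses m' cs)) y sg r res)(Zf := flag (\<exists>C\<in>set cs. \<forall>l\<in>set C. p l)))"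
proof -
  let ?\<sigma> = "st g c s (rev (enc_clauses m cs)) y sg r res"
  let ?L = "length (enc_clauses m cs)"
  define g' where "g' \<longleftrightarrow> cs \<noteq> [] \<and> (\<forall>l\<in>set (hd cs). p l)"
  define f' where "f' \<longleftrightarrow> (\<exists>C\<in>set (tl cs). \<forall>l\<in>set C. p l)"
  have gf: "(\<exists>C\<in>set cs. \<forall>l\<in>set C. p l) \<longleftrightarrow> f' \<or> g'" by (cases cs) (auto simp: f'_def g'_def)
  let ?\<sigma>1 = "?\<sigma>(XR := [], XF := enc_clauses m' cs, Zg := flag g', Zf := flag f')"
  let ?\<sigma>2 = "?\<sigma>(XR := [], XF := enc_clauses m' cs, Zf := flag (f' \<or> g'))"
  have 1: "runs (pass_loop fl) ?\<sigma> (20 * ?L + 1) ?\<sigma>1"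
  proof (rule pass_clauses[where rest = "[]" and n = 1 and p = p and m' = m' and m = m and cs = cs])
    show "runs (pass_loop fl) (?\<sigma>(XR := [], XF := enc_clauses m' cs @ ?\<sigma> XF,
        Zg := flag (cs \<noteq> [] \<and> (\<forall>l\<in>set (hd cs). p l)),
        Zf := flag (\<exists>C\<in>set (tl cs). \<forall>l\<in>set C. p l))) 1 ?\<sigma>1"
      unfolding f'_def[symmetric] g'_def[symmetric] pass_loop_def
      by (simp del: st_upd) (rule runs_Loop_done; simp del: st_upd)
  qed (use assms in auto)
  have 2: "runs (Ops (\<lambda>v. Pop Zg # (if v Zg \<noteq> 0 then [Pop Zf, Push Zf 1] else []))) ?\<sigma>1 4 ?\<sigma>2"
    by (rule runs_Ops[where ps = "Pop Zg # (if g' then [Pop Zf, Push Zf 1] else [])"])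
      (auto simp: fun_eq_iff simp del: st_upd)
  have 3: "runs (mv always XF [(XR, id)]) ?\<sigma>2 (5 * ?L + 1)
      (?\<sigma>(XR := rev (enc_clauses m' cs), Zf := flag (f' \<or> g')))"
    by (rule runs_mv[where xs = "enc_clauses m' cs" and ys = "[]"])
      (auto simp: fun_eq_iff length_enc_clauses[of m' cs m] simp del: st_upd dest: set_enc_clauses)
  have "runs (pass fl) ?\<sigma> n (?\<sigma>(XR := rev (enc_clauses m' cs), Zf := flag (f' \<or> g')))"
    unfolding pass_def
    by (rule runs_Seq[OF 1 runs_Seq[OF 2 3 order_refl]]) (use assms(3) in simp)
  then show ?thesis by (simp add: gf)
qed

section \<open>Setting a literal and testing for unit clauses\<close>

definition mark_fl :: "nat \<Rightarrow> bool \<Rightarrow> nat \<Rightarrow> bool \<times> nat" where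
  "mark_fl a eq s = (False,
     if eq \<and> s = 3 then (if a = 3 then 6 else 8) else if eq \<and> s = 4 then (if a = 3 then 9 else 7) else s)"

text \<open>The earlier value wins, so marking is monotone even when the search tries contradictory
  literals.\<close>

definition set_lit :: "(nat \<Rightarrow> bool option) \<Rightarrow> lit \<Rightarrow> nat \<Rightarrow> bool option" where
  "set_lit m l = (if m (fst l) = None then m(fst l := Some (snd l)) else m)"

definition mark :: "reg com" where
  "mark = Seq (pass mark_fl) (Ops (\<lambda>_. [Pop Zf]))"

lemma ok_mark: "10 < B \<Longrightarrow> ok_com B mark"
  unfolding mark_def ok_com.simps(3)
  by (intro conjI ok_pass) (auto simp: mark_fl_def)

lemma zero_notin_bits [simp]: "0 \<notin> set (bits x)"
  using set_bits_bounds by blast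

lemma zero_notin_enc_clauses [simp]: "0 \<notin> set (enc_clauses m cs)"
  using set_enc_clauses by blast

lemma st_Zf_clear: "(st g c s x y sg r res)(Zf := []) = st g c s x y sg r res"
  by (rule ext) simp

lemma runs_mark:
  assumes "25 * length (enc_clauses m cs) + 12 \<le> n"
  shows "runs mark (st g c s (rev (enc_clauses m cs)) (rev (bits (fst l))) [sign_code (snd l)] r res) n
    (st g c s (rev (enc_clauses (set_lit m l) cs)) (rev (bits (fst l))) [sign_code (snd l)] r res)"
  (is "runs _ ?\<sigma> _ ?\<sigma>'")
proof -
  have fl: "mark_fl (top0 [sign_code (snd l)]) (rev (bits (fst l')) = rev (bits (fst l))) (stat m l') =
      (False, stat (set_lit m l) l')" for l'
  proof (cases "fst l' = fst l")
    case True
    then show ?thesis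
      by (cases "m (fst l)"; cases "snd l"; cases "snd l'")
        (auto simp: mark_fl_def stat_def set_lit_def sign_code_def)
  next
    case False
    then show ?thesis by (auto simp: mark_fl_def stat_def set_lit_def bits_eq_iff)
  qed
  \<comment> \<open>With \<open>p\<close> constantly false the pass still raises its flag on an
    empty clause; the flag is discarded afterwards.\<close>
  let ?f = "\<exists>C\<in>set cs. \<forall>l\<in>set C. False"
  have 1: "runs (pass mark_fl) ?\<sigma> (25 * length (enc_clauses m cs) + 9) (?\<sigma>'(Zf := flag ?f))"
    by (rule runs_pass[where p = "\<lambda>_. False"], rule fl) simp_all
  have 2: "runs (Ops (\<lambda>_. [Pop Zf])) (?\<sigma>'(Zf := flag ?f)) 2 ?\<sigma>'"
    by (rule runs_Ops[OF refl]) (simp_all add: st_Zf_clear)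
  show ?thesis
    unfolding mark_def by (rule runs_Seq[OF 1 2]) (use assms in simp)
qed

definition unit_fl :: "nat \<Rightarrow> bool \<Rightarrow> nat \<Rightarrow> bool \<times> nat" where
  "unit_fl a eq s = (s = 8 \<or> s = 9 \<or> eq \<and> s = a, s)"

definition try_unit :: "reg com" where
  "try_unit = Seq (pass unit_fl) (Cond (\<lambda>v. v Zf \<noteq> 0) (Seq (Ops (\<lambda>_. [Pop Zf])) mark) Skip)"

text \<open>A clause with all literals false forces every literal. This is harmless: no model agrees
  with such an \<open>m\<close>.\<close>

definition forced :: "lit list list \<Rightarrow> (nat \<Rightarrow> bool option) \<Rightarrow> lit \<Rightarrow> bool" where
  "forced cs m l \<longleftrightarrow> (\<exists>C\<in>set cs. \<forall>l'\<in>set C. m (fst l') = Some (\<not> snd l') \<or> m (fst l') = None \<and> l' = l)"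

definition prop_lit :: "lit list list \<Rightarrow> (nat \<Rightarrow> bool option) \<Rightarrow> lit \<Rightarrow> nat \<Rightarrow> bool option" where
  "prop_lit cs m l = (if forced cs m l then set_lit m l else m)"

lemma ok_try_unit: "10 < B \<Longrightarrow> ok_com B try_unit"
  unfolding try_unit_def ok_com.simps(1,3,4)
  by (intro conjI ok_pass ok_mark) (auto simp: unit_fl_def)

lemma runs_try_unit:
  assumes "50 * length (enc_clauses m cs) + 30 \<le> n"
  shows "runs try_unit (st g c s (rev (enc_clauses m cs)) (rev (bits (fst l))) [sign_code (snd l)] r res) n
    (st g c s (rev (enc_clauses (prop_lit cs m l) cs)) (rev (bits (fst l))) [sign_code (snd l)] r res)"
  (is "runs _ ?\<sigma> _ ?\<sigma>'")
proof -
  define p where "p l' \<longleftrightarrow> m (fst l') = Some (\<not> snd l') \<or> m (fst l') = None \<and> l' = l" for l'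
  have fl: "unit_fl (top0 [sign_code (snd l)]) (rev (bits (fst l')) = rev (bits (fst l))) (stat m l') =
      (p l', stat m l')" for l'
    by (cases "m (fst l')"; cases "snd l"; cases "snd l'")
      (auto simp: unit_fl_def stat_def sign_code_def bits_eq_iff p_def prod_eq_iff)
  have fo: "(\<exists>C\<in>set cs. \<forall>l'\<in>set C. p l') \<longleftrightarrow> forced cs m l"
    by (simp add: forced_def p_def)
  have 1: "runs (pass unit_fl) ?\<sigma> (25 * length (enc_clauses m cs) + 9) (?\<sigma>(Zf := flag (forced cs m l)))"
    unfolding fo[symmetric] by (rule runs_pass[where p = p], rule fl) simp_all
  have 2: "runs (Cond (\<lambda>v. v Zf \<noteq> 0) (Seq (Ops (\<lambda>_. [Pop Zf])) mark) Skip) (?\<sigma>(Zf := flag (forced cs m l)))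
      (25 * length (enc_clauses m cs) + 16) ?\<sigma>'"
  proof (cases "forced cs m l")
    case True
    have a: "runs (Ops (\<lambda>_. [Pop Zf])) (?\<sigma>(Zf := flag (forced cs m l))) 2 ?\<sigma>"
      by (rule runs_Ops[OF refl]) (simp_all add: st_Zf_clear)
    have b: "runs mark ?\<sigma> (25 * length (enc_clauses m cs) + 12) ?\<sigma>'"
      using runs_mark[OF order_refl] True by (simp add: prop_lit_def)
    show ?thesis by (rule runs_CondT[OF _ runs_Seq[OF a b order_refl]]) (use True in simp_all)
  next
    case False
    then have "?\<sigma>(Zf := flag (forced cs m l)) = ?\<sigma>'" by (simp add: prop_lit_def st_Zf_clear)
    then show ?thesis
      by (simp only:) (rule runs_CondF[OF _ runs_Skip[of _ 0]]; simp)
  qed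
  show ?thesis unfolding try_unit_def by (rule runs_Seq[OF 1 2]) (use assms in simp)
qed

section \<open>Iterating over literals\<close>

text \<open>\<open>None\<close> is the end of a clause, so that the word of a formula can itself
  serve as the list of literals to iterate over.\<close>

fun enc_tok :: "lit option \<Rightarrow> nat list" where
  "enc_tok None = [5]"
| "enc_tok (Some l) = sign_code (snd l) # bits (fst l)"

definition enc_toks :: "lit option list \<Rightarrow> nat list" where
  "enc_toks ts = concat (map enc_tok ts)"

lemma enc_toks_simps [simp]: "enc_toks [] = []" "enc_toks (t # ts) = enc_tok t @ enc_toks ts"
  by (simp_all add: enc_toks_def)

lemma zero_notin_enc_toks [simp]: "0 \<notin> set (enc_toks ts)"
proof (induction ts)
  case (Cons t ts)
  then show ?case by (cases t) (auto simp: sign_code_def)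
qed simp

lemma enc_toks_hd: "ts = [] \<or> hd (enc_toks ts) \<in> {3, 4, 5}"
  by (cases ts; cases "hd ts") (auto simp: sign_code_def)

text \<open>The symbol 10, which no formula uses, ends the list on \<open>Cr\<close>. A loop inside
  the body puts its own list with a new sentinel on top, so loops nest to any depth on one
  stack.\<close>

definition for_each :: "reg com \<Rightarrow> reg com" where
  "for_each body =
     Seq (Loop (\<lambda>v. v Cr \<noteq> 10)
       (Cond (\<lambda>v. v Cr = 5) (Ops (\<lambda>_. [Pop Cr]))
         (Seq (Ops (\<lambda>v. [Pop Cr, Push Sg (if v Cr = 4 then 4 else 3)]))
           (Seq (mv (\<lambda>x. x \<le> 2) Cr [(Yr, id)]) body))))
       (Ops (\<lambda>_. [Pop Cr]))"

lemma ok_for_each: "10 < B \<Longrightarrow> ok_com B body \<Longrightarrow> ok_com B (for_each body)"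
  by (simp add: for_each_def)

text \<open>The loop state \<alpha> is visible only through \<open>XR\<close> and
  \<open>Res\<close>. It is a partial assignment when marking or propagating and the Boolean verdict
  when searching.\<close>

lemma runs_for_each:
  fixes xr res :: "'a \<Rightarrow> nat list"
  assumes body: "\<And>\<alpha> l c. Some l \<in> set ts \<Longrightarrow>
      runs body (st g c s (xr \<alpha>) (rev (bits (fst l))) [sign_code (snd l)] r (res \<alpha>)) T
        (st g c s (xr (step l \<alpha>)) [] [] r (res (step l \<alpha>)))"
    and time: "length (enc_toks ts) * (T + 20) + 4 \<le> n"
    and \<beta>: "\<beta> = fold (\<lambda>t \<alpha>. case t of None \<Rightarrow> \<alpha> | Some l \<Rightarrow> step l \<alpha>) ts \<alpha>"
  shows "runs (for_each body) (st g (enc_toks ts @ 10 # c) s (xr \<alpha>) [] [] r (res \<alpha>)) n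
    (st g c s (xr \<beta>) [] [] r (res \<beta>))"
proof -
  let ?c = "Cond (\<lambda>v. v Cr = 5) (Ops (\<lambda>_. [Pop Cr]))
         (Seq (Ops (\<lambda>v. [Pop Cr, Push Sg (if v Cr = 4 then 4 else 3)]))
           (Seq (mv (\<lambda>x. x \<le> 2) Cr [(Yr, id)]) body))"
  let ?st = "\<lambda>ts \<alpha>. st g (enc_toks ts @ 10 # c) s (xr \<alpha>) [] [] r (res \<alpha>)"
  have 1: "runs (Loop (\<lambda>v. v Cr \<noteq> 10) ?c) (?st ts \<alpha>) (length (enc_toks ts) * (T + 20) + 1) (?st [] \<beta>)"
    using body unfolding \<beta>
  proof (induction ts arbitrary: \<alpha>)
    case Nil
    show ?case unfolding fold.simps id_apply by (rule runs_Loop_done) simp_all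
  next
    case (Cons t ts)
    let ?\<beta> = "\<lambda>\<alpha>. fold (\<lambda>t \<alpha>. case t of None \<Rightarrow> \<alpha> | Some l \<Rightarrow> step l \<alpha>) ts \<alpha>"
    have IH: "runs (Loop (\<lambda>v. v Cr \<noteq> 10) ?c) (?st ts \<alpha>) (length (enc_toks ts) * (T + 20) + 1) (?st [] (?\<beta> \<alpha>))" for \<alpha>
      by (rule Cons.IH, rule Cons.prems) simp
    show ?case
    proof (cases t)
      case None
      have a: "runs (Ops (\<lambda>_. [Pop Cr])) (?st (t # ts) \<alpha>) 2 (?st ts \<alpha>)"
        by (rule runs_Ops[OF refl]) (simp_all add: None)
      have b: "runs ?c (?st (t # ts) \<alpha>) 3 (?st ts \<alpha>)"
        by (rule runs_CondT[OF _ a]) (simp_all add: None)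
      show ?thesis
        unfolding fold.simps comp_apply None option.case
        by (rule runs_Loop_step[OF _ b[unfolded None] IH]) simp_all
    next
      case (Some l)
      let ?b = "bits (fst l)"
      let ?s1 = "st g (?b @ enc_toks ts @ 10 # c) s (xr \<alpha>) [] [sign_code (snd l)] r (res \<alpha>)"
      let ?s2 = "st g (enc_toks ts @ 10 # c) s (xr \<alpha>) (rev ?b) [sign_code (snd l)] r (res \<alpha>)"
      have a: "runs (Ops (\<lambda>v. [Pop Cr, Push Sg (if v Cr = 4 then 4 else 3)])) (?st (t # ts) \<alpha>) 3 ?s1"
        by (rule runs_Ops[OF refl]) (simp_all add: Some sign_code_def)
      have hd: "\<not> hd (enc_toks ts @ 10 # c) \<le> 2"
        using enc_toks_hd[of ts] by (cases "enc_toks ts") auto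
      have b: "runs (mv (\<lambda>x. x \<le> 2) Cr [(Yr, id)]) ?s1 (5 * length ?b + 1) ?s2"
      proof (rule runs_mv[where xs = ?b and ys = "enc_toks ts @ 10 # c"])
        show "?s2 = (\<lambda>r'. if r' = Cr then enc_toks ts @ 10 # c
          else case map_of [(Yr, id)] r' of None \<Rightarrow> ?s1 r' | Some g \<Rightarrow> rev (map g ?b) @ ?s1 r')"
          by (rule ext, rename_tac q, case_tac q; simp)
      qed (use hd set_bits_bounds in simp_all)
      have c: "runs body ?s2 T (?st ts (step l \<alpha>))"
        by (rule Cons.prems) (simp add: Some)
      have d: "runs ?c (?st (t # ts) \<alpha>) (T + 5 * length ?b + 7) (?st ts (step l \<alpha>))"
        by (rule runs_CondF[OF _ runs_Seq[OF a runs_Seq[OF b c order_refl] order_refl]])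
          (simp_all add: Some sign_code_def)
      have "T + 5 * length ?b + 9 + (length (enc_toks ts) * (T + 20) + 1) \<le>
          length (enc_toks (t # ts)) * (T + 20) + 1"
        by (simp add: Some algebra_simps)
      then show ?thesis
        unfolding fold.simps comp_apply Some option.case
        by (intro runs_Loop_step[OF _ d[unfolded Some] IH]) (simp_all add: sign_code_def)
    qed
  qed
  have 2: "runs (Ops (\<lambda>_. [Pop Cr])) (?st [] \<beta>) 2 (st g c s (xr \<beta>) [] [] r (res \<beta>))"
    by (rule runs_Ops[OF refl]) simp_all
  show ?thesis unfolding for_each_def by (rule runs_Seq[OF 1 2]) (use time in simp)
qed

definition toks :: "lit list list \<Rightarrow> lit option list" where
  "toks cs = concat (map (\<lambda>C. map Some C @ [None]) cs)"

lemma enc_toks_append: "enc_toks (ts @ us) = enc_toks ts @ enc_toks us"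
  by (simp add: enc_toks_def)

lemma enc_toks_toks: "enc_toks (toks cs) = enc_clauses (\<lambda>_. None) cs"
proof -
  have "enc_toks (map Some C) = concat (map (enc_marked (\<lambda>_. None)) C)" for C
    by (induction C) (simp_all add: enc_marked_def stat_def)
  then show ?thesis
    by (induction cs) (simp_all add: toks_def enc_clauses_def enc_toks_append)
qed

lemma fold_toks:
  "fold (\<lambda>t \<alpha>. case t of None \<Rightarrow> \<alpha> | Some l \<Rightarrow> f l \<alpha>) (toks cs) \<alpha> = fold f (concat cs) \<alpha>"
proof -
  have "fold (\<lambda>t \<alpha>. case t of None \<Rightarrow> \<alpha> | Some l \<Rightarrow> f l \<alpha>) (map Some C) \<alpha> = fold f C \<alpha>" for C \<alpha>
    by (induction C arbitrary: \<alpha>) simp_all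
  then show ?thesis by (induction cs arbitrary: \<alpha>) (simp_all add: toks_def)
qed

lemma length_enc_tok_le: "t \<in> set ts \<Longrightarrow> length (enc_tok t) \<le> length (enc_toks ts)"
  by (induction ts) auto

lemma length_bits_le: "Some l \<in> set ts \<Longrightarrow> length (bits (fst l)) \<le> length (enc_toks ts)"
  using length_enc_tok_le[of "Some l" ts] by simp

section \<open>Searching for a satisfying partial assignment\<close>

definition load :: "reg \<Rightarrow> reg com" where
  "load a = Seq (Ops (\<lambda>_. [Push Cr 10])) (copy Tmp a Cr id)"

lemma ok_load: "10 < B \<Longrightarrow> ok_com B (load a)"
  by (simp add: load_def)

lemma runs_load:
  assumes "a \<in> {Gr, Sr}" "st g c s x y sg r res a = zs" "0 \<notin> set zs" "11 * length zs + 6 \<le> n"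
  shows "runs (load a) (st g c s x y sg r res) n (st g (zs @ 10 # c) s x y sg r res)"
proof -
  have 1: "runs (Ops (\<lambda>_. [Push Cr 10])) (st g c s x y sg r res) 2 (st g (10 # c) s x y sg r res)"
    by (rule runs_Ops[OF refl]) simp_all
  have 2: "runs (copy Tmp a Cr id) (st g (10 # c) s x y sg r res) (11 * length zs + 3)
      (st g (zs @ 10 # c) s x y sg r res)"
    by (rule runs_copy) (use assms in auto)
  show ?thesis unfolding load_def by (rule runs_Seq[OF 1 2]) (use assms(4) in simp)
qed

definition drop_lit :: "reg com" where
  "drop_lit = Seq (clear Yr) (Ops (\<lambda>_. [Pop Sg]))"

lemma runs_drop_lit:
  assumes "4 * length (bits x) + 4 \<le> n"
  shows "runs drop_lit (st g c s xr (rev (bits x)) [b] r res) n (st g c s xr [] [] r res)"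
proof -
  have 1: "runs (clear Yr) (st g c s xr (rev (bits x)) [b] r res) (4 * length (bits x) + 1)
      (st g c s xr [] [b] r res)"
    by (rule runs_clear) simp_all
  have 2: "runs (Ops (\<lambda>_. [Pop Sg])) (st g c s xr [] [b] r res) 2 (st g c s xr [] [] r res)"
    by (rule runs_Ops[OF refl]) simp_all
  show ?thesis unfolding drop_lit_def by (rule runs_Seq[OF 1 2]) (use assms in simp)
qed

definition up_round :: "reg com" where
  "up_round = Seq (load Gr) (for_each (Seq try_unit drop_lit))"

definition prop_round :: "lit list list \<Rightarrow> (nat \<Rightarrow> bool option) \<Rightarrow> nat \<Rightarrow> bool option" where
  "prop_round cs m = fold (\<lambda>l m. prop_lit cs m l) (concat cs) m"

abbreviation enc_formula :: "lit list list \<Rightarrow> nat list" where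
  "enc_formula cs \<equiv> enc_clauses (\<lambda>_. None) cs"

lemma runs_up_round:
  assumes "length (enc_formula cs) \<le> N" "N * (54 * N + 60) + 11 * N + 12 \<le> n"
  shows "runs up_round (st (enc_formula cs) c s (rev (enc_clauses m cs)) [] [] r res) n
     (st (enc_formula cs) c s (rev (enc_clauses (prop_round cs m) cs)) [] [] r res)"
proof -
  let ?g = "enc_formula cs"
  have 1: "runs (load Gr) (st ?g c s (rev (enc_clauses m cs)) [] [] r res) (11 * length ?g + 6)
      (st ?g (?g @ 10 # c) s (rev (enc_clauses m cs)) [] [] r res)"
    by (rule runs_load) simp_all
  have b: "runs (Seq try_unit drop_lit)
      (st ?g c s (rev (enc_clauses m cs)) (rev (bits (fst l))) [sign_code (snd l)] r res) (54 * N + 40)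
      (st ?g c s (rev (enc_clauses (prop_lit cs m l) cs)) [] [] r res)"
    if "Some l \<in> set (toks cs)" for m l c
  proof -
    have "length (bits (fst l)) \<le> N"
      using length_bits_le[OF that] assms(1) unfolding enc_toks_toks by (rule order_trans)
    moreover have "length (enc_clauses m cs) \<le> N" using assms(1) length_enc_clauses[of m cs] by metis
    ultimately show ?thesis
      by (intro runs_Seq[OF runs_try_unit[OF order_refl] runs_drop_lit[OF order_refl]]) simp
  qed
  have 2: "runs (for_each (Seq try_unit drop_lit))
     (st ?g (enc_toks (toks cs) @ 10 # c) s (rev (enc_clauses m cs)) [] [] r res) (N * (54 * N + 60) + 4)
     (st ?g c s (rev (enc_clauses (prop_round cs m) cs)) [] [] r res)"
  proof (rule runs_for_each[where xr = "\<lambda>m. rev (enc_clauses m cs)" and res = "\<lambda>_. res"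
        and step = "\<lambda>l m. prop_lit cs m l", OF b])
    show "length (enc_toks (toks cs)) * (54 * N + 40 + 20) + 4 \<le> N * (54 * N + 60) + 4"
      using mult_le_mono1[OF assms(1), of "54 * N + 60"] by (simp add: enc_toks_toks algebra_simps)
  qed (simp_all add: fold_toks prop_round_def)
  show ?thesis unfolding up_round_def
    by (rule runs_Seq[OF 1 2[unfolded enc_toks_toks]]) (use assms in simp)
qed

text \<open>Passes expect the formula reversed, so \<open>XR\<close> is filled by a single move,
  while the second copy in \<open>Tmp\<close> restores \<open>Gr\<close>.\<close>

definition init_marks :: "reg com" where
  "init_marks = Seq (mv always Gr [(Tmp, id), (XR, id)]) (mv always Tmp [(Gr, id)])"

lemma runs_init_marks:
  assumes "0 \<notin> set g" "11 * length g + 3 \<le> n"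
  shows "runs init_marks (st g c s [] y sg r res) n (st g c s (rev g) y sg r res)"
proof -
  let ?\<sigma> = "(st [] c s (rev g) y sg r res)(Tmp := rev g)"
  have g: "\<And>x. x \<in> set g \<Longrightarrow> 0 < x" using assms(1) by (metis gr0I)
  have 1: "runs (mv always Gr [(Tmp, id), (XR, id)]) (st g c s [] y sg r res) (6 * length g + 1) ?\<sigma>"
  proof (rule runs_mv[where xs = g and ys = "[]"])
    show "?\<sigma> = (\<lambda>r'. if r' = Gr then [] else case map_of [(Tmp, id), (XR, id)] r' of
        None \<Rightarrow> st g c s [] y sg r res r' | Some f \<Rightarrow> rev (map f g) @ st g c s [] y sg r res r')"
      by (rule ext, rename_tac q, case_tac q; simp)
  qed (use g in simp_all)
  have 2: "runs (mv always Tmp [(Gr, id)]) ?\<sigma> (5 * length g + 1) (st g c s (rev g) y sg r res)"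
  proof (rule runs_mv[where xs = "rev g" and ys = "[]"])
    show "st g c s (rev g) y sg r res = (\<lambda>r'. if r' = Tmp then [] else case map_of [(Gr, id)] r' of
        None \<Rightarrow> ?\<sigma> r' | Some f \<Rightarrow> rev (map f (rev g)) @ ?\<sigma> r')"
      by (rule ext, rename_tac q, case_tac q; simp)
  qed (use g in simp_all)
  show ?thesis unfolding init_marks_def by (rule runs_Seq[OF 1 2]) (use assms(2) in simp)
qed

definition mark_chosen :: "reg com" where
  "mark_chosen = Seq (load Sr) (for_each (Seq mark drop_lit))"

definition assign_lits :: "lit list \<Rightarrow> nat \<Rightarrow> bool option" where
  "assign_lits ls = fold (\<lambda>l m. set_lit m l) ls (\<lambda>_. None)"

lemma fold_map_Some:
  "fold (\<lambda>t \<alpha>. case t of None \<Rightarrow> \<alpha> | Some l \<Rightarrow> f l \<alpha>) (map Some ls) \<alpha> = fold f ls \<alpha>"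
  by (induction ls arbitrary: \<alpha>) simp_all

lemma runs_mark_chosen:
  assumes "length (enc_formula cs) \<le> N" "length (enc_toks (map Some ls)) \<le> N"
    "N * (29 * N + 40) + 11 * N + 12 \<le> n"
  shows "runs mark_chosen (st (enc_formula cs) c (enc_toks (map Some ls)) (rev (enc_formula cs)) [] [] r res) n
     (st (enc_formula cs) c (enc_toks (map Some ls)) (rev (enc_clauses (assign_lits ls) cs)) [] [] r res)"
proof -
  let ?g = "enc_formula cs" and ?s = "enc_toks (map Some ls)"
  have 1: "runs (load Sr) (st ?g c ?s (rev ?g) [] [] r res) (11 * length ?s + 6)
      (st ?g (?s @ 10 # c) ?s (rev ?g) [] [] r res)"
    by (rule runs_load) simp_all
  have b: "runs (Seq mark drop_lit)
      (st ?g c ?s (rev (enc_clauses m cs)) (rev (bits (fst l))) [sign_code (snd l)] r res) (29 * N + 20)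
      (st ?g c ?s (rev (enc_clauses (set_lit m l) cs)) [] [] r res)"
    if "Some l \<in> set (map Some ls)" for m l c
  proof -
    have "length (bits (fst l)) \<le> N"
      using length_bits_le[OF that] assms(2) by (rule order_trans)
    moreover have "length (enc_clauses m cs) \<le> N" using assms(1) length_enc_clauses[of m cs] by metis
    ultimately show ?thesis
      by (intro runs_Seq[OF runs_mark[OF order_refl] runs_drop_lit[OF order_refl]]) simp
  qed
  have 2: "runs (for_each (Seq mark drop_lit))
     (st ?g (?s @ 10 # c) ?s (rev (enc_clauses (\<lambda>_. None) cs)) [] [] r res) (N * (29 * N + 40) + 4)
     (st ?g c ?s (rev (enc_clauses (assign_lits ls) cs)) [] [] r res)"
  proof (rule runs_for_each[where xr = "\<lambda>m. rev (enc_clauses m cs)" and res = "\<lambda>_. res"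
        and step = "\<lambda>l m. set_lit m l", OF b])
    show "length ?s * (29 * N + 20 + 20) + 4 \<le> N * (29 * N + 40) + 4"
      using mult_le_mono1[OF assms(2), of "29 * N + 40"] by (simp add: algebra_simps)
  qed (simp_all add: fold_map_Some assign_lits_def)
  show ?thesis unfolding mark_chosen_def
    by (rule runs_Seq[OF 1 2]) (use assms in simp)
qed

text \<open>A copy of the formula serves as a unary counter: its length bounds the number of
  variables and so the number of rounds that can change anything.\<close>

definition propagate :: "reg com" where
  "propagate = Seq (copy Tmp Gr Rr id) (Loop (\<lambda>v. v Rr \<noteq> 0) (Seq (Ops (\<lambda>_. [Pop Rr])) up_round))"

lemma runs_propagate:
  assumes "length (enc_formula cs) \<le> N" "N * (N * (54 * N + 60) + 11 * N + 17) + 11 * N + 5 \<le> n"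
  shows "runs propagate (st (enc_formula cs) c s (rev (enc_clauses m cs)) [] [] [] res) n
     (st (enc_formula cs) c s
       (rev (enc_clauses ((prop_round cs ^^ length (enc_formula cs)) m) cs)) [] [] [] res)"
proof -
  let ?g = "enc_formula cs"
  let ?T = "N * (54 * N + 60) + 11 * N + 17"
  have 1: "runs (copy Tmp Gr Rr id) (st ?g c s (rev (enc_clauses m cs)) [] [] [] res) (11 * length ?g + 3)
      (st ?g c s (rev (enc_clauses m cs)) [] [] ?g res)"
    by (rule runs_copy) simp_all
  have 2: "runs (Loop (\<lambda>v. v Rr \<noteq> 0) (Seq (Ops (\<lambda>_. [Pop Rr])) up_round))
      (st ?g c s (rev (enc_clauses m cs)) [] [] r res) (length r * ?T + 1)
      (st ?g c s (rev (enc_clauses ((prop_round cs ^^ length r) m) cs)) [] [] [] res)" if "0 \<notin> set r" for r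
    using that
  proof (induction r arbitrary: m)
    case Nil
    show ?case unfolding list.size funpow_0 by (rule runs_Loop_done) simp_all
  next
    case (Cons x r)
    have a: "runs (Ops (\<lambda>_. [Pop Rr])) (st ?g c s (rev (enc_clauses m cs)) [] [] (x # r) res) 2
       (st ?g c s (rev (enc_clauses m cs)) [] [] r res)"
      by (rule runs_Ops[OF refl]) simp_all
    note b = runs_Seq[OF a runs_up_round[OF assms(1) order_refl] order_refl]
    have IH: "runs (Loop (\<lambda>v. v Rr \<noteq> 0) (Seq (Ops (\<lambda>_. [Pop Rr])) up_round))
      (st ?g c s (rev (enc_clauses (prop_round cs m) cs)) [] [] r res) (length r * ?T + 1)
      (st ?g c s (rev (enc_clauses ((prop_round cs ^^ length (x # r)) m) cs)) [] [] [] res)"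
      using Cons.IH[of "prop_round cs m"] Cons.prems by (simp add: funpow_swap1)
    show ?case by (rule runs_Loop_step[OF _ b IH]) (use Cons.prems in simp_all)
  qed
  have le: "length ?g * ?T \<le> N * ?T" using assms(1) by (rule mult_le_mono1)
  show ?thesis unfolding propagate_def
    by (rule runs_Seq[OF 1 2]) (use assms le in \<open>simp_all add: algebra_simps\<close>)
qed

text \<open>Codes 6 and 7 mark true literals, so the pass reports a clause without a true
  literal.\<close>

definition final_fl :: "nat \<Rightarrow> bool \<Rightarrow> nat \<Rightarrow> bool \<times> nat" where
  "final_fl a eq s = (s \<noteq> 6 \<and> s \<noteq> 7, s)"

definition verdict :: "reg com" where
  "verdict = Seq (pass final_fl)
     (Seq (Cond (\<lambda>v. v Zf = 0) (Ops (\<lambda>_. [Pop Res, Push Res 1])) (Ops (\<lambda>_. [Pop Zf]))) (clear XR))"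

definition satisfied :: "(nat \<Rightarrow> bool option) \<Rightarrow> lit list list \<Rightarrow> bool" where
  "satisfied m cs \<longleftrightarrow> (\<forall>C\<in>set cs. \<exists>l\<in>set C. m (fst l) = Some (snd l))"

lemma runs_verdict:
  assumes "length (enc_clauses m cs) \<le> N" "29 * N + 20 \<le> n"
  shows "runs verdict (st g c s (rev (enc_clauses m cs)) [] [] r (flag b)) n
    (st g c s [] [] [] r (flag (b \<or> satisfied m cs)))"
proof -
  let ?\<sigma> = "\<lambda>b. st g c s (rev (enc_clauses m cs)) [] [] r (flag b)"
  define p where "p l \<longleftrightarrow> m (fst l) \<noteq> Some (snd l)" for l
  have fl: "final_fl (top0 []) (rev (bits (fst l')) = []) (stat m l') = (p l', stat m l')" for l'
    by (cases "m (fst l')"; cases "snd l'") (auto simp: final_fl_def stat_def sign_code_def p_def)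
  have fo: "(\<exists>C\<in>set cs. \<forall>l'\<in>set C. p l') \<longleftrightarrow> \<not> satisfied m cs"
    by (simp add: satisfied_def p_def)
  have 1: "runs (pass final_fl) (?\<sigma> b) (25 * length (enc_clauses m cs) + 9) ((?\<sigma> b)(Zf := flag (\<not> satisfied m cs)))"
    unfolding fo[symmetric] by (rule runs_pass[where p = p], rule fl) simp_all
  have 2: "runs (Cond (\<lambda>v. v Zf = 0) (Ops (\<lambda>_. [Pop Res, Push Res 1])) (Ops (\<lambda>_. [Pop Zf])))
      ((?\<sigma> b)(Zf := flag (\<not> satisfied m cs))) 4 (?\<sigma> (b \<or> satisfied m cs))"
  proof (cases "satisfied m cs")
    case True
    have "runs (Ops (\<lambda>_. [Pop Res, Push Res 1])) ((?\<sigma> b)(Zf := flag (\<not> satisfied m cs))) 3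
        (?\<sigma> (b \<or> satisfied m cs))"
      by (rule runs_Ops[OF refl]) (simp_all add: True st_Zf_clear)
    then show ?thesis by (rule runs_CondT[rotated]) (simp_all add: True)
  next
    case False
    have "runs (Ops (\<lambda>_. [Pop Zf])) ((?\<sigma> b)(Zf := flag (\<not> satisfied m cs))) 3 (?\<sigma> (b \<or> satisfied m cs))"
      by (rule runs_Ops[OF refl]) (simp_all add: False st_Zf_clear)
    then show ?thesis by (rule runs_CondF[rotated]) (simp_all add: False)
  qed
  have 3: "runs (clear XR) (?\<sigma> (b \<or> satisfied m cs)) (4 * length (enc_clauses m cs) + 1)
      (st g c s [] [] [] r (flag (b \<or> satisfied m cs)))"
    by (rule runs_clear) simp_all
  show ?thesis unfolding verdict_def
    by (rule runs_Seq[OF 1 runs_Seq[OF 2 3 order_refl]]) (use assms in simp)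
qed

definition try_chosen :: "reg com" where
  "try_chosen = Seq init_marks (Seq mark_chosen (Seq propagate verdict))"

definition chosen_ok :: "lit list list \<Rightarrow> lit list \<Rightarrow> bool" where
  "chosen_ok cs ls \<longleftrightarrow>
     satisfied ((prop_round cs ^^ length (enc_formula cs)) (assign_lits ls)) cs"

definition try_time :: "nat \<Rightarrow> nat" where
  "try_time N = N * (N * (54 * N + 60) + 11 * N + 17) + N * (29 * N + 40) + 62 * N + 43"

lemma runs_try_chosen:
  assumes "length (enc_formula cs) \<le> N" "length (enc_toks (map Some ls)) \<le> N" "try_time N \<le> n"
  shows "runs try_chosen (st (enc_formula cs) c (enc_toks (map Some ls)) [] [] [] [] (flag b)) n
     (st (enc_formula cs) c (enc_toks (map Some ls)) [] [] [] [] (flag (b \<or> chosen_ok cs ls)))"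
proof -
  have len: "length (enc_clauses m cs) \<le> N" for m using assms(1) length_enc_clauses[of m cs] by metis
  have z: "0 \<notin> set (enc_formula cs)" by simp
  show ?thesis
    unfolding try_chosen_def chosen_ok_def
    by (rule runs_Seq[OF runs_init_marks[OF z order_refl] runs_Seq[OF runs_mark_chosen[OF assms(1,2) order_refl]
        runs_Seq[OF runs_propagate[OF assms(1) order_refl] runs_verdict[OF len order_refl] order_refl] order_refl]])
      (use assms in \<open>simp add: try_time_def\<close>)
qed

text \<open>The sign of the occurrence is only a starting point: both polarities of its variable are
  tried by flipping the top of \<open>Sr\<close>. As \<open>sub\<close> occurs twice, the program
  grows exponentially in \<open>k\<close>, which is a constant.\<close>

definition branch :: "reg com \<Rightarrow> reg com" where
  "branch sub = Seq (mv always Yr [(Sr, id)])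
     (Seq (Ops (\<lambda>v. [Push Sr (if v Sg = 4 then 4 else 3), Pop Sg]))
     (Seq sub
     (Seq (Ops (\<lambda>v. [Pop Sr, Push Sr (if v Sr = 3 then 4 else 3)]))
     (Seq sub
     (Seq (Ops (\<lambda>_. [Pop Sr])) (mv (\<lambda>x. x \<le> 2) Sr []))))))"

primrec search :: "nat \<Rightarrow> reg com" where
  "search 0 = try_chosen"
| "search (Suc j) = Seq (load Gr) (for_each (branch (search j)))"

primrec search_ok :: "lit list list \<Rightarrow> nat \<Rightarrow> lit list \<Rightarrow> bool" where
  "search_ok cs 0 ls \<longleftrightarrow> chosen_ok cs ls"
| "search_ok cs (Suc j) ls \<longleftrightarrow>
     (\<exists>l\<in>set (concat cs). search_ok cs j (l # ls) \<or> search_ok cs j ((fst l, \<not> snd l) # ls))"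

primrec search_time :: "nat \<Rightarrow> nat \<Rightarrow> nat" where
  "search_time 0 N = try_time N"
| "search_time (Suc j) N = N * (2 * search_time j N + 9 * N + 40) + 11 * N + 12"

lemma ok_search:
  assumes "10 < B"
  shows "ok_com B (search j)"
proof (induction j)
  case 0
  have "ok_com B (pass final_fl)" by (rule ok_pass) (use assms in \<open>auto simp: final_fl_def\<close>)
  then show ?case using assms
    by (simp add: try_chosen_def init_marks_def mark_chosen_def propagate_def verdict_def up_round_def
        drop_lit_def ok_load ok_for_each ok_mark ok_try_unit)
next
  case (Suc j)
  have "ok_com B (branch (search j))" using Suc assms by (simp add: branch_def)
  then show ?case using assms by (simp add: ok_load ok_for_each)
qed

lemma runs_branch:
  assumes sub: "\<And>l b. l \<in> {(x, True), (x, False)} \<Longrightarrow>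
      runs sub (st g c (enc_toks (map Some (l # ls))) [] [] [] [] (flag b)) T
        (st g c (enc_toks (map Some (l # ls))) [] [] [] [] (flag (b \<or> P l)))"
    and "fst l = x" "2 * T + 9 * length (bits x) + 19 \<le> n"
  shows "runs (branch sub)
     (st g c (enc_toks (map Some ls)) [] (rev (bits x)) [sign_code (snd l)] [] (flag b)) n
     (st g c (enc_toks (map Some ls)) [] [] [] [] (flag (b \<or> P l \<or> P (fst l, \<not> snd l))))"
proof -
  let ?s = "enc_toks (map Some ls)" and ?b = "bits x"
  let ?sc = "sign_code (snd l)" and ?sc' = "sign_code (\<not> snd l)"
  let ?b1 = "b \<or> P l" and ?b2 = "b \<or> P l \<or> P (fst l, \<not> snd l)"
  have l: "l = (x, snd l)" using assms(2) by (simp add: prod_eq_iff)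
  have bn: "\<And>y. y \<in> set ?b \<Longrightarrow> 0 < y \<and> y \<le> 2" using set_bits_bounds by blast
  have 1: "runs (mv always Yr [(Sr, id)]) (st g c ?s [] (rev ?b) [?sc] [] (flag b)) (5 * length ?b + 1)
      (st g c (?b @ ?s) [] [] [?sc] [] (flag b))"
  proof (rule runs_mv[where xs = "rev ?b" and ys = "[]"])
    show "st g c (?b @ ?s) [] [] [?sc] [] (flag b) = (\<lambda>r'. if r' = Yr then [] else case map_of [(Sr, id)] r' of
        None \<Rightarrow> st g c ?s [] (rev ?b) [?sc] [] (flag b) r'
      | Some f \<Rightarrow> rev (map f (rev ?b)) @ st g c ?s [] (rev ?b) [?sc] [] (flag b) r')"
      by (rule ext, rename_tac q, case_tac q; simp)
  qed (use bn in simp_all)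
  have 2: "runs (Ops (\<lambda>v. [Push Sr (if v Sg = 4 then 4 else 3), Pop Sg]))
      (st g c (?b @ ?s) [] [] [?sc] [] (flag b)) 3 (st g c (?sc # ?b @ ?s) [] [] [] [] (flag b))"
    by (rule runs_Ops[OF refl]) (simp_all add: sign_code_def)
  have 3: "runs sub (st g c (?sc # ?b @ ?s) [] [] [] [] (flag b)) T (st g c (?sc # ?b @ ?s) [] [] [] [] (flag ?b1))"
    using sub[of l b] l by (cases "snd l") auto
  have 4: "runs (Ops (\<lambda>v. [Pop Sr, Push Sr (if v Sr = 3 then 4 else 3)]))
      (st g c (?sc # ?b @ ?s) [] [] [] [] (flag ?b1)) 3 (st g c (?sc' # ?b @ ?s) [] [] [] [] (flag ?b1))"
    by (rule runs_Ops[OF refl]) (simp_all add: sign_code_def)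
  have 5: "runs sub (st g c (?sc' # ?b @ ?s) [] [] [] [] (flag ?b1)) T (st g c (?sc' # ?b @ ?s) [] [] [] [] (flag ?b2))"
    using sub[of "(x, \<not> snd l)" ?b1] assms(2) by (cases "snd l") (auto simp: disj_assoc)
  have 6: "runs (Ops (\<lambda>_. [Pop Sr]))
      (st g c (?sc' # ?b @ ?s) [] [] [] [] (flag ?b2)) 2 (st g c (?b @ ?s) [] [] [] [] (flag ?b2))"
    by (rule runs_Ops[OF refl]) simp_all
  have hd: "?s = [] \<or> \<not> hd ?s \<le> 2"
    using enc_toks_hd[of "map Some ls"] by auto
  have 7: "runs (mv (\<lambda>x. x \<le> 2) Sr []) (st g c (?b @ ?s) [] [] [] [] (flag ?b2)) (4 * length ?b + 1)
      (st g c ?s [] [] [] [] (flag ?b2))"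
  proof (rule runs_mv[where xs = ?b and ys = ?s])
    show "st g c ?s [] [] [] [] (flag ?b2) = (\<lambda>r'. if r' = Sr then ?s else case map_of [] r' of
        None \<Rightarrow> st g c (?b @ ?s) [] [] [] [] (flag ?b2) r'
      | Some f \<Rightarrow> rev (map f ?b) @ st g c (?b @ ?s) [] [] [] [] (flag ?b2) r')"
      by (rule ext, rename_tac q, case_tac q; simp)
  qed (use bn hd in simp_all)
  show ?thesis unfolding branch_def
    by (rule runs_Seq[OF 1 runs_Seq[OF 2 runs_Seq[OF 3 runs_Seq[OF 4 runs_Seq[OF 5 runs_Seq[OF 6 7
        order_refl] order_refl] order_refl] order_refl] order_refl]]) (use assms(3) in simp)
qed

lemma fold_disj: "fold (\<lambda>l b. b \<or> P l) ls b \<longleftrightarrow> b \<or> (\<exists>l\<in>set ls. P l)"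
  by (induction ls arbitrary: b) auto

text \<open>Each of the remaining \<open>j\<close> levels adds one literal no longer than the
  formula. The second premise reserves this space, so a single \<open>N\<close> bounds all
  levels.\<close>

lemma runs_search:
  assumes "length (enc_formula cs) \<le> N" "length (enc_toks (map Some ls)) + j * length (enc_formula cs) \<le> N"
    "search_time j N \<le> n"
  shows "runs (search j) (st (enc_formula cs) c (enc_toks (map Some ls)) [] [] [] [] (flag b)) n
     (st (enc_formula cs) c (enc_toks (map Some ls)) [] [] [] [] (flag (b \<or> search_ok cs j ls)))"
  using assms(2,3)
proof (induction j arbitrary: ls n c b)
  case 0
  then show ?case using runs_try_chosen[OF assms(1), of ls n c b] by simp
next
  case (Suc j)
  let ?g = "enc_formula cs" and ?s = "enc_toks (map Some ls)"
  let ?T = "2 * search_time j N + 9 * N + 20"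
  define P where "P l \<longleftrightarrow> search_ok cs j (l # ls)" for l
  have 1: "runs (load Gr) (st ?g c ?s [] [] [] [] (flag b)) (11 * length ?g + 6)
      (st ?g (enc_toks (toks cs) @ 10 # c) ?s [] [] [] [] (flag b))"
    unfolding enc_toks_toks by (rule runs_load) simp_all
  have b: "runs (branch (search j))
      (st ?g c ?s [] (rev (bits (fst l))) [sign_code (snd l)] [] (flag b)) ?T
      (st ?g c ?s [] [] [] [] (flag (b \<or> P l \<or> P (fst l, \<not> snd l))))"
    if l: "Some l \<in> set (toks cs)" for b l c
  proof (rule runs_branch)
    have len: "length (enc_tok (Some (fst l, v))) \<le> length ?g" for v
      using length_enc_tok_le[OF l] by (simp add: enc_toks_toks)
    show "2 * search_time j N + 9 * length (bits (fst l)) + 19 \<le> ?T"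
      using len[of True] assms(1) by simp
    fix l' b assume "l' \<in> {(fst l, True), (fst l, False)}"
    then have "length (enc_toks (map Some (l' # ls))) + j * length ?g \<le> N"
      using len[of "snd l'"] Suc.prems(1) by auto
    then show "runs (search j) (st ?g c (enc_toks (map Some (l' # ls))) [] [] [] [] (flag b)) (search_time j N)
      (st ?g c (enc_toks (map Some (l' # ls))) [] [] [] [] (flag (b \<or> P l')))"
      unfolding P_def by (rule Suc.IH[OF _ order_refl])
  qed simp
  have 2: "runs (for_each (branch (search j)))
     (st ?g (enc_toks (toks cs) @ 10 # c) ?s [] [] [] [] (flag b)) (N * (2 * search_time j N + 9 * N + 40) + 4)
     (st ?g c ?s [] [] [] [] (flag (b \<or> search_ok cs (Suc j) ls)))"
  proof (rule runs_for_each[where xr = "\<lambda>_. []" and res = flag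
        and step = "\<lambda>l b. b \<or> P l \<or> P (fst l, \<not> snd l)", OF b])
    show "length (enc_toks (toks cs)) * (?T + 20) + 4 \<le> N * (2 * search_time j N + 9 * N + 40) + 4"
      using mult_le_mono1[OF assms(1), of "?T + 20"] by (simp add: enc_toks_toks algebra_simps)
    show "(b \<or> search_ok cs (Suc j) ls) = fold (\<lambda>t \<alpha>. case t of None \<Rightarrow> \<alpha>
        | Some l \<Rightarrow> \<alpha> \<or> P l \<or> P (fst l, \<not> snd l)) (toks cs) b"
      by (simp only: fold_toks fold_disj search_ok.simps P_def)
  qed
  show ?case unfolding search.simps
    by (rule runs_Seq[OF 1 2]) (use assms(1) Suc.prems(2) in simp)
qed

lemma poly_bounded_search_time: "poly_bounded (search_time j)"
proof (induction j)
  case 0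
  show ?case unfolding search_time.simps try_time_def by (intro poly_bounded_intros)
next
  case (Suc j)
  show ?case unfolding search_time.simps by (intro poly_bounded_intros Suc)
qed

section \<open>Unit propagation\<close>

definition agrees :: "(nat \<Rightarrow> bool) \<Rightarrow> (nat \<Rightarrow> bool option) \<Rightarrow> bool" where
  "agrees a m \<longleftrightarrow> (\<forall>x b. m x = Some b \<longrightarrow> b = a x)"

definition models :: "(nat \<Rightarrow> bool) \<Rightarrow> lit list list \<Rightarrow> bool" where
  "models a cs \<longleftrightarrow> (\<forall>C\<in>set cs. \<exists>l\<in>set C. a (fst l) = snd l)"

definition closed_up :: "lit list list \<Rightarrow> (nat \<Rightarrow> bool option) \<Rightarrow> bool" where
  "closed_up cs m \<longleftrightarrow> (\<forall>l\<in>set (concat cs). forced cs m l \<longrightarrow> m (fst l) \<noteq> None)"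

lemma cnf_sat_iff: "cnf_sat (set (map set cs)) \<longleftrightarrow> (\<exists>a. models a cs)"
  by (simp add: cnf_sat_def models_def)

lemma satisfied_imp_models: "satisfied m cs \<Longrightarrow> models (\<lambda>x. m x = Some True) cs"
  unfolding satisfied_def models_def
proof
  fix C assume "\<forall>C\<in>set cs. \<exists>l\<in>set C. m (fst l) = Some (snd l)" "C \<in> set cs"
  then obtain l where "l \<in> set C" "m (fst l) = Some (snd l)" by blast
  then show "\<exists>l\<in>set C. (m (fst l) = Some True) = snd l" by (intro bexI[of _ l]) simp_all
qed

lemma agrees_set_lit: "agrees a m \<Longrightarrow> a (fst l) = snd l \<Longrightarrow> agrees a (set_lit m l)"
  by (auto simp: agrees_def set_lit_def)

text \<open>The model makes some literal of the forcing clause true. This literal is not false under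
  \<open>m\<close>, so it can only be \<open>l\<close>.\<close>

lemma forced_true:
  assumes "agrees a m" "models a cs" "forced cs m l"
  shows "a (fst l) = snd l"
proof -
  obtain C where C: "C \<in> set cs"
    "\<forall>l'\<in>set C. m (fst l') = Some (\<not> snd l') \<or> m (fst l') = None \<and> l' = l"
    using assms(3) unfolding forced_def by blast
  obtain l' where l': "l' \<in> set C" "a (fst l') = snd l'" using assms(2) C(1) unfolding models_def by blast
  then have "m (fst l') \<noteq> Some (\<not> snd l')" using assms(1) unfolding agrees_def by (metis (full_types))
  then show ?thesis using C(2) l' by blast
qed

lemma agrees_prop_lit: "agrees a m \<Longrightarrow> models a cs \<Longrightarrow> agrees a (prop_lit cs m l)"
  by (simp add: prop_lit_def agrees_set_lit forced_true)

lemma agrees_prop_round: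
  assumes "agrees a m" "models a cs"
  shows "agrees a (prop_round cs m)"
proof -
  have "agrees a (fold (\<lambda>l m. prop_lit cs m l) ls m)" for ls
    using assms(1) by (induction ls arbitrary: m) (simp_all add: agrees_prop_lit assms(2))
  then show ?thesis by (simp add: prop_round_def)
qed

lemma map_le_prop_lit: "m \<subseteq>\<^sub>m prop_lit cs m l"
  by (auto simp: prop_lit_def set_lit_def map_le_def)

lemma map_le_fold_prop_lit: "m \<subseteq>\<^sub>m fold (\<lambda>l m. prop_lit cs m l) ls m"
proof (induction ls arbitrary: m)
  case (Cons l ls)
  then show ?case using map_le_prop_lit[of m cs l] by (auto intro: map_le_trans)
qed simp

text \<open>Every step extends the assignment; if the whole round changes nothing, each single step
  is squeezed between \<open>m\<close> and \<open>m\<close>.\<close>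

lemma fold_prop_lit_fixed:
  assumes "fold (\<lambda>l m. prop_lit cs m l) ls m = m" "l \<in> set ls"
  shows "prop_lit cs m l = m"
  using assms
proof (induction ls)
  case (Cons k ls)
  have "prop_lit cs m k \<subseteq>\<^sub>m m"
    using map_le_fold_prop_lit[of "prop_lit cs m k" cs ls] Cons.prems(1) by simp
  then have "prop_lit cs m k = m" using map_le_prop_lit map_le_antisym by blast
  then show ?case using Cons by auto
qed simp

lemma closed_up_if_fixed:
  assumes "prop_round cs m = m"
  shows "closed_up cs m"
  unfolding closed_up_def
proof (intro ballI impI)
  fix l assume l: "l \<in> set (concat cs)" "forced cs m l"
  have "prop_lit cs m l = m"
    using fold_prop_lit_fixed[OF assms[unfolded prop_round_def] l(1)] .
  then have "set_lit m l = m" using l(2) by (simp add: prop_lit_def)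
  then show "m (fst l) \<noteq> None" unfolding set_lit_def by (metis fun_upd_same option.distinct(1))
qed

lemma dom_prop_round: "dom (prop_round cs m) \<subseteq> dom m \<union> fst ` set (concat cs)"
proof -
  have "dom (fold (\<lambda>l m. prop_lit cs m l) ls m) \<subseteq> dom m \<union> fst ` set ls" for ls
  proof (induction ls arbitrary: m)
    case (Cons l ls)
    have "dom (prop_lit cs m l) \<subseteq> insert (fst l) (dom m)"
      by (auto simp: prop_lit_def set_lit_def)
    then show ?case using Cons[of "prop_lit cs m l"]
      by (simp only: fold.simps comp_apply list.set image_insert) blast
  qed simp
  then show ?thesis unfolding prop_round_def by this
qed

text \<open>As long as no fixed point is reached, each round raises the measure, which therefore is
  at least the number of rounds; beyond \<open>K\<close> it cannot grow.\<close>

lemma iterate_to_fixpoint: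
  fixes \<mu> :: "'a \<Rightarrow> nat"
  assumes "\<And>x. f x = x \<or> \<mu> x < \<mu> (f x)" "\<And>x. \<mu> x \<le> K" "K \<le> n"
  shows "f ((f ^^ n) x) = (f ^^ n) x"
proof -
  have "f ((f ^^ i) x) = (f ^^ i) x \<or> i \<le> \<mu> ((f ^^ i) x)" for i
  proof (induction i)
    case (Suc i)
    then show ?case using assms(1)[of "(f ^^ i) x"] by auto
  qed simp
  then show ?thesis using assms(1)[of "(f ^^ n) x"] assms(2)[of "f ((f ^^ n) x)"] assms(3)
    by (metis leD le_trans)
qed

lemma length_concat_le_enc: "length (concat cs) \<le> length (enc_formula cs)"
proof -
  have "length C \<le> length (concat (map (enc_marked (\<lambda>_. None)) C))" for C
    by (induction C) (simp_all add: enc_marked_def)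
  note le = this
  show ?thesis
  proof (induction cs)
    case (Cons C cs)
    then show ?case using le[of C] by (simp add: enc_clauses_def)
  qed simp
qed

lemma prop_round_fixpoint:
  "prop_round cs ((prop_round cs ^^ length (enc_formula cs)) m) = (prop_round cs ^^ length (enc_formula cs)) m"
proof (rule iterate_to_fixpoint)
  let ?V = "fst ` set (concat cs)"
  \<comment> \<open>The intersection with the variables of the formula keeps the measure finite and
    bounded for every \<open>m\<close>.\<close>
  let ?\<mu> = "\<lambda>m :: nat \<Rightarrow> bool option. card (dom m \<inter> ?V)"
  have fin: "finite ?V" by simp
  show "prop_round cs m = m \<or> ?\<mu> m < ?\<mu> (prop_round cs m)" for m
  proof (cases "prop_round cs m = m")
    case False
    have le: "m \<subseteq>\<^sub>m prop_round cs m" unfolding prop_round_def by (rule map_le_fold_prop_lit)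
    then have d: "dom m \<subseteq> dom (prop_round cs m)" by (rule map_le_implies_dom_le)
    have "dom m \<noteq> dom (prop_round cs m)"
    proof
      assume "dom m = dom (prop_round cs m)"
      then have "prop_round cs m \<subseteq>\<^sub>m m" using le by (auto simp: map_le_def)
      then show False using False le map_le_antisym by blast
    qed
    then have "dom m \<inter> ?V \<subset> dom (prop_round cs m) \<inter> ?V" using d dom_prop_round[of cs m] by blast
    then show ?thesis using fin by (simp add: psubset_card_mono)
  qed simp
  show "?\<mu> m \<le> card ?V" for m using fin by (intro card_mono) auto
  have "card ?V \<le> length (concat cs)" using card_image_le[of "set (concat cs)" fst] card_length[of "concat cs"]
    by (simp del: set_concat)
  then show "card ?V \<le> length (enc_formula cs)" using length_concat_le_enc by (rule order_trans)
qed

section \<open>The subsolver's own run compared with a closed partial assignment\<close>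

lemma inj_unit_key: "inj unit_key"
proof (rule injI)
  fix l l' assume "unit_key l = unit_key l'"
  moreover have "inj sym_code"
    by (rule injI, rename_tac a b, case_tac a; case_tac b; simp)
  ultimately have "enc_lit l = enc_lit l'"
    by (simp add: unit_key_def enc_clause_def inj_map_eq_map)
  then show "l = l'"
    using inj_eq[OF inj_bin] by (auto simp: enc_lit_def prod_eq_iff split: if_splits)
qed

text \<open>\<open>least_unit\<close> is a definite description. The lexicographic order on keys is
  total because \<open>unit_key\<close> is injective, so a finite nonempty set of unit clauses has
  exactly one least element.\<close>

lemma least_unit_in:
  assumes "finite F" "{l} \<in> F"
  shows "{least_unit F} \<in> F"
proof -
  let ?r = "{(a, b). a < (b :: nat)}"
  define less where "less l l' \<longleftrightarrow> (unit_key l, unit_key l') \<in> lexord ?r" for l l'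
  have trans: "less x z" if "less x y" "less y z" for x y z
    using that unfolding less_def by (rule lexord_trans) (auto simp: trans_def)
  have irrefl: "\<not> less x x" for x unfolding less_def by (rule lexord_irreflexive) simp
  have "\<forall>a b. (a, b) \<in> ?r \<or> a = b \<or> (b, a) \<in> ?r" by auto
  then have total: "less x y \<or> x = y \<or> less y x" for x y
    using lexord_linear[of ?r "unit_key x" "unit_key y"] inj_eq[OF inj_unit_key, of x y]
    unfolding less_def by blast
  have ex: "\<exists>l\<in>U. \<forall>l'\<in>U. l' \<noteq> l \<longrightarrow> less l l'" if "finite U" "U \<noteq> {}" for U
    using that
  proof (induction U rule: finite_ne_induct)
    case (insert x U)
    then obtain l where l: "l \<in> U" "\<forall>l'\<in>U. l' \<noteq> l \<longrightarrow> less l l'" by blast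
    show ?case
    proof (cases "less x l")
      case True
      have "less x l'" if "l' \<in> insert x U" "l' \<noteq> x" for l'
        using that l(2) trans[OF True, of l'] True by (cases "l' = l") auto
      then show ?thesis by blast
    next
      case False
      then have "less l l'" if "l' \<in> insert x U" "l' \<noteq> l" for l'
        using that l(2) total[of x l] by auto
      then show ?thesis using l(1) by blast
    qed
  qed simp
  let ?U = "{l. {l} \<in> F}"
  have "(\<lambda>l. {l}) ` ?U \<subseteq> F" by blast
  then have "finite ((\<lambda>l. {l}) ` ?U)" using assms(1) by (rule finite_subset)
  then have "finite ?U" by (rule finite_imageD) (simp add: inj_on_def)
  moreover have "?U \<noteq> {}" using assms(2) by blast
  ultimately obtain k where k: "{k} \<in> F" "\<forall>l'. {l'} \<in> F \<and> l' \<noteq> k \<longrightarrow> less k l'"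
    using ex[of ?U] by auto
  have "least_unit F = k"
    unfolding least_unit_def less_def[symmetric]
  proof (rule the_equality)
    show "x = k" if x: "{x} \<in> F \<and> (\<forall>l'. {l'} \<in> F \<and> l' \<noteq> x \<longrightarrow> less x l')" for x
    proof (rule ccontr)
      assume "x \<noteq> k"
      then have "less x k" "less k x" using x k by blast+
      then show False using trans irrefl by blast
    qed
  qed (use k in blast)
  then show ?thesis using k(1) by simp
qed

text \<open>Keeps the state of \<open>up_run\<close> in the form \<open>assign F D a\<close> with a
  growing set \<open>D\<close>. The two simplifications do not interfere: restricting to
  \<open>D\<close> removes from clauses only literals false under \<open>a\<close>, and
  \<open>(x, a x)\<close> is not one of them.\<close>

lemma assign_assign:
  assumes "b = a x"
  shows "assign (assign F D a) {x} (\<lambda>_. b) = assign F (insert x D) a"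
proof -
  define N where "N S = {(x, \<not> a x) | x. x \<in> S}" for S
  have as: "assign F S a = (\<lambda>C. C - N S) ` {C \<in> F. \<forall>x\<in>S. (x, a x) \<notin> C}" for F S
    unfolding assign_def N_def by auto
  have "assign (assign F D a) {x} (\<lambda>_. b) = assign (assign F D a) {x} a"
    by (simp add: assign_def assms)
  also have "\<dots> = (\<lambda>C. C - N {x}) ` {C \<in> (\<lambda>C. C - N D) ` {C \<in> F. \<forall>y\<in>D. (y, a y) \<notin> C}. (x, a x) \<notin> C}"
    unfolding as by simp
  also have "\<dots> = (\<lambda>C. C - N {x}) ` (\<lambda>C. C - N D) ` {C \<in> F. \<forall>y\<in>insert x D. (y, a y) \<notin> C}"
  proof -
    have "(x, a x) \<notin> C - N D \<longleftrightarrow> (x, a x) \<notin> C" for C by (auto simp: N_def)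
    then show ?thesis by (intro arg_cong[of _ _ "image (\<lambda>C. C - N {x})"]) blast
  qed
  also have "\<dots> = (\<lambda>C. C - N (insert x D)) ` {C \<in> F. \<forall>y\<in>insert x D. (y, a y) \<notin> C}"
  proof -
    have "C - N D - N {x} = C - N (insert x D)" for C by (auto simp: N_def)
    then show ?thesis by (simp only: image_image)
  qed
  finally show ?thesis unfolding as .
qed

text \<open>The invariant along \<open>up_run\<close> is \<open>D \<subseteq> dom m\<close>. As
  \<open>a\<close> is a model, the empty clause never appears. A unit clause stems from a clause of
  \<open>cs\<close> whose other literals are false on \<open>D\<close>, hence under
  \<open>m\<close>; its literal is forced unless already assigned, and closedness puts its variable
  into \<open>dom m\<close>. Without rejection the run ends in the empty formula, where every clause
  has a literal that is true on \<open>D\<close>.\<close>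

lemma satisfied_if_determined:
  assumes m: "agrees a m" "models a cs" "closed_up cs m"
    and "D \<subseteq> dom m" "up_run n (assign (set (map set cs)) D a) \<noteq> Reject"
  shows "satisfied m cs"
  using assms(4,5)
proof (induction n arbitrary: D)
  case (Suc n)
  let ?F = "set (map set cs)"
  let ?G = "assign ?F D a"
  have dom: "m x = Some (a x)" if "x \<in> D" for x
    using that m(1) Suc.prems(1) unfolding agrees_def by blast
  have G: "\<exists>C\<in>?F. C' = C - {(x, \<not> a x) | x. x \<in> D} \<and> (\<forall>x\<in>D. (x, a x) \<notin> C)" if "C' \<in> ?G" for C'
    using that unfolding assign_def by blast
  have tl: "\<exists>l\<in>C - {(x, \<not> a x) | x. x \<in> D}. a (fst l) = snd l" if C: "C \<in> ?F" for C
  proof -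
    obtain C0 where "C0 \<in> set cs" "C = set C0" using C by auto
    then obtain l where l: "l \<in> C" "a (fst l) = snd l" using m(2) unfolding models_def by blast
    then have "l \<notin> {(x, \<not> a x) | x. x \<in> D}" by auto
    then show ?thesis using l by blast
  qed
  have "finite ?G" unfolding assign_def by auto
  show ?case
  proof (cases "?G = {}")
    case True
    show ?thesis
      unfolding satisfied_def
    proof
      fix C assume "C \<in> set cs"
      then have "\<exists>x\<in>D. (x, a x) \<in> set C" using True unfolding assign_def by auto
      then obtain x where "x \<in> D" "(x, a x) \<in> set C" by blast
      then show "\<exists>l\<in>set C. m (fst l) = Some (snd l)"
        using dom by (intro bexI[of _ "(x, a x)"]) simp_all
    qed
  next
    case False
    have ne: "{} \<notin> ?G"
    proof
      assume "{} \<in> ?G"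
      then obtain C where "C \<in> ?F" "{} = C - {(x, \<not> a x) | x. x \<in> D}" using G by blast
      then show False using tl[of C] by blast
    qed
    have "\<exists>l. {l} \<in> ?G"
    proof (rule ccontr)
      assume "\<not> ?thesis"
      then have "up_run (Suc n) ?G = Reject"
        unfolding up_run.simps if_not_P[OF False] if_not_P[OF ne] by (rule if_not_P)
      then show False using Suc.prems(2) by contradiction
    qed
    then obtain l where l: "{l} \<in> ?G" ..
    define k where "k = least_unit ?G"
    have k: "{k} \<in> ?G" unfolding k_def using least_unit_in[OF \<open>finite ?G\<close> l] .
    obtain C where C: "C \<in> ?F" "{k} = C - {(x, \<not> a x) | x. x \<in> D}" using G[OF k] by blast
    have ak: "a (fst k) = snd k" using tl[OF C(1)] C(2) by auto
    have "forced cs m k" if "m (fst k) = None"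
    proof -
      obtain C0 where C0: "C0 \<in> set cs" "C = set C0" using C(1) by auto
      have "m (fst l') = Some (\<not> snd l') \<or> m (fst l') = None \<and> l' = k" if l': "l' \<in> set C0" for l'
      proof (cases "l' = k")
        case False
        then have "l' \<in> {(x, \<not> a x) | x. x \<in> D}" using C(2) l' C0(2) by blast
        then show ?thesis using dom by auto
      qed (use \<open>m (fst k) = None\<close> in simp)
      then show ?thesis unfolding forced_def using C0(1) by blast
    qed
    moreover have "k \<in> set (concat cs)" using C by auto
    ultimately have "fst k \<in> dom m" using m(3) unfolding closed_up_def by blast
    then have sub: "insert (fst k) D \<subseteq> dom m" using Suc.prems(1) by simp
    have ex: "\<exists>l. {l} \<in> ?G" using l by blast
    have "up_run (Suc n) ?G = (case up_run n (assign ?G {fst k} (\<lambda>_. snd k)) of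
             Sat as \<Rightarrow> Sat (k # as) | r \<Rightarrow> r)"
      unfolding up_run.simps Let_def k_def[symmetric] if_not_P[OF False] if_not_P[OF ne] if_P[OF ex] ..
    then have "up_run n (assign ?F (insert (fst k) D) a) \<noteq> Reject"
      using Suc.prems(2) unfolding assign_assign[where b = "snd k" and a = a and x = "fst k", OF ak[symmetric]] by auto
    then show ?thesis using Suc.IH[OF sub] by blast
  qed
qed simp

text \<open>Marking the literals of a model and propagating them never leaves that model and never
  forgets a value. The fixed point is therefore closed, agrees with \<open>a\<close> and still
  contains the chosen variables, as the comparison with the subsolver demands.\<close>

lemma chosen_ok_complete:
  assumes "models a cs" "\<forall>l\<in>set ls. a (fst l) = snd l"
    "up_determines (assign (set (map set cs)) (fst ` set ls) a)"
  shows "chosen_ok cs ls"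
proof -
  have step: "agrees a (fold (\<lambda>l m. set_lit m l) ls m) \<and>
      dom m \<union> fst ` set ls \<subseteq> dom (fold (\<lambda>l m. set_lit m l) ls m)" if "agrees a m" for m
    using assms(2) that
  proof (induction ls arbitrary: m)
    case (Cons l ls)
    have "insert (fst l) (dom m) \<subseteq> dom (set_lit m l)" by (auto simp: set_lit_def)
    moreover have "agrees a (set_lit m l)" using Cons.prems by (simp add: agrees_set_lit)
    ultimately show ?case using Cons.IH[of "set_lit m l"] Cons.prems(1)
      by (simp only: fold.simps comp_apply list.set image_insert) blast
  qed simp
  have "agrees a (\<lambda>_. None)" by (simp add: agrees_def)
  from step[OF this] have m0: "agrees a (assign_lits ls)" "fst ` set ls \<subseteq> dom (assign_lits ls)"
    unfolding assign_lits_def by blast+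
  define m where "m n = (prop_round cs ^^ n) (assign_lits ls)" for n
  have m: "agrees a (m n) \<and> assign_lits ls \<subseteq>\<^sub>m m n" for n
  proof (induction n)
    case (Suc n)
    have e: "m (Suc n) = prop_round cs (m n)" by (simp add: m_def)
    have "m n \<subseteq>\<^sub>m prop_round cs (m n)" unfolding prop_round_def by (rule map_le_fold_prop_lit)
    then have "assign_lits ls \<subseteq>\<^sub>m prop_round cs (m n)" using Suc by (blast intro: map_le_trans)
    then show ?case unfolding e using agrees_prop_round[OF _ assms(1)] Suc by blast
  qed (simp add: m_def m0)
  let ?m = "m (length (enc_formula cs))"
  have "closed_up cs ?m" unfolding m_def by (rule closed_up_if_fixed[OF prop_round_fixpoint])
  moreover have "fst ` set ls \<subseteq> dom ?m" 
    using map_le_implies_dom_le[OF conjunct2[OF m]] m0(2) by (rule order_trans[rotated])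
  ultimately show ?thesis
    using satisfied_if_determined[of a ?m cs "fst ` set ls"] m assms(1,3)
    unfolding up_determines_def unit_prop_def chosen_ok_def m_def by blast
qed

text \<open>Choices are pushed in front of the accumulator, so a list chosen from left to right
  arrives reversed. Only the variables have to occur in the formula, since both polarities are
  tried.\<close>

lemma search_ok_intro:
  assumes "chosen_ok cs (rev ls @ acc)" "\<forall>l\<in>set ls. fst l \<in> fst ` set (concat cs)"
  shows "search_ok cs (length ls) acc"
  using assms
proof (induction ls arbitrary: acc)
  case (Cons l ls)
  have "fst l \<in> fst ` set (concat cs)" using Cons.prems(2) by (simp del: set_concat)
  then obtain l' where l': "l' \<in> set (concat cs)" "fst l' = fst l" by (metis imageE)
  have "search_ok cs (length ls) (l # acc)" using Cons by simp
  moreover have "l = l' \<or> l = (fst l', \<not> snd l')" using l'(2) by (auto simp: prod_eq_iff)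
  ultimately show ?case using l'(1) by auto
qed simp

lemma search_ok_sound: "search_ok cs j ls \<Longrightarrow> \<exists>a. models a cs"
proof (induction j arbitrary: ls)
  case 0
  then show ?case using satisfied_imp_models by (auto simp: chosen_ok_def)
qed auto

lemma search_ok_iff:
  assumes "strong_backdoor_up (set (map set cs)) S" "card S \<le> k"
  shows "search_ok cs k [] \<longleftrightarrow> cnf_sat (set (map set cs))"
proof
  assume "cnf_sat (set (map set cs))"
  then obtain a where a: "models a cs" unfolding cnf_sat_iff ..
  have S: "S \<noteq> {}" "S \<subseteq> fst ` set (concat cs)" "up_determines (assign (set (map set cs)) S a)"
    using assms(1) by (auto simp: strong_backdoor_up_def vars_def)
  have "finite S" using S(2) by (rule finite_subset) simp
  then obtain xs where xs: "set xs = S" "length xs = card S"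
    using finite_distinct_list distinct_card by metis
  obtain x where x: "x \<in> S" using S(1) by blast
  \<comment> \<open>The search makes exactly \<open>k\<close> choices; a smaller backdoor is padded
    with copies of one of its elements, which exists because \<open>S\<close> is nonempty.\<close>
  define ls where "ls = map (\<lambda>x. (x, a x)) (xs @ replicate (k - card S) x)"
  have "set ls = (\<lambda>x. (x, a x)) ` S"
    using xs(1) x by (auto simp: ls_def set_replicate_conv_if)
  then have ls: "length ls = k" "fst ` set ls = S" "\<forall>l\<in>set ls. a (fst l) = snd l"
    using xs(2) assms(2) by (auto simp: ls_def image_image)
  have "chosen_ok cs (rev ls @ [])"
    by (rule chosen_ok_complete[OF a]) (use ls S(3) in auto)
  then have "search_ok cs (length ls) []"
    by (rule search_ok_intro) (use ls(2) S(2) in auto)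
  then show "search_ok cs k []" by (simp add: ls(1))
qed (use search_ok_sound cnf_sat_iff in blast)

section \<open>The decision procedure\<close>

text \<open>Only codes up to 5 occur; the default 1 keeps the pushed value positive and below
  \<open>B\<close> for every argument.\<close>

definition shift :: "nat \<Rightarrow> nat" where
  "shift x = (if x \<le> 5 then x + 1 else 1)"

lemma code_bounds: "0 < code s" "code s \<le> 5"
  by (cases s; simp add: code_def)+

lemma shift_code: "shift (code s) = Suc (code s)"
  using code_bounds(2)[of s] by (simp add: shift_def)

lemma tm_rep_init:
  assumes "\<sigma> TQ = [3]" "\<sigma> TL = []" "\<sigma> TR = map (\<lambda>s. code s + 1) w"
  shows "tm_rep TL TR TQ \<sigma> (init_config w)"
  using assms by (auto simp: tm_rep_def init_config_def cell_at_def)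

lemma runs_sim_word:
  assumes "wf_tm M" "fst (tm_run M w T) < 2"
    "\<sigma> TQ = [3]" "\<sigma> TL = []" "\<sigma> TR = map (\<lambda>s. code s + 1) w"
  shows "\<exists>\<sigma>'. runs (sim_tm M TL TR TQ) \<sigma> (9 * T + 1) \<sigma>' \<and> tm_rep TL TR TQ \<sigma>' (tm_run M w T) \<and>
    length (\<sigma>' TR) \<le> length w + 2 * T \<and> length (\<sigma>' TL) \<le> 2 * T \<and>
    (\<forall>x. x \<notin> {TL, TR, TQ} \<longrightarrow> \<sigma>' x = \<sigma> x)"
proof -
  have "distinct [TL, TR, TQ]" by simp
  from runs_sim_tm[OF assms(1) this tm_valid_init[OF assms(1)] tm_rep_init[OF assms(3-5)]
      assms(2)[unfolded tm_run_def]]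
  show ?thesis unfolding tm_run_def using assms(4,5) by simp
qed

definition start :: "reg com" where
  "start = Seq (mv always Inp [(Tmp, id)]) (Seq (mv always Tmp [(TR, shift)]) (Ops (\<lambda>_. [Push TQ 3])))"

lemma runs_start:
  assumes "10 * length w + 6 \<le> n"
  shows "runs start ((\<lambda>_. [])(Inp := map code w)) n ((\<lambda>_. [])(TR := map (\<lambda>s. code s + 1) w, TQ := [3]))"
proof -
  let ?z = "(\<lambda>_. []) :: reg store"
  have 1: "runs (mv always Inp [(Tmp, id)]) (?z(Inp := map code w)) (5 * length w + 1)
      (?z(Tmp := rev (map code w)))"
  proof (rule runs_mv[where xs = "map code w" and ys = "[]"])
    show "?z(Tmp := rev (map code w)) = (\<lambda>r'. if r' = Inp then [] else case map_of [(Tmp, id)] r' of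
        None \<Rightarrow> (?z(Inp := map code w)) r' | Some f \<Rightarrow> rev (map f (map code w)) @ (?z(Inp := map code w)) r')"
      by (rule ext) simp
  qed (use code_bounds in auto)
  have 2: "runs (mv always Tmp [(TR, shift)]) (?z(Tmp := rev (map code w))) (5 * length w + 1)
      (?z(TR := map (\<lambda>s. code s + 1) w))"
  proof (rule runs_mv[where xs = "rev (map code w)" and ys = "[]"])
    show "?z(TR := map (\<lambda>s. code s + 1) w) = (\<lambda>r'. if r' = Tmp then [] else case map_of [(TR, shift)] r' of
        None \<Rightarrow> (?z(Tmp := rev (map code w))) r'
      | Some f \<Rightarrow> rev (map f (rev (map code w))) @ (?z(Tmp := rev (map code w))) r')"
      by (rule ext) (simp add: shift_code rev_map)
  qed (use code_bounds in auto)
  have 3: "runs (Ops (\<lambda>_. [Push TQ 3])) (?z(TR := map (\<lambda>s. code s + 1) w)) 2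
      (?z(TR := map (\<lambda>s. code s + 1) w, TQ := [3]))"
    by (rule runs_Ops[OF refl]) simp_all
  show ?thesis unfolding start_def by (rule runs_Seq[OF 1 runs_Seq[OF 2 3 order_refl]]) (use assms in simp)
qed

text \<open>The output starts at the head and ends at the first blank, which appears as a stored 1
  or as the end of the stack; proper symbols are stored as 2 or more.\<close>

definition read_output :: "reg com" where
  "read_output = Seq (mv (\<lambda>x. 2 \<le> x) TR [(Tmp, \<lambda>x. x - 1)])
     (Seq (mv always Tmp [(Gr, id)]) (Seq (clear TL) (Seq (clear TR) (Ops (\<lambda>_. [Pop TQ])))))"

lemma output_prefix:
  assumes "tm_rep TL TR TQ \<sigma> (q, t, h)" "\<forall>i<length u. t (h + int i) = code (u ! i)"
    "t (h + int (length u)) = 0"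
  shows "\<exists>ys. \<sigma> TR = map (\<lambda>s. code s + 1) u @ ys \<and> (ys = [] \<or> hd ys \<le> 1)"
proof -
  have c: "\<And>i. t (h + int i) = cell_at (\<sigma> TR) i" using assms(1) by (simp add: tm_rep_def)
  have el: "i < length (\<sigma> TR) \<and> \<sigma> TR ! i = code (u ! i) + 1" if "i < length u" for i
    using c[of i] assms(2) that code_bounds(1)[of "u ! i"] by (auto simp: cell_at_def split: if_splits)
  have len: "length u \<le> length (\<sigma> TR)"
    using el[of "length u - 1"] by (cases "u = []") auto
  have tk: "take (length u) (\<sigma> TR) = map (\<lambda>s. code s + 1) u"
    by (rule nth_equalityI) (use len el in auto)
  let ?ys = "drop (length u) (\<sigma> TR)"
  have "?ys = [] \<or> hd ?ys \<le> 1"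
  proof (cases "length u < length (\<sigma> TR)")
    case True
    then show ?thesis using c[of "length u"] assms(3) by (simp add: cell_at_def hd_drop_conv_nth)
  qed simp
  then show ?thesis using tk by (metis append_take_drop_id)
qed

lemma runs_read_output:
  assumes "\<sigma> TQ = [q]" "0 \<notin> set (\<sigma> TL)" "0 \<notin> set (\<sigma> TR)" "\<And>x. x \<notin> {TL, TR, TQ} \<Longrightarrow> \<sigma> x = []"
    "\<sigma> TR = map (\<lambda>s. code s + 1) u @ ys" "ys = [] \<or> hd ys \<le> 1"
    "10 * length u + 4 * length (\<sigma> TL) + 4 * length (\<sigma> TR) + 10 \<le> n"
  shows "runs read_output \<sigma> n ((\<lambda>_. [])(Gr := map code u))"
proof -
  let ?z = "(\<lambda>_. []) :: reg store"
  let ?c = "map code u" and ?c' = "map (\<lambda>s. code s + 1) u"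
  let ?\<sigma>1 = "?z(TL := \<sigma> TL, TQ := [q], TR := ys, Tmp := rev ?c)"
  let ?\<sigma>2 = "?z(TL := \<sigma> TL, TQ := [q], TR := ys, Gr := ?c)"
  have 1: "runs (mv (\<lambda>x. 2 \<le> x) TR [(Tmp, \<lambda>x. x - 1)]) \<sigma> (5 * length u + 1) ?\<sigma>1"
  proof (rule runs_mv[where xs = ?c' and ys = ys])
    show "?\<sigma>1 = (\<lambda>r'. if r' = TR then ys else case map_of [(Tmp, \<lambda>x. x - 1)] r' of
        None \<Rightarrow> \<sigma> r' | Some f \<Rightarrow> rev (map f ?c') @ \<sigma> r')"
      by (rule ext, rename_tac x, case_tac x) (simp_all add: assms(1,4) comp_def)
    show "0 < x \<and> 2 \<le> x" if "x \<in> set ?c'" for x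
    proof -
      from that obtain s where "x = code s + 1" by auto
      then show ?thesis using code_bounds(1)[of s] by simp
    qed
    show "ys = [] \<or> \<not> 2 \<le> hd ys" using assms(6) by auto
  qed (use assms(5) in simp_all)
  have 2: "runs (mv always Tmp [(Gr, id)]) ?\<sigma>1 (5 * length u + 1) ?\<sigma>2"
  proof (rule runs_mv[where xs = "rev ?c" and ys = "[]"])
    show "?\<sigma>2 = (\<lambda>r'. if r' = Tmp then [] else case map_of [(Gr, id)] r' of
        None \<Rightarrow> ?\<sigma>1 r' | Some f \<Rightarrow> rev (map f (rev ?c)) @ ?\<sigma>1 r')"
      by (rule ext, rename_tac x, case_tac x; simp)
  qed (use code_bounds in auto)
  have 3: "runs (clear TL) ?\<sigma>2 (4 * length (\<sigma> TL) + 1) (?z(TQ := [q], TR := ys, Gr := ?c))"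
  proof (rule runs_clear)
    show "?z(TQ := [q], TR := ys, Gr := ?c) = ?\<sigma>2(TL := [])"
      by (rule ext, rename_tac x, case_tac x; simp)
  qed (use assms(2) in simp_all)
  have 4: "runs (clear TR) (?z(TQ := [q], TR := ys, Gr := ?c)) (4 * length (\<sigma> TR) + 1) (?z(TQ := [q], Gr := ?c))"
  proof (rule runs_clear)
    show "?z(TQ := [q], Gr := ?c) = (?z(TQ := [q], TR := ys, Gr := ?c))(TR := [])"
      by (rule ext, rename_tac x, case_tac x; simp)
  qed (use assms(3,5) in simp_all)
  have 5: "runs (Ops (\<lambda>_. [Pop TQ])) (?z(TQ := [q], Gr := ?c)) 2 (?z(Gr := ?c))"
    by (rule runs_Ops[OF refl]) (simp_all add: fun_eq_iff)
  show ?thesis unfolding read_output_def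
    by (rule runs_Seq[OF 1 runs_Seq[OF 2 runs_Seq[OF 3 runs_Seq[OF 4 5 order_refl] order_refl] order_refl]])
      (use assms(7) in simp)
qed

definition restart :: "reg com" where
  "restart = Seq (copy Tmp Gr TR shift) (Ops (\<lambda>_. [Push TQ 3]))"

lemma runs_restart:
  assumes "11 * length u + 6 \<le> n"
  shows "runs restart ((\<lambda>_. [])(Gr := map code u)) n
     ((\<lambda>_. [])(Gr := map code u, TR := map (\<lambda>s. code s + 1) u, TQ := [3]))"
proof -
  let ?z = "(\<lambda>_. [])(Gr := map code u) :: reg store"
  have 1: "runs (copy Tmp Gr TR shift) ?z (11 * length u + 3) (?z(TR := map (\<lambda>s. code s + 1) u))"
  proof (rule runs_copy)
    show "?z(TR := map (\<lambda>s. code s + 1) u) = ?z(TR := map shift (?z Gr) @ ?z TR)"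
      by (simp add: shift_code comp_def)
    show "0 \<notin> set (?z Gr)" using code_bounds(1) by auto (metis less_irrefl)
  qed simp_all
  have 2: "runs (Ops (\<lambda>_. [Push TQ 3])) (?z(TR := map (\<lambda>s. code s + 1) u)) 2
     (?z(TR := map (\<lambda>s. code s + 1) u, TQ := [3]))"
    by (rule runs_Ops[OF refl]) simp_all
  show ?thesis unfolding restart_def by (rule runs_Seq[OF 1 2]) (use assms in simp)
qed

text \<open>\<open>TQ\<close> holds 1 exactly if the simulated machine accepted, and only then is
  the content of \<open>Gr\<close> known to encode a formula. Otherwise \<open>Res\<close> stays
  empty, which means rejection.\<close>

definition finish :: "nat \<Rightarrow> reg com" where
  "finish k = Seq (clear TL) (Seq (clear TR)
     (Cond (\<lambda>v. v TQ = 1) (Seq (Ops (\<lambda>_. [Pop TQ])) (search k)) Skip))"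

lemma enc_cnf_code: "map code (enc_cnf cs) = enc_formula cs"
proof -
  have l: "map code (enc_lit l) = enc_marked (\<lambda>_. None) l" for l
    by (simp add: enc_lit_def enc_marked_def stat_def sign_code_def bits_def code_def)
  have "map code (enc_clause C) = concat (map (enc_marked (\<lambda>_. None)) C) @ [5]" for C
    by (simp add: enc_clause_def map_concat comp_def l) (simp add: code_def)
  then show ?thesis by (induction cs) (simp_all add: enc_cnf_def enc_clauses_def)
qed

lemma runs_finish:
  assumes "\<sigma> TQ = [q]" "0 \<notin> set (\<sigma> TL)" "0 \<notin> set (\<sigma> TR)" "\<sigma> Gr = map code u"
    "\<And>x. x \<notin> {TL, TR, TQ, Gr} \<Longrightarrow> \<sigma> x = []" "q = 1 \<Longrightarrow> u = enc_cnf cs"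
    "length u \<le> U" "4 * length (\<sigma> TL) + 4 * length (\<sigma> TR) + search_time k ((k + 1) * U) + 8 \<le> n"
  shows "\<exists>\<sigma>'. runs (finish k) \<sigma> n \<sigma>' \<and> (top0 (\<sigma>' Res) \<noteq> 0 \<longleftrightarrow> q = 1 \<and> search_ok cs k [])"
proof -
  let ?\<sigma>2 = "(\<lambda>_. [])(TQ := [q], Gr := map code u) :: reg store"
  have 1: "runs (clear TL) \<sigma> (4 * length (\<sigma> TL) + 1) (\<sigma>(TL := []))"
    by (rule runs_clear) (use assms(2) in simp_all)
  have 2: "runs (clear TR) (\<sigma>(TL := [])) (4 * length (\<sigma> TR) + 1) ?\<sigma>2"
  proof (rule runs_clear)
    show "?\<sigma>2 = (\<sigma>(TL := []))(TR := [])"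
      by (rule ext, rename_tac x, case_tac x) (simp_all add: assms(1,4,5))
  qed (use assms(3) in simp_all)
  have "\<exists>\<sigma>'. runs (Cond (\<lambda>v. v TQ = 1) (Seq (Ops (\<lambda>_. [Pop TQ])) (search k)) Skip) ?\<sigma>2
      (search_time k ((k + 1) * U) + 4) \<sigma>' \<and> (top0 (\<sigma>' Res) \<noteq> 0 \<longleftrightarrow> q = 1 \<and> search_ok cs k [])"
  proof (cases "q = 1")
    case True
    have g: "map code u = enc_formula cs" using assms(6)[OF True] enc_cnf_code by simp
    have len: "length (enc_formula cs) = length u" using g by (metis length_map)
    have a: "runs (Ops (\<lambda>_. [Pop TQ])) ?\<sigma>2 2 (st (enc_formula cs) [] (enc_toks (map Some [])) [] [] [] [] (flag False))"
    proof (rule runs_Ops[OF refl])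
      show "fold app_op [Pop TQ] ?\<sigma>2 = st (enc_formula cs) [] (enc_toks (map Some [])) [] [] [] [] (flag False)"
        by (rule ext, rename_tac x, case_tac x) (simp_all add: g)
    qed simp
    have b: "runs (search k) (st (enc_formula cs) [] (enc_toks (map Some [])) [] [] [] [] (flag False))
        (search_time k ((k + 1) * U))
        (st (enc_formula cs) [] (enc_toks (map Some [])) [] [] [] [] (flag (False \<or> search_ok cs k [])))"
    proof (rule runs_search[OF _ _ order_refl])
      show "length (enc_formula cs) \<le> (k + 1) * U" using assms(7) len by simp
      \<comment> \<open>The size bound \<open>(k + 1) * U\<close> leaves room for \<open>k\<close>
        chosen literals, each at most as long as the formula.\<close>
      have "k * length (enc_formula cs) \<le> (k + 1) * U" using assms(7) len by (intro mult_le_mono) simp_all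
      then show "length (enc_toks (map Some [])) + k * length (enc_formula cs) \<le> (k + 1) * U"
        by (simp only: list.map enc_toks_simps list.size add_0)
    qed
    show ?thesis
      by (intro exI conjI, rule runs_CondT[OF _ runs_Seq[OF a b order_refl]]) (use True in simp_all)
  next
    case False
    have "runs (Cond (\<lambda>v. v TQ = 1) (Seq (Ops (\<lambda>_. [Pop TQ])) (search k)) Skip) ?\<sigma>2
      (search_time k ((k + 1) * U) + 4) ?\<sigma>2"
      by (rule runs_CondF[OF _ runs_Skip[of _ 0]]) (use False in simp_all)
    then show ?thesis using False by (intro exI[of _ ?\<sigma>2]) simp
  qed
  then obtain \<sigma>' where 3: "runs (Cond (\<lambda>v. v TQ = 1) (Seq (Ops (\<lambda>_. [Pop TQ])) (search k)) Skip) ?\<sigma>2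
      (search_time k ((k + 1) * U) + 4) \<sigma>'" and res: "top0 (\<sigma>' Res) \<noteq> 0 \<longleftrightarrow> q = 1 \<and> search_ok cs k []"
    by blast
  have "runs (finish k) \<sigma> n \<sigma>'"
    unfolding finish_def by (rule runs_Seq[OF 1 runs_Seq[OF 2 3 order_refl]]) (use assms(8) in simp)
  then show ?thesis using res by blast
qed

definition decide :: "tm \<Rightarrow> tm \<Rightarrow> nat \<Rightarrow> reg com" where
  "decide Mf MA k = Seq start (Seq (sim_tm Mf TL TR TQ) (Seq read_output
     (Seq restart (Seq (sim_tm MA TL TR TQ) (finish k)))))"

lemma poly_bound_mono: "m \<le> n \<Longrightarrow> poly_bound c m \<le> poly_bound c n"
  by (simp add: poly_bound_def power_mono)

text \<open>For each language in NP the reduction, the test for \<open>A\<close> and the search form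
  a single program, so P-closure under reductions needs no composition of machines.\<close>

theorem theorem2:
  fixes k :: nat and A :: "sym list set"
  assumes "k \<ge> 1"
    and "A \<subseteq> {w. is_formula w}"
    and "in_P A" and "NP_complete (A \<inter> SAT)"
    and "\<forall>G\<in>A. \<exists>S. strong_backdoor_up (cnf_of G) S \<and> card S \<le> k"
    and "\<exists>f. poly_computable f \<and>
           (\<forall>G\<in>A. \<exists>xs. f G = enc_varset xs \<and>
                strong_backdoor_up (cnf_of G) (set xs) \<and> card (set xs) \<le> k)"
  shows "PP = NP"
proof -
  obtain MA cA where MA: "wf_tm MA" "\<And>w. fst (tm_run MA w (poly_bound cA (length w))) < 2"
    "\<And>w. fst (tm_run MA w (poly_bound cA (length w))) = 0 \<longleftrightarrow> w \<in> A"
    using assms(3) unfolding in_P_def by blast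
  have "in_P L" if "in_NP L" for L
  proof -
    obtain f where "poly_computable f" and red: "\<And>w. w \<in> L \<longleftrightarrow> f w \<in> A \<inter> SAT"
      using assms(4) \<open>in_NP L\<close> unfolding NP_complete_def by blast
    then obtain Mf cf where Mf: "wf_tm Mf" and out: "\<And>w. case tm_run Mf w (poly_bound cf (length w)) of (q, t, h) \<Rightarrow>
        q = 0 \<and> (\<forall>i < length (f w). t (h + int i) = code (f w ! i)) \<and> t (h + int (length (f w))) = 0"
      unfolding poly_computable_def by blast
    \<comment> \<open>Bounds the length of the reduced word: it is a prefix of the right stack,
      which a simulated step lengthens by at most two entries.\<close>
    define U where "U n = n + 2 * poly_bound cf n" for n
    define T where "T n = 10 * n + 6 + (9 * poly_bound cf n + 1) + (18 * U n + 10) + (11 * U n + 6)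
      + (9 * poly_bound cA (U n) + 1) +
      (4 * U n + 16 * poly_bound cA (U n) + search_time k ((k + 1) * U n) + 8) + 5" for n
    define B where "B = tm_states Mf + tm_syms Mf + tm_states MA + tm_syms MA + 20"
    have "ok_com B (decide Mf MA k)"
    proof -
      have "ok_com B (mv (\<lambda>x. 2 \<le> x) TR [(Tmp, \<lambda>x. x - 1)])" by (rule ok_mv) auto
      moreover have "10 < B" "tm_states Mf < B" "tm_syms Mf < B" "tm_states MA < B" "tm_syms MA < B"
        by (simp_all add: B_def)
      moreover from this have "ok_com B (sim_tm Mf TL TR TQ)" "ok_com B (sim_tm MA TL TR TQ)" "ok_com B (search k)"
        by (simp_all add: ok_sim_tm Mf MA(1) ok_search)
      ultimately show ?thesis
        by (simp add: decide_def start_def read_output_def restart_def finish_def shift_def)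
    qed
    moreover have "6 \<le> B" by (simp add: B_def)
    moreover have "\<exists>\<sigma>'. runs (decide Mf MA k) ((\<lambda>_. [])(Inp := map code w)) (T (length w)) \<sigma>' \<and>
       (tops \<sigma>' Res \<noteq> 0 \<longleftrightarrow> w \<in> L)" for w
    proof -
      let ?n = "length w" and ?z = "(\<lambda>_. []) :: reg store"
      define u where "u = f w"
      define Tf where "Tf = poly_bound cf ?n"
      define TA where "TA = poly_bound cA (length u)"
      obtain q t h where qth: "tm_run Mf w Tf = (q, t, h)" by (metis prod_cases3)
      have q: "q = 0" "\<forall>i<length u. t (h + int i) = code (u ! i)" "t (h + int (length u)) = 0"
        using out[of w] qth by (simp_all add: u_def Tf_def)
      let ?\<sigma>1 = "?z(TR := map (\<lambda>s. code s + 1) w, TQ := [3])"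
      have "fst (tm_run Mf w Tf) < 2" using qth q by simp
      from runs_sim_word[OF Mf this, of ?\<sigma>1] obtain \<sigma>2 where \<sigma>2:
        "runs (sim_tm Mf TL TR TQ) ?\<sigma>1 (9 * Tf + 1) \<sigma>2" "tm_rep TL TR TQ \<sigma>2 (q, t, h)"
        "length (\<sigma>2 TR) \<le> ?n + 2 * Tf" "length (\<sigma>2 TL) \<le> 2 * Tf" "\<And>x. x \<notin> {TL, TR, TQ} \<Longrightarrow> \<sigma>2 x = []"
        unfolding qth by auto
      have nz2: "\<sigma>2 TQ = [1]" "0 \<notin> set (\<sigma>2 TL)" "0 \<notin> set (\<sigma>2 TR)" using \<sigma>2(2) q(1) by (auto simp: tm_rep_def)
      obtain ys where ys: "\<sigma>2 TR = map (\<lambda>s. code s + 1) u @ ys" "ys = [] \<or> hd ys \<le> 1"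
        using output_prefix[OF \<sigma>2(2) q(2,3)] by blast
      have u: "length u \<le> U ?n" using ys(1) \<sigma>2(3) by (simp add: U_def Tf_def)
      have TA: "TA \<le> poly_bound cA (U ?n)" unfolding TA_def by (rule poly_bound_mono[OF u])
      have 3: "runs read_output \<sigma>2 (18 * U ?n + 10) (?z(Gr := map code u))"
        by (rule runs_read_output[OF nz2 \<sigma>2(5) ys]) (use u \<sigma>2(3,4) in \<open>simp_all add: U_def Tf_def\<close>)
      have 4: "runs restart (?z(Gr := map code u)) (11 * U ?n + 6)
          (?z(Gr := map code u, TR := map (\<lambda>s. code s + 1) u, TQ := [3]))" (is "runs _ _ _ ?\<sigma>4")
        by (rule runs_restart) (use u in simp)
      have "fst (tm_run MA u TA) < 2" unfolding TA_def by (rule MA(2))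
      from runs_sim_word[OF MA(1) this, of ?\<sigma>4] obtain \<sigma>5 where \<sigma>5:
        "runs (sim_tm MA TL TR TQ) ?\<sigma>4 (9 * TA + 1) \<sigma>5" "tm_rep TL TR TQ \<sigma>5 (tm_run MA u TA)"
        "length (\<sigma>5 TR) \<le> length u + 2 * TA" "length (\<sigma>5 TL) \<le> 2 * TA"
        "\<forall>x. x \<notin> {TL, TR, TQ} \<longrightarrow> \<sigma>5 x = ?\<sigma>4 x"
        by auto
      define p where "p = fst (tm_run MA u TA)"
      have nz5: "\<sigma>5 TQ = [p + 1]" "0 \<notin> set (\<sigma>5 TL)" "0 \<notin> set (\<sigma>5 TR)"
        using \<sigma>5(2) by (auto simp: tm_rep_def p_def split: prod.splits)
      have p: "p + 1 = 1 \<longleftrightarrow> u \<in> A" using MA(3)[of u] by (simp add: p_def TA_def)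
      \<comment> \<open>The same choice as in \<open>cnf_of\<close>, so both speak of one clause
        list and unique decoding does not have to be proved.\<close>
      define cs where "cs = (SOME cs. u = enc_cnf cs)"
      have cs: "u = enc_cnf cs" if "u \<in> A"
        using assms(2) that unfolding cs_def is_formula_def by (auto intro: someI_ex)
      have cs': "u = enc_cnf cs" if "p + 1 = 1" using cs p that by blast
      have s5: "\<sigma>5 Gr = map code u" "\<And>x. x \<notin> {TL, TR, TQ, Gr} \<Longrightarrow> \<sigma>5 x = []"
        using \<sigma>5(5) by simp_all
      have "4 * length (\<sigma>5 TL) + 4 * length (\<sigma>5 TR) + search_time k ((k + 1) * U ?n) + 8 \<le>
        4 * U ?n + 16 * poly_bound cA (U ?n) + search_time k ((k + 1) * U ?n) + 8"
        using \<sigma>5(3,4) u TA by linarith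
      from runs_finish[OF nz5 s5 cs' u this] obtain \<sigma>6 where
        6: "runs (finish k) \<sigma>5 (4 * U ?n + 16 * poly_bound cA (U ?n) + search_time k ((k + 1) * U ?n) + 8) \<sigma>6"
        and res: "top0 (\<sigma>6 Res) \<noteq> 0 \<longleftrightarrow> p + 1 = 1 \<and> search_ok cs k []" by blast
      have r: "runs (decide Mf MA k) (?z(Inp := map code w)) (T ?n) \<sigma>6"
        unfolding decide_def
        by (rule runs_Seq[OF runs_start[OF order_refl] runs_Seq[OF \<sigma>2(1) runs_Seq[OF 3 runs_Seq[OF 4
            runs_Seq[OF \<sigma>5(1) 6 order_refl] order_refl] order_refl] order_refl]])
          (use TA in \<open>simp add: T_def Tf_def\<close>)
      have "u \<in> A \<and> search_ok cs k [] \<longleftrightarrow> u \<in> A \<inter> SAT"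
      proof (cases "u \<in> A")
        case True
        have F: "cnf_of u = set (map set cs)" by (simp add: cnf_of_def cs_def)
        obtain S where "strong_backdoor_up (set (map set cs)) S" "card S \<le> k"
          using assms(5) True unfolding F[symmetric] by blast
        from search_ok_iff[OF this] have "search_ok cs k [] \<longleftrightarrow> cnf_sat (cnf_of u)" unfolding F .
        then show ?thesis using True assms(2) unfolding SAT_def by blast
      qed simp
      then have "tops \<sigma>6 Res \<noteq> 0 \<longleftrightarrow> w \<in> L" using res p red[of w] u_def by blast
      then show ?thesis using r by blast
    qed
    moreover have "poly_bounded T"
    proof -
      have U: "poly_bounded U" unfolding U_def by (intro poly_bounded_intros poly_bounded_poly_bound)
      have "poly_bounded (\<lambda>n. poly_bound cA (U n))"
        by (rule poly_bounded_compose[OF poly_bounded_poly_bound U])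
      moreover have "poly_bounded (\<lambda>n. search_time k ((k + 1) * U n))"
        by (rule poly_bounded_compose[OF poly_bounded_search_time]) (intro poly_bounded_intros U)
      ultimately show ?thesis
        unfolding T_def by (intro poly_bounded_intros poly_bounded_poly_bound U)
    qed
    ultimately show ?thesis
      by (rule in_P_if_program[where acc = "\<lambda>v. v Res \<noteq> 0"])
  qed
  then show ?thesis using in_P_imp_in_NP unfolding PP_def NP_def by blast
qed

end
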